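(* Let $G=(V,E)$ be a simple, connected, bridgeless cubic graph with $n=|V|\geq 6$. Then $G$ has a graph-TSP tour of length at most $\frac{4}{3}n-2$; equivalently, $G$ has a spanning Eulerian multi-subgraph with at most $\frac{4}{3}n-2$ edges.
   Context: A graph is cubic if every vertex has degree exactly 3. A bridge is an edge whose removal disconnects the graph; bridgeless means there is no bridge. For a connected graph $G$, the graph-TSP on $G$ asks for a minimum cost Hamiltonian cycle in the metric completion of $G$, i.e. the complete graph on $V$ where the cost between two vertices is the number of edges on a shortest path between them in $G$. A spanning Eulerian multi-subgraph of $G$ is a connected multigraph on vertex set $V$ whose edges are copies of edges of $G$ (an edge of $G$ may be used several times) and in which every vertex has even degree. A graph-TSP tour of length $L$ exists if and only if a spanning Eulerian multi-subgraph with $L$ edges exists. *)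

theory Defs
  imports Complex_Main "HOL-Library.Multiset"
begin

definition simple_graph :: "'a set \<Rightarrow> 'a set set \<Rightarrow> bool" where
  "simple_graph V E \<longleftrightarrow> finite V \<and> (\<forall>e\<in>E. e \<subseteq> V \<and> card e = 2)"

definition degree :: "'a set set \<Rightarrow> 'a \<Rightarrow> nat" where
  "degree E v = card {e \<in> E. v \<in> e}"

definition cubic :: "'a set \<Rightarrow> 'a set set \<Rightarrow> bool" where
  "cubic V E \<longleftrightarrow> (\<forall>v\<in>V. degree E v = 3)"

text \<open>A path is its list of vertices; its number of edges is \<open>length p - 1\<close>.\<close>

definition path_between :: "'a set \<Rightarrow> 'a set set \<Rightarrow> 'a \<Rightarrow> 'a \<Rightarrow> 'a list \<Rightarrow> bool" where
  "path_between V E u v p \<longleftrightarrow>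
     p \<noteq> [] \<and> hd p = u \<and> last p = v \<and> set p \<subseteq> V \<and> distinct p \<and>
     successively (\<lambda>x y. {x, y} \<in> E) p"

definition connected_graph :: "'a set \<Rightarrow> 'a set set \<Rightarrow> bool" where
  "connected_graph V E \<longleftrightarrow> V \<noteq> {} \<and> (\<forall>u\<in>V. \<forall>v\<in>V. \<exists>p. path_between V E u v p)"

definition bridge :: "'a set \<Rightarrow> 'a set set \<Rightarrow> 'a set \<Rightarrow> bool" where
  "bridge V E e \<longleftrightarrow> e \<in> E \<and> \<not> connected_graph V (E - {e})"

definition bridgeless :: "'a set \<Rightarrow> 'a set set \<Rightarrow> bool" where
  "bridgeless V E \<longleftrightarrow> (\<nexists>e. bridge V E e)"

text \<open>The distance is only meaningful for vertices joined by a path.\<close>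

definition graph_dist :: "'a set \<Rightarrow> 'a set set \<Rightarrow> 'a \<Rightarrow> 'a \<Rightarrow> nat" where
  "graph_dist V E u v = (LEAST k. \<exists>p. path_between V E u v p \<and> k = length p - 1)"

definition complete_edges :: "'a set \<Rightarrow> 'a set set" where
  "complete_edges V = {e. e \<subseteq> V \<and> card e = 2}"

text \<open>A Hamiltonian cycle lists every vertex once; the last vertex is joined back to the first.\<close>

definition hamiltonian_cycle :: "'a set \<Rightarrow> 'a set set \<Rightarrow> 'a list \<Rightarrow> bool" where
  "hamiltonian_cycle V E c \<longleftrightarrow>
     length c \<ge> 3 \<and> distinct c \<and> set c = V \<and>
     (\<forall>i<length c. {c ! i, c ! (Suc i mod length c)} \<in> E)"

definition tsp_tour :: "'a set \<Rightarrow> 'a list \<Rightarrow> bool" where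
  "tsp_tour V c \<longleftrightarrow> hamiltonian_cycle V (complete_edges V) c"

definition tour_length :: "'a set \<Rightarrow> 'a set set \<Rightarrow> 'a list \<Rightarrow> nat" where
  "tour_length V E c =
     (\<Sum>i<length c. graph_dist V E (c ! i) (c ! (Suc i mod length c)))"

text \<open>A multi-subgraph on \<open>V\<close> is the multiset \<open>F\<close> of its edges, each a copy of an edge in \<open>E\<close>.
  There are no loops, so counting edges at a vertex with multiplicity gives its degree.\<close>

definition spanning_eulerian :: "'a set \<Rightarrow> 'a set set \<Rightarrow> 'a set multiset \<Rightarrow> bool" where
  "spanning_eulerian V E F \<longleftrightarrow>
     set_mset F \<subseteq> E \<and> connected_graph V (set_mset F) \<and>
     (\<forall>v\<in>V. even (size {#e \<in># F. v \<in> e#}))"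

end

theory Submission
  imports Defs
begin

text \<open>
  It suffices to find an even edge set \<open>F\<close> of \<open>G\<close> with \<open>3 (\<bar>F\<bar> + 2 c) \<le> 4 n\<close>, where \<open>c\<close> is the
  number of components of \<open>(V, F)\<close>: doubling \<open>c - 1\<close> edges that connect these components gives a
  spanning Eulerian multi-subgraph, and shortcutting a closed trail in it gives the tour.

  The constant vector \<open>1/3\<close> lies in the perfect matching polytope of a cubic bridgeless graph, so
  by Edmonds' theorem any edge set \<open>D\<close> contains at most \<open>\<bar>D\<bar> / 3\<close> edges of some perfect matching
  \<open>M\<close>. Peeling off the vertices of \<open>G\<close> one by one produces a set \<open>D\<close> of at most \<open>n/2 - 1\<close> edges
  for which the 2-factor complementary to any \<open>M\<close> has at most \<open>1 + \<bar>M \<inter> D\<bar>\<close> cycles. Hence there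
  is a 2-factor with at most \<open>(n + 4) / 6\<close> cycles, which is good enough if \<open>n\<close> is divisible by
  \<open>6\<close>. If all cycles have length at least \<open>6\<close> then any 2-factor is good enough. In the remaining
  cases a triangle, a 4-cycle or a 5-cycle is replaced by something smaller, so that the number of
  vertices drops by \<open>2\<close> or \<open>4\<close>. A 2-factor or an even edge set of the smaller graph, obtained
  from the bound above or by induction, is lifted back to \<open>G\<close>. Only two triangles sharing an edge
  need an extra argument, because contracting a triangle then creates parallel edges.
\<close>

subsection \<open>Edmonds' perfect matching theorem\<close>

text \<open>A 2-factor has n edges, so it meets the target exactly when it has at most n/6 cycles.
  The size of \<open>D\<close> is the cyclomatic number of G minus a vertex, (3n/2 - 3) - (n - 1) +
  1 = n/2 - 1, whence (n + 4)/6. The obstacle is a rounding error: n is even, and the residues 2 and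
  4 modulo 6 miss by one cycle. Contracting a triangle, or replacing a 4-cycle with a penalty on one
  edge, lowers the numerator to n + 2 and settles residue 2. For residue 4 induction is used: two
  vertices fewer lower 4n/3 by 8/3 while the lift may cost 3, and rounding absorbs the difference. A
  pentagon removes four vertices at cost 5 < 16/3, whatever the residue. Edges are names with an end
  map \<open>h\<close>, so that edge sets and weights carry over when contraction creates parallel
  edges. The 2-factor bound holds for such multigraphs, but the induction needs
  \<open>inj_on h E\<close>: otherwise a 2-factor may have cycles of length two. For two triangles
  sharing an edge the 2-factor bound is therefore applied without induction, to G itself or after
  two reductions.\<close>

definition mgraph :: "'v set \<Rightarrow> 'e set \<Rightarrow> ('e \<Rightarrow> 'v set) \<Rightarrow> bool" where
  "mgraph V E h \<longleftrightarrow> finite V \<and> finite E \<and> (\<forall>e\<in>E. h e \<subseteq> V \<and> card (h e) = 2)"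

definition inc :: "('e \<Rightarrow> 'v set) \<Rightarrow> 'e set \<Rightarrow> 'v \<Rightarrow> 'e set" where
  "inc h F v = {e \<in> F. v \<in> h e}"

definition cut :: "('e \<Rightarrow> 'v set) \<Rightarrow> 'e set \<Rightarrow> 'v set \<Rightarrow> 'e set" where
  "cut h F X = {e \<in> F. h e \<inter> X \<noteq> {} \<and> \<not> h e \<subseteq> X}"

definition perfect_matching :: "'v set \<Rightarrow> 'e set \<Rightarrow> ('e \<Rightarrow> 'v set) \<Rightarrow> 'e set \<Rightarrow> bool" where
  "perfect_matching V E h M \<longleftrightarrow> M \<subseteq> E \<and> (\<forall>v\<in>V. card (inc h M v) = 1)"

text \<open>These are Edmonds' inequalities for the perfect matching polytope. The odd cuts exclude,
  for instance, the value 1/2 on all edges of two disjoint triangles.\<close>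

definition fractional_pm :: "'v set \<Rightarrow> 'e set \<Rightarrow> ('e \<Rightarrow> 'v set) \<Rightarrow> ('e \<Rightarrow> real) \<Rightarrow> bool" where
  "fractional_pm V E h x \<longleftrightarrow> (\<forall>e\<in>E. 0 \<le> x e) \<and> (\<forall>v\<in>V. sum x (inc h E v) = 1) \<and>
     (\<forall>X\<subseteq>V. odd (card X) \<longrightarrow> 1 \<le> sum x (cut h E X))"

text \<open>Optimisation form of the theorem: no linear objective separates \<open>x\<close> from
  the perfect matchings. This avoids convex combinations and is the form in which the result is
  applied.\<close>

definition edmonds :: "'v set \<Rightarrow> 'e set \<Rightarrow> ('e \<Rightarrow> 'v set) \<Rightarrow> bool" where
  "edmonds V E h \<longleftrightarrow> (\<forall>x w. fractional_pm V E h x \<longrightarrow>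
     (\<exists>M. perfect_matching V E h M \<and> (\<Sum>e\<in>M. w e) \<le> (\<Sum>e\<in>E. w e * x e :: real)))"

lemma inc_subset: "inc h F v \<subseteq> F" and cut_subset: "cut h F X \<subseteq> F"
  by (auto simp: inc_def cut_def)

lemma mgraph_ends:
  assumes "mgraph V E h" "e \<in> E"
  obtains u v where "h e = {u, v}" "u \<noteq> v" "u \<in> V" "v \<in> V"
proof -
  have "card (h e) = 2" "h e \<subseteq> V" using assms by (auto simp: mgraph_def)
  then obtain u v where "h e = {u, v}" "u \<noteq> v" by (meson card_2_iff)
  with \<open>h e \<subseteq> V\<close> that show thesis by auto
qed

lemma mgraph_other_end:
  assumes "mgraph V E h" "e \<in> E" "v \<in> h e"
  obtains u where "h e = {v, u}" "u \<noteq> v" "u \<in> V"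
  using mgraph_ends[OF assms(1,2)] assms(3) by (metis doubleton_eq_iff empty_iff insert_iff)

lemma mgraph_subset: "mgraph V E h \<Longrightarrow> F \<subseteq> E \<Longrightarrow> mgraph V F h"
  by (auto simp: mgraph_def intro: finite_subset)

text \<open>Each edge is counted once for every end that it has in \<open>X\<close>. For constant
  \<open>x\<close> this is the handshake count behind all parity arguments.\<close>

lemma sum_inc:
  fixes x :: "'e \<Rightarrow> 'a :: comm_semiring_1"
  assumes "mgraph V E h" "X \<subseteq> V"
  shows "(\<Sum>v\<in>X. sum x (inc h E v)) = sum x (cut h E X) + 2 * sum x {e \<in> E. h e \<subseteq> X}"
proof -
  have fin: "finite E" "finite X" using assms by (auto simp: mgraph_def intro: finite_subset)
  have "(\<Sum>v\<in>X. sum x (inc h E v)) = (\<Sum>v\<in>X. \<Sum>e\<in>E. if v \<in> h e then x e else 0)"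
    unfolding inc_def by (intro sum.cong refl sum.inter_filter fin)
  also have "\<dots> = (\<Sum>e\<in>E. \<Sum>v\<in>X. if v \<in> h e then x e else 0)"
    by (rule sum.swap)
  also have "\<dots> = (\<Sum>e\<in>E. (if e \<in> cut h E X then x e else 0) + (if h e \<subseteq> X then 2 * x e else 0))"
  proof (intro sum.cong refl)
    fix e assume e: "e \<in> E"
    obtain u v where uv: "h e = {u, v}" "u \<noteq> v" using mgraph_ends[OF assms(1) e] by metis
    have "(\<Sum>v\<in>X. if v \<in> h e then x e else 0) = sum (\<lambda>_. x e) {z \<in> X. z \<in> h e}"
      by (rule sum.inter_filter[symmetric, OF fin(2)])
    also have "{z \<in> X. z \<in> h e} = (if u \<in> X then {u} else {}) \<union> (if v \<in> X then {v} else {})"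
      using uv by auto
    also have "sum (\<lambda>_. x e) \<dots> = (if e \<in> cut h E X then x e else 0) + (if h e \<subseteq> X then 2 * x e else 0)"
      using uv e by (auto simp: cut_def algebra_simps mult_2)
    finally show "(\<Sum>v\<in>X. if v \<in> h e then x e else 0) = \<dots>" .
  qed
  also have "\<dots> = sum x (cut h E X) + 2 * sum x {e \<in> E. h e \<subseteq> X}"
  proof -
    have "(\<Sum>e\<in>E. if e \<in> cut h E X then x e else 0) = sum x (cut h E X)"
      using fin cut_subset[of h E X] by (simp add: sum.inter_restrict[symmetric] Int_absorb1)
    moreover have "(\<Sum>e\<in>E. if h e \<subseteq> X then 2 * x e else 0) = 2 * sum x {e \<in> E. h e \<subseteq> X}"
      using fin by (simp add: sum.inter_filter[symmetric] sum_distrib_left)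
    ultimately show ?thesis by (simp add: sum.distrib)
  qed
  finally show ?thesis .
qed

text \<open>Each step of Gaussian elimination disposes of one equation, which either vanishes
  identically or supplies a pivot \<open>e0\<close>.\<close>

lemma underdetermined_kernel:
  fixes a :: "'v \<Rightarrow> 'e \<Rightarrow> real"
  assumes "finite V" "finite E" "card V < card E"
  shows "\<exists>y. (\<exists>e\<in>E. y e \<noteq> 0) \<and> (\<forall>v\<in>V. (\<Sum>e\<in>E. a v e * y e) = 0)"
  using assms
proof (induction V arbitrary: E a rule: finite_induct)
  case empty
  then have "E \<noteq> {}" by auto
  then show ?case by (intro exI[of _ "\<lambda>_. 1"]) auto
next
  case (insert v V)
  show ?case
  proof (cases "\<forall>e\<in>E. a v e = 0")
    case True
    with insert.IH[of E a] insert.prems insert.hyps show ?thesis by auto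
  next
    case False
    then obtain e0 where e0: "e0 \<in> E" "a v e0 \<noteq> 0" by auto
    \<comment> \<open>Row \<open>u\<close> after subtracting the multiple of row \<open>v\<close>
      that clears column \<open>e0\<close>.\<close>
    define b where "b u e = a u e - a u e0 * a v e / a v e0" for u e
    have "card V < card (E - {e0})" using insert e0 by auto
    with insert.IH[of "E - {e0}" b] insert.prems obtain y where
      y: "\<exists>e\<in>E - {e0}. y e \<noteq> 0" "\<forall>u\<in>V. (\<Sum>e\<in>E - {e0}. b u e * y e) = 0" by auto
    define s where "s = (\<Sum>e\<in>E - {e0}. a v e * y e)"
    \<comment> \<open>The value at \<open>e0\<close> is forced by equation \<open>v\<close>; the
      remaining equations then follow from those of \<open>b\<close>.\<close>
    define z where "z = y(e0 := - s / a v e0)"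
    have split: "(\<Sum>e\<in>E. a u e * z e) = (\<Sum>e\<in>E - {e0}. a u e * y e) - a u e0 * s / a v e0" for u
    proof -
      have "(\<Sum>e\<in>E. a u e * z e) = a u e0 * z e0 + (\<Sum>e\<in>E - {e0}. a u e * z e)"
        using e0 insert.prems by (simp add: sum.remove)
      moreover have "(\<Sum>e\<in>E - {e0}. a u e * z e) = (\<Sum>e\<in>E - {e0}. a u e * y e)"
        by (intro sum.cong) (auto simp: z_def)
      ultimately show ?thesis by (simp add: z_def)
    qed
    have "(\<Sum>e\<in>E. a u e * z e) = 0" if "u \<in> insert v V" for u
    proof (cases "u = v")
      case True
      then show ?thesis using e0 by (simp add: split s_def)
    next
      case False
      with that have "(\<Sum>e\<in>E - {e0}. b u e * y e) = 0" using y by auto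
      moreover have "(\<Sum>e\<in>E - {e0}. b u e * y e) =
          (\<Sum>e\<in>E - {e0}. a u e * y e) - a u e0 / a v e0 * s"
        unfolding s_def sum_distrib_left sum_subtractf[symmetric]
        by (intro sum.cong) (auto simp: b_def algebra_simps)
      ultimately show ?thesis by (simp add: split)
    qed
    moreover have "\<exists>e\<in>E. z e \<noteq> 0" using y(1) by (auto simp: z_def)
    ultimately show ?thesis by blast
  qed
qed

text \<open>This is the ratio test of the simplex method: the step length is the smallest ratio at
  which a decreasing coordinate reaches zero.\<close>

lemma slide_to_boundary:
  fixes a b :: "'j \<Rightarrow> real"
  assumes "finite J" "\<forall>j\<in>J. 0 < a j" "\<exists>j\<in>J. b j < 0"
  shows "\<exists>t>0. (\<forall>j\<in>J. 0 \<le> a j + t * b j) \<and> (\<exists>j\<in>J. a j + t * b j = 0)"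
proof -
  define N where "N = {j \<in> J. b j < 0}"
  define t where "t = Min ((\<lambda>j. a j / - b j) ` N)"
  have N: "finite N" "N \<noteq> {}" using assms by (auto simp: N_def)
  then have "t \<in> (\<lambda>j. a j / - b j) ` N" unfolding t_def by (intro Min_in) auto
  then obtain i where i: "i \<in> N" "t = a i / - b i" by auto
  have "0 < a i" "0 < - b i" using i assms by (auto simp: N_def)
  then have t: "0 < t" unfolding i(2) by (rule divide_pos_pos)
  have "0 \<le> a j + t * b j" if "j \<in> J" for j
  proof (cases "b j < 0")
    case True
    then have "t \<le> a j / - b j" using that N unfolding t_def N_def by (intro Min_le) auto
    with True show ?thesis by (simp add: field_simps)
  next
    case False
    with t assms that show ?thesis by (simp add: add_nonneg_nonneg less_imp_le)
  qed
  moreover have "i \<in> J" "a i + t * b i = 0" using i by (auto simp: N_def)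
  ultimately show ?thesis using t by blast
qed

section \<open>Contracting a vertex set to one of its vertices\<close>

definition contract :: "'v set \<Rightarrow> 'v \<Rightarrow> ('e \<Rightarrow> 'v set) \<Rightarrow> 'e \<Rightarrow> 'v set" where
  "contract U u h e = (\<lambda>v. if v \<in> U then u else v) ` h e"

lemma contract_inc_new:
  "u \<in> U \<Longrightarrow> inc (contract U u h) {e \<in> E. \<not> h e \<subseteq> U} u = cut h E U"
  by (auto simp: inc_def cut_def contract_def split: if_splits)

lemma contract_inc_old:
  assumes "u \<in> U" "v \<notin> U"
  shows "inc (contract U u h) {e \<in> E. \<not> h e \<subseteq> U} v = inc h E v"
  using assms by (auto simp: inc_def contract_def split: if_splits)

lemma contract_cut_avoid:
  assumes "u \<in> U" "X \<inter> U = {}"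
  shows "cut (contract U u h) {e \<in> E. \<not> h e \<subseteq> U} X = cut h E X"
proof -
  have "contract U u h e \<inter> X \<noteq> {} \<longleftrightarrow> h e \<inter> X \<noteq> {}" for e
    using assms by (auto simp: contract_def split: if_splits)
  moreover have "contract U u h e \<subseteq> X \<longleftrightarrow> h e \<subseteq> X" for e
  proof -
    have "u \<notin> X" using assms by auto
    then have "contract U u h e \<subseteq> X \<longleftrightarrow> (\<forall>v\<in>h e. v \<notin> U \<and> v \<in> X)"
      unfolding contract_def by auto
    then show ?thesis using assms by blast
  qed
  moreover have "\<not> h e \<subseteq> U" if "h e \<inter> X \<noteq> {}" for e using that assms by blast
  ultimately show ?thesis by (auto simp: cut_def)
qed

lemma contract_cut_through:
  assumes "u \<in> U" "u \<in> X" "X \<inter> U = {u}"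
  shows "cut (contract U u h) {e \<in> E. \<not> h e \<subseteq> U} X = cut h E (X \<union> U)"
proof -
  have "contract U u h e \<inter> X \<noteq> {} \<longleftrightarrow> h e \<inter> (X \<union> U) \<noteq> {}" for e
    using assms(1,2) by (auto simp: contract_def split: if_splits)
  moreover have "contract U u h e \<subseteq> X \<longleftrightarrow> h e \<subseteq> X \<union> U" for e
  proof -
    have "contract U u h e \<subseteq> X \<longleftrightarrow> (\<forall>v\<in>h e. v \<in> U \<or> v \<in> X)"
      unfolding contract_def image_subset_iff using assms(2) by (intro ball_cong refl) simp
    then show ?thesis unfolding subset_iff by simp metis
  qed
  ultimately show ?thesis by (auto simp: cut_def)
qed

lemma contract_mgraph:
  assumes G: "mgraph V E h" and "u \<in> U" "U \<subseteq> V"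
  shows "mgraph (insert u (V - U)) {e \<in> E. \<not> h e \<subseteq> U} (contract U u h)"
proof -
  have "contract U u h e \<subseteq> insert u (V - U) \<and> card (contract U u h e) = 2"
    if e: "e \<in> E" "\<not> h e \<subseteq> U" for e
  proof -
    obtain a b where ab: "h e = {a, b}" "a \<noteq> b" "a \<in> V" "b \<in> V" using mgraph_ends[OF G e(1)] .
    then have "contract U u h e = {if a \<in> U then u else a, if b \<in> U then u else b}"
      by (simp add: contract_def)
    moreover have "a \<notin> U \<or> b \<notin> U" using e(2) ab(1) by auto
    ultimately show ?thesis using ab(2-4) assms(2) by (auto simp: card_insert_if)
  qed
  with assms show ?thesis by (auto simp: mgraph_def)
qed

lemma contract_card:
  assumes "finite V" "U \<subseteq> V" "u \<in> U"
  shows "card (insert u (V - U)) + card U = card V + 1"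
proof -
  have "finite U" using assms finite_subset by auto
  then have "card (V - U) + card U = card V" using assms card_mono[of V U] by (simp add: card_Diff_subset)
  moreover have "card (insert u (V - U)) = card (V - U) + 1" using assms by simp
  ultimately show ?thesis by simp
qed

lemma contract_lift_card:
  assumes "finite V" "U \<subseteq> V" "X \<subseteq> insert u (V - U)" "u \<in> X" "u \<in> U"
  shows "card (X \<union> U) + 1 = card X + card U"
proof -
  have "X \<inter> U = {u}" using assms by auto
  moreover have "finite U" "finite (insert u (V - U))" using assms finite_subset[of _ V] by auto
  then have "finite X" "finite U" using assms(3) finite_subset by blast+
  ultimately show ?thesis using card_Un_Int[of X U] by simp
qed

text \<open>Tightness of the cut of \<open>U\<close> is precisely the degree equation at the new
  vertex. An odd set through \<open>u\<close> pulls back to its union with \<open>U\<close>, whose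
  size is \<open>card X + card U - 1\<close> and hence odd again.\<close>

lemma contract_fractional_pm:
  assumes G: "mgraph V E h" and u: "u \<in> U" "U \<subseteq> V" and U: "odd (card U)" "sum x (cut h E U) = 1"
    and x: "fractional_pm V E h x"
  shows "fractional_pm (insert u (V - U)) {e \<in> E. \<not> h e \<subseteq> U} (contract U u h) x"
  unfolding fractional_pm_def
proof (intro conjI ballI allI impI)
  fix e assume "e \<in> {e \<in> E. \<not> h e \<subseteq> U}"
  then show "0 \<le> x e" using x by (auto simp: fractional_pm_def)
next
  fix v assume "v \<in> insert u (V - U)"
  then show "sum x (inc (contract U u h) {e \<in> E. \<not> h e \<subseteq> U} v) = 1"
    using x u U by (cases "v = u") (auto simp: contract_inc_new contract_inc_old fractional_pm_def)
next
  fix X assume X: "X \<subseteq> insert u (V - U)" "odd (card X)"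
  show "1 \<le> sum x (cut (contract U u h) {e \<in> E. \<not> h e \<subseteq> U} X)"
  proof (cases "u \<in> X")
    case True
    with X u have XU: "X \<inter> U = {u}" by auto
    have "card (X \<union> U) + 1 = card X + card U"
      using contract_lift_card[of V U X u] X u G True by (auto simp: mgraph_def)
    with X U have "odd (card (X \<union> U))" by presburger
    moreover have "X \<union> U \<subseteq> V" using X u by auto
    ultimately have "1 \<le> sum x (cut h E (X \<union> U))" using x by (auto simp: fractional_pm_def)
    then show ?thesis by (simp only: contract_cut_through[OF u(1) True XU])
  next
    case False
    with X have "X \<inter> U = {}" "X \<subseteq> V" by auto
    then have "1 \<le> sum x (cut h E X)" using x X by (simp add: fractional_pm_def)
    then show ?thesis by (simp only: contract_cut_avoid[OF u(1) \<open>X \<inter> U = {}\<close>])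
  qed
qed

lemma cut_compl:
  assumes "mgraph V E h" "X \<subseteq> V"
  shows "cut h E (V - X) = cut h E X"
proof -
  have "h e \<inter> (V - X) \<noteq> {} \<longleftrightarrow> \<not> h e \<subseteq> X" "h e \<subseteq> V - X \<longleftrightarrow> h e \<inter> X = {}" if "e \<in> E" for e
    using assms that unfolding mgraph_def by blast+
  then show ?thesis by (auto simp: cut_def)
qed

text \<open>The cost \<open>\<mu> f\<close> of completing a matching of one side that uses the cut edge \<open>f\<close> is added
  to the weight of \<open>f\<close>. Charging \<open>- \<mu>\<close> on the other side makes all its matchings nonnegative, hence
  the total charge is paid for by the fractional weight there.\<close>

lemma edmonds_tight_cut:
  assumes G: "mgraph V E h" and x: "fractional_pm V E h x"
    and U: "U \<subseteq> V" "odd (card U)" "odd (card (V - U))" "sum x (cut h E U) = 1"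
    and u: "u \<in> U" "w0 \<in> V - U"
    and ed1: "edmonds (insert u (V - U)) {e \<in> E. \<not> h e \<subseteq> U} (contract U u h)"
    and ed2: "edmonds (insert w0 U) {e \<in> E. \<not> h e \<subseteq> V - U} (contract (V - U) w0 h)"
  shows "\<exists>M. perfect_matching V E h M \<and> sum w M \<le> (\<Sum>e\<in>E. w e * x e)"
proof -
  define E1 where "E1 = {e \<in> E. \<not> h e \<subseteq> U}"
  define E2 where "E2 = {e \<in> E. \<not> h e \<subseteq> V - U}"
  define h1 where "h1 = contract U u h"
  define h2 where "h2 = contract (V - U) w0 h"
  define C where "C = cut h E U"
  have fin: "finite E" "finite V" using G by (auto simp: mgraph_def)
  have finE: "finite E1" "finite E2" "finite C" using fin by (auto simp: E1_def E2_def C_def cut_def)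
  have cc: "cut h E (V - U) = C" using cut_compl[OF G U(1)] by (simp add: C_def)
  have VU: "V - (V - U) = U" using U by auto
  have sub: "h e \<subseteq> V - U \<longleftrightarrow> h e \<inter> U = {}" "h e \<subseteq> U \<Longrightarrow> h e \<inter> U \<noteq> {}" if "e \<in> E" for e
    using G that unfolding mgraph_def by (auto simp: Int_absorb2)
  have C12: "C = E1 \<inter> E2" and Esplit: "E = E1 \<union> (E2 - C)" and Edisj: "E1 \<inter> (E2 - C) = {}"
    using sub by (auto simp: C_def cut_def E1_def E2_def)
  have f1: "fractional_pm (insert u (V - U)) E1 h1 x"
    unfolding E1_def h1_def using contract_fractional_pm[OF G u(1) U(1,2,4) x] .
  have f2: "fractional_pm (insert w0 U) E2 h2 x"
    unfolding E2_def h2_def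
    using contract_fractional_pm[OF G u(2) _ U(3) _ x] cc U VU by (simp add: C_def)
  define P2 where "P2 = {M. perfect_matching (insert w0 U) E2 h2 M}"
  have finP2: "finite P2"
    using finE by (auto simp: P2_def perfect_matching_def intro: finite_subset[of _ "Pow E2"])
  define W where "W f = (\<lambda>M. sum w (M - {f})) ` {M \<in> P2. f \<in> M}" for f
  \<comment> \<open>\<open>K\<close> stands in for an infinite cost when \<open>f\<close> lies in no
    matching of the second side; it exceeds the fractional weight by more than any matching can
    save.\<close>
  define K where "K = (\<Sum>e\<in>E. w e * x e) + (\<Sum>e\<in>E. \<bar>w e\<bar>) + 1"
  define \<mu> where "\<mu> f = (if W f = {} then K else Min (W f))" for f
  have finW: "finite (W f)" for f using finP2 by (simp add: W_def)
  have inc1: "inc h1 E1 u = C" and inc2: "inc h2 E2 w0 = C"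
    unfolding h1_def E1_def h2_def E2_def using contract_inc_new[OF u(1), of h E] contract_inc_new[OF u(2), of h E] cc
    by (simp_all add: C_def)
  obtain M2 where M2: "perfect_matching (insert w0 U) E2 h2 M2"
    "(\<Sum>e\<in>M2. if e \<in> C then - \<mu> e else w e) \<le> (\<Sum>e\<in>E2. (if e \<in> C then - \<mu> e else w e) * x e)"
    using ed2 f2 unfolding edmonds_def E2_def h2_def by meson
  have cutM2: "card (M \<inter> C) = 1" if "M \<in> P2" for M
  proof -
    have "inc h2 M w0 = M \<inter> C"
      using that inc2 unfolding P2_def perfect_matching_def inc_def by auto
    then show ?thesis using that unfolding P2_def perfect_matching_def by auto
  qed
  have charge: "(\<Sum>e\<in>C. \<mu> e * x e) \<le> (\<Sum>e\<in>E2 - C. w e * x e)"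
  proof -
    \<comment> \<open>\<open>M2\<close> contains exactly one cut edge \<open>f\<close>, its edge at
      \<open>w0\<close>. Minimality of \<open>\<mu> f\<close> makes the charged weight of
      \<open>M2\<close> nonnegative.\<close>
    have "M2 \<in> P2" using M2 by (simp add: P2_def)
    obtain f where f: "M2 \<inter> C = {f}" using cutM2[OF \<open>M2 \<in> P2\<close>] by (meson card_1_singletonE)
    have finM2: "finite M2" using M2 finE by (auto simp: perfect_matching_def intro: finite_subset)
    have "sum w (M2 - {f}) \<in> W f" using \<open>M2 \<in> P2\<close> f by (auto simp: W_def)
    then have "\<mu> f \<le> sum w (M2 - {f})" using finW by (auto simp: \<mu>_def)
    moreover have "(\<Sum>e\<in>M2. if e \<in> C then - \<mu> e else w e) = - \<mu> f + sum w (M2 - {f})"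
    proof -
      have "f \<in> M2" "f \<in> C" using f by auto
      then have "(\<Sum>e\<in>M2. if e \<in> C then - \<mu> e else w e) =
          - \<mu> f + (\<Sum>e\<in>M2 - {f}. if e \<in> C then - \<mu> e else w e)"
        using finM2 by (simp add: sum.remove)
      also have "(\<Sum>e\<in>M2 - {f}. if e \<in> C then - \<mu> e else w e) = sum w (M2 - {f})"
        using f by (intro sum.cong) auto
      finally show ?thesis .
    qed
    moreover have "(\<Sum>e\<in>E2. (if e \<in> C then - \<mu> e else w e) * x e) =
        (\<Sum>e\<in>E2 - C. w e * x e) - (\<Sum>e\<in>C. \<mu> e * x e)"
    proof -
      have "C \<subseteq> E2" using C12 by auto
      then have "(\<Sum>e\<in>E2. (if e \<in> C then - \<mu> e else w e) * x e) =
         (\<Sum>e\<in>E2 - C. (if e \<in> C then - \<mu> e else w e) * x e) + (\<Sum>e\<in>C. (if e \<in> C then - \<mu> e else w e) * x e)"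
        using finE by (intro sum.subset_diff)
      also have "(\<Sum>e\<in>E2 - C. (if e \<in> C then - \<mu> e else w e) * x e) = (\<Sum>e\<in>E2 - C. w e * x e)"
        by (intro sum.cong) auto
      also have "(\<Sum>e\<in>C. (if e \<in> C then - \<mu> e else w e) * x e) = - (\<Sum>e\<in>C. \<mu> e * x e)"
        by (simp add: sum_negf[symmetric])
      finally show ?thesis by simp
    qed
    ultimately show ?thesis using M2(2) by simp
  qed
  obtain M1 where M1: "perfect_matching (insert u (V - U)) E1 h1 M1"
    "(\<Sum>e\<in>M1. w e + (if e \<in> C then \<mu> e else 0)) \<le> (\<Sum>e\<in>E1. (w e + (if e \<in> C then \<mu> e else 0)) * x e)"
    using ed1 f1 unfolding edmonds_def E1_def h1_def by meson
  have M1sub: "M1 \<subseteq> E1" using M1 by (simp add: perfect_matching_def)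
  have "inc h1 M1 u = M1 \<inter> C" using M1sub inc1 unfolding inc_def by auto
  then have "card (M1 \<inter> C) = 1" using M1 by (auto simp: perfect_matching_def)
  then obtain f where f: "M1 \<inter> C = {f}" by (meson card_1_singletonE)
  have finM1: "finite M1" using M1sub finE finite_subset by auto
  have "(\<Sum>e\<in>M1. w e + (if e \<in> C then \<mu> e else 0)) = sum w M1 + \<mu> f"
    using f finM1 by (simp add: sum.distrib sum.inter_restrict[symmetric])
  moreover have "(\<Sum>e\<in>E1. (w e + (if e \<in> C then \<mu> e else 0)) * x e) =
      (\<Sum>e\<in>E1. w e * x e) + (\<Sum>e\<in>C. \<mu> e * x e)"
  proof -
    have "(\<Sum>e\<in>E1. (w e + (if e \<in> C then \<mu> e else 0)) * x e) =
        (\<Sum>e\<in>E1. w e * x e + (if e \<in> C then \<mu> e * x e else 0))"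
      by (intro sum.cong) (auto simp: algebra_simps)
    moreover have "E1 \<inter> C = C" using C12 by auto
    ultimately show ?thesis using finE by (simp add: sum.distrib sum.inter_restrict[symmetric])
  qed
  moreover have "(\<Sum>e\<in>E. w e * x e) = (\<Sum>e\<in>E1. w e * x e) + (\<Sum>e\<in>E2 - C. w e * x e)"
    unfolding Esplit using Edisj finE by (intro sum.union_disjoint) (auto simp: Esplit[symmetric])
  ultimately have bound: "sum w M1 + \<mu> f \<le> (\<Sum>e\<in>E. w e * x e)" using M1(2) charge by simp
  \<comment> \<open>If \<open>f\<close> had no completion, the bound would push the weight of
    \<open>M1\<close> below minus the sum of all absolute weights.\<close>
  have "W f \<noteq> {}"
  proof
    assume "W f = {}"
    then have "\<mu> f = K" by (simp add: \<mu>_def)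
    moreover have "- (\<Sum>e\<in>E. \<bar>w e\<bar>) \<le> sum w M1"
    proof -
      have "\<bar>sum w M1\<bar> \<le> (\<Sum>e\<in>M1. \<bar>w e\<bar>)" by (rule sum_abs)
      also have "\<dots> \<le> (\<Sum>e\<in>E. \<bar>w e\<bar>)"
        using M1sub fin by (intro sum_mono2) (auto simp: E1_def)
      finally show ?thesis by simp
    qed
    ultimately show False using bound by (simp add: K_def)
  qed
  then have "Min (W f) \<in> W f" using finW by (rule Min_in[rotated])
  then have "\<mu> f \<in> W f" using \<open>W f \<noteq> {}\<close> by (simp add: \<mu>_def)
  then obtain N where N: "N \<in> P2" "f \<in> N" "\<mu> f = sum w (N - {f})"
    unfolding W_def by auto
  have NE: "N \<subseteq> E2" using N by (simp add: P2_def perfect_matching_def)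
  have "f \<in> C" using f by auto
  have NC: "N \<inter> C = {f}"
    using cutM2[OF N(1)] N(2) \<open>f \<in> C\<close> by (metis IntI card_1_singletonE singletonD)
  have disj: "M1 \<inter> (N - {f}) = {}" using M1sub NE NC C12 by auto
  \<comment> \<open>The two matchings share exactly the cut edge \<open>f\<close>. Hence the edges
    at a vertex of \<open>U\<close> are those of \<open>N\<close>, and at any other vertex those of
    \<open>M1\<close>.\<close>
  have "perfect_matching V E h (M1 \<union> N)"
    unfolding perfect_matching_def
  proof (intro conjI ballI)
    show "M1 \<union> N \<subseteq> E" using M1sub NE by (auto simp: E1_def E2_def)
  next
    fix v assume v: "v \<in> V"
    show "card (inc h (M1 \<union> N) v) = 1"
    proof (cases "v \<in> U")
      case True
      have "inc h (M1 \<union> N) v = inc h2 N v"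
      proof -
        have "e \<in> N" if "e \<in> M1" "v \<in> h e" for e
        proof -
          have "e \<in> C" using that True M1sub by (auto simp: C_def cut_def E1_def)
          then show ?thesis using f N that by auto
        qed
        moreover have "v \<in> h2 e \<longleftrightarrow> v \<in> h e" for e
          using True u by (auto simp: h2_def contract_def image_iff)
        ultimately show ?thesis by (auto simp: inc_def)
      qed
      then show ?thesis using N True by (auto simp: P2_def perfect_matching_def)
    next
      case False
      have "inc h (M1 \<union> N) v = inc h1 M1 v"
      proof -
        have "e \<in> M1" if "e \<in> N" "v \<in> h e" for e
        proof -
          have "e \<in> E" "\<not> h e \<subseteq> V - U" using that NE by (auto simp: E2_def)
          moreover have "h e \<subseteq> V" using G \<open>e \<in> E\<close> by (auto simp: mgraph_def)
          ultimately have "e \<in> C" using that False by (auto simp: C_def cut_def)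
          then have "e = f" using NC that by auto
          then show ?thesis using f by auto
        qed
        moreover have "v \<in> h1 e \<longleftrightarrow> v \<in> h e" for e
          using False u by (auto simp: h1_def contract_def image_iff)
        ultimately show ?thesis by (auto simp: inc_def)
      qed
      then show ?thesis using M1 v False by (auto simp: perfect_matching_def)
    qed
  qed
  moreover have "sum w (M1 \<union> N) = sum w M1 + sum w (N - {f})"
  proof -
    have "M1 \<union> N = M1 \<union> (N - {f})" using f by auto
    then show ?thesis using disj finM1 NE finE finite_subset
      by (metis finite_Diff sum.union_disjoint)
  qed
  ultimately show ?thesis using bound N(3) by (intro exI[of _ "M1 \<union> N"]) simp
qed

lemma cut_singleton: "mgraph V E h \<Longrightarrow> cut h E {v} = inc h E v"
proof -
  assume G: "mgraph V E h"
  have "\<not> h e \<subseteq> {v}" if "e \<in> E" for e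
  proof
    assume "h e \<subseteq> {v}"
    then have "card (h e) \<le> card {v}" by (intro card_mono) auto
    then show False using G that by (auto simp: mgraph_def)
  qed
  then show ?thesis by (auto simp: cut_def inc_def)
qed

lemma cut_everything: "mgraph V E h \<Longrightarrow> cut h E V = {}"
  by (auto simp: cut_def mgraph_def)

text \<open>No edge leaves \<open>V\<close>, so an odd \<open>V\<close> would violate its own cut
  inequality.\<close>

lemma fractional_pm_even:
  assumes "mgraph V E h" "fractional_pm V E h x"
  shows "even (card V)"
proof (rule ccontr)
  assume "odd (card V)"
  then have "1 \<le> sum x (cut h E V)" using assms unfolding fractional_pm_def by blast
  then show False using cut_everything[OF assms(1)] by simp
qed

lemma edmonds_zero_edge:
  assumes G: "mgraph V E h" and x: "fractional_pm V E h x" and e: "e \<in> E" "x e = 0"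
    and ed: "edmonds V (E - {e}) h"
  shows "\<exists>M. perfect_matching V E h M \<and> sum w M \<le> (\<Sum>e\<in>E. w e * x e)"
proof -
  have fin: "finite E" using G by (simp add: mgraph_def)
  have eq: "sum x (A - {e}) = sum x A" if "A \<subseteq> E" for A
    using that fin e(2) finite_subset by (intro sum.mono_neutral_left) auto
  have "inc h (E - {e}) v = inc h E v - {e}" "cut h (E - {e}) X = cut h E X - {e}" for v X
    by (auto simp: inc_def cut_def)
  then have "fractional_pm V (E - {e}) h x"
    using x unfolding fractional_pm_def by (simp add: eq inc_subset cut_subset)
  then obtain M where M: "perfect_matching V (E - {e}) h M" "sum w M \<le> (\<Sum>e\<in>E - {e}. w e * x e)"
    using ed unfolding edmonds_def by blast
  have "(\<Sum>e\<in>E - {e}. w e * x e) = (\<Sum>e\<in>E. w e * x e)"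
    using fin e by (intro sum.mono_neutral_left) auto
  then show ?thesis using M by (intro exI[of _ M]) (auto simp: perfect_matching_def)
qed

text \<open>The degree equation at the leaf \<open>v\<close> gives \<open>x e = 1\<close>.
  Positivity then leaves no room for a second edge at \<open>u\<close>, so \<open>e\<close> can be
  split off together with both its ends.\<close>

lemma edmonds_isolated_edge:
  assumes G: "mgraph V E h" and x: "fractional_pm V E h x" and pos: "\<forall>e\<in>E. 0 < x e"
    and e: "e \<in> E" "h e = {u, v}" "inc h E v = {e}"
    and ed: "edmonds (V - {u, v}) (E - {e}) h"
  shows "\<exists>M. perfect_matching V E h M \<and> sum w M \<le> (\<Sum>e\<in>E. w e * x e)"
proof -
  have fin: "finite E" using G by (simp add: mgraph_def)
  have uv: "u \<in> V" "v \<in> V" using G e by (auto simp: mgraph_def)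
  have xe: "x e = 1" using x e uv unfolding fractional_pm_def by force
  have incu: "inc h E u = {e}"
  proof (rule ccontr)
    assume "inc h E u \<noteq> {e}"
    moreover have "e \<in> inc h E u" using e by (simp add: inc_def)
    ultimately obtain f where f: "f \<in> inc h E u" "f \<noteq> e" by blast
    have "sum x {e, f} \<le> sum x (inc h E u)"
      using f \<open>e \<in> inc h E u\<close> fin pos by (intro sum_mono2) (auto simp: inc_def intro: less_imp_le)
    moreover have "sum x (inc h E u) = 1" using x uv by (simp add: fractional_pm_def)
    moreover have "0 < x f" using pos f by (simp add: inc_def)
    ultimately show False using f xe by simp
  qed
  have avoid: "h f \<inter> {u, v} = {}" if "f \<in> E - {e}" for f
    using that incu e(3) by (auto simp: inc_def)
  have "fractional_pm (V - {u, v}) (E - {e}) h x"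
    unfolding fractional_pm_def
  proof (intro conjI ballI allI impI)
    show "0 \<le> x f" if "f \<in> E - {e}" for f using x that by (simp add: fractional_pm_def)
  next
    fix z assume z: "z \<in> V - {u, v}"
    then have "inc h (E - {e}) z = inc h E z" using e by (auto simp: inc_def)
    then show "sum x (inc h (E - {e}) z) = 1" using x z by (simp add: fractional_pm_def)
  next
    fix X assume X: "X \<subseteq> V - {u, v}" "odd (card X)"
    then have "cut h (E - {e}) X = cut h E X" using e by (auto simp: cut_def)
    moreover have "X \<subseteq> V" using X by auto
    ultimately show "1 \<le> sum x (cut h (E - {e}) X)" using x X by (simp add: fractional_pm_def)
  qed
  then obtain M where M: "perfect_matching (V - {u, v}) (E - {e}) h M"
    "sum w M \<le> (\<Sum>e\<in>E - {e}. w e * x e)"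
    using ed unfolding edmonds_def by blast
  have ME: "M \<subseteq> E - {e}" using M by (simp add: perfect_matching_def)
  have "perfect_matching V E h (insert e M)"
    unfolding perfect_matching_def
  proof (intro conjI ballI)
    show "insert e M \<subseteq> E" using ME e by auto
    fix z assume z: "z \<in> V"
    show "card (inc h (insert e M) z) = 1"
    proof (cases "z \<in> {u, v}")
      case True
      have "z \<notin> h f" if "f \<in> M" for f using avoid[of f] that ME True by blast
      then have "inc h (insert e M) z = {e}" using e True by (auto simp: inc_def)
      then show ?thesis by simp
    next
      case False
      then have "inc h (insert e M) z = inc h M z" using e by (auto simp: inc_def)
      then show ?thesis using M z False by (simp add: perfect_matching_def)
    qed
  qed
  moreover have "sum w (insert e M) \<le> (\<Sum>e\<in>E. w e * x e)"
  proof -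
    have "finite M" "e \<notin> M" using ME fin finite_subset by auto
    then have "sum w (insert e M) = w e + sum w M" by simp
    moreover have "(\<Sum>e\<in>E. w e * x e) = w e * x e + (\<Sum>e\<in>E - {e}. w e * x e)"
      using fin e by (simp add: sum.remove)
    ultimately show ?thesis using M(2) xe by simp
  qed
  ultimately show ?thesis by blast
qed

text \<open>Moving along a kernel vector preserves the degree equations, so the first obstacle is
  the inequality of an edge or of an odd cut. The direction is chosen so that the weight does not
  grow.\<close>

lemma fractional_pm_slide:
  fixes x y w :: "'e \<Rightarrow> real"
  assumes G: "mgraph V E h" and x: "fractional_pm V E h x" and pos: "\<forall>e\<in>E. 0 < x e"
    and strict: "\<forall>U\<subseteq>V. odd (card U) \<longrightarrow> card U \<noteq> 1 \<longrightarrow> card (V - U) \<noteq> 1 \<longrightarrow> sum x (cut h E U) \<noteq> 1"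
    and y: "e0 \<in> E" "y e0 \<noteq> 0" "\<forall>v\<in>V. sum y (inc h E v) = 0"
  shows "\<exists>x'. fractional_pm V E h x' \<and> (\<Sum>e\<in>E. w e * x' e) \<le> (\<Sum>e\<in>E. w e * x e) \<and>
    ((\<exists>e\<in>E. x' e = 0) \<or>
     (\<exists>U\<subseteq>V. odd (card U) \<and> card U \<noteq> 1 \<and> card (V - U) \<noteq> 1 \<and> sum x' (cut h E U) = 1))"
proof -
  have fin: "finite E" "finite V" using G by (auto simp: mgraph_def)
  define z where "z = (if (\<Sum>e\<in>E. w e * y e) \<le> 0 then y else (\<lambda>e. - y e))"
  have z: "z e0 \<noteq> 0" "\<forall>v\<in>V. sum z (inc h E v) = 0" "(\<Sum>e\<in>E. w e * z e) \<le> 0"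
    using y by (auto simp: z_def sum_negf)
  \<comment> \<open>Around an end of \<open>e0\<close> the values of \<open>z\<close> sum to zero
    without all vanishing, so one of them is negative.\<close>
  have neg: "\<exists>e\<in>E. z e < 0"
  proof (rule ccontr)
    assume "\<not> ?thesis"
    then have nn: "\<forall>e\<in>E. 0 \<le> z e" by (auto simp: not_less)
    obtain a b where ab: "h e0 = {a, b}" "a \<in> V" using mgraph_ends[OF G y(1)] by metis
    have "finite (inc h E a)" using fin by (simp add: inc_def)
    moreover have "\<forall>e\<in>inc h E a. 0 \<le> z e" using nn by (simp add: inc_def)
    moreover have "sum z (inc h E a) = 0" using z(2) ab by simp
    ultimately have "\<forall>e\<in>inc h E a. z e = 0" by (simp add: sum_nonneg_eq_0_iff)
    then show False using z(1) ab y(1) by (auto simp: inc_def)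
  qed
  \<comment> \<open>Sets of size one and their complements are left out: their cut values are fixed
    to 1 by the degree equations and stay tight.\<close>
  define Os where "Os = {U. U \<subseteq> V \<and> odd (card U) \<and> card U \<noteq> 1 \<and> card (V - U) \<noteq> 1}"
  define J where "J = Inl ` E \<union> Inr ` Os"
  define a where "a = case_sum x (\<lambda>U. sum x (cut h E U) - 1)"
  define b where "b = case_sum z (\<lambda>U. sum z (cut h E U))"
  have "finite J" using fin by (auto simp: J_def Os_def)
  moreover have "\<forall>j\<in>J. 0 < a j"
  proof -
    have "1 < sum x (cut h E U)" if "U \<in> Os" for U
    proof -
      have "1 \<le> sum x (cut h E U)" using x that by (simp add: fractional_pm_def Os_def)
      moreover have "sum x (cut h E U) \<noteq> 1" using strict that by (simp add: Os_def)
      ultimately show ?thesis by simp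
    qed
    then show ?thesis using pos by (auto simp: J_def a_def)
  qed
  moreover have "\<exists>j\<in>J. b j < 0"
  proof -
    obtain e where "e \<in> E" "z e < 0" using neg by auto
    then have "Inl e \<in> J" "b (Inl e) < 0" by (auto simp: J_def b_def)
    then show ?thesis by blast
  qed
  ultimately obtain t where t: "0 < t" "\<forall>j\<in>J. 0 \<le> a j + t * b j" "\<exists>j\<in>J. a j + t * b j = 0"
    using slide_to_boundary[of J a b] by blast
  define x' where "x' e = x e + t * z e" for e
  have sumx': "sum x' A = sum x A + t * sum z A" for A
    by (simp add: x'_def sum.distrib sum_distrib_left)
  have vert: "sum x' (inc h E v) = 1" if "v \<in> V" for v
    using that x z by (simp add: sumx' fractional_pm_def)
  have "fractional_pm V E h x'"
    unfolding fractional_pm_def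
  proof (intro conjI ballI allI impI vert)
    fix e assume "e \<in> E"
    then have "0 \<le> a (Inl e) + t * b (Inl e)" using t by (auto simp: J_def)
    then show "0 \<le> x' e" by (simp add: a_def b_def x'_def)
  next
    fix X assume X: "X \<subseteq> V" "odd (card X)"
    consider "card X = 1" | "card (V - X) = 1" | "X \<in> Os" using X by (auto simp: Os_def)
    then show "1 \<le> sum x' (cut h E X)"
    proof cases
      case 1
      then obtain v where "X = {v}" by (meson card_1_singletonE)
      then show ?thesis using vert[of v] X cut_singleton[OF G] by simp
    next
      case 2
      then obtain v where "V - X = {v}" by (meson card_1_singletonE)
      moreover from this have "v \<in> V" by auto
      ultimately show ?thesis using vert[of v] cut_singleton[OF G, of v] cut_compl[OF G X(1)] by simp
    next
      case 3
      then have "0 \<le> a (Inr X) + t * b (Inr X)" using t by (auto simp: J_def)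
      then show ?thesis by (simp add: a_def b_def sumx')
    qed
  qed
  moreover have "(\<Sum>e\<in>E. w e * x' e) \<le> (\<Sum>e\<in>E. w e * x e)"
  proof -
    have "(\<Sum>e\<in>E. w e * x' e) = (\<Sum>e\<in>E. w e * x e) + t * (\<Sum>e\<in>E. w e * z e)"
      by (simp add: x'_def algebra_simps sum.distrib sum_distrib_left)
    then show ?thesis using t(1) z(3) by (simp add: mult_nonneg_nonpos)
  qed
  moreover have "(\<exists>e\<in>E. x' e = 0) \<or>
     (\<exists>U\<subseteq>V. odd (card U) \<and> card U \<noteq> 1 \<and> card (V - U) \<noteq> 1 \<and> sum x' (cut h E U) = 1)"
  proof -
    obtain j where j: "j \<in> J" "a j + t * b j = 0" using t by blast
    show ?thesis
    proof (cases j)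
      case (Inl e)
      then show ?thesis using j by (auto simp: J_def a_def b_def x'_def)
    next
      case (Inr U)
      then have "U \<in> Os" "sum x' (cut h E U) = 1" using j by (auto simp: J_def a_def b_def sumx')
      then show ?thesis by (auto simp: Os_def)
    qed
  qed
  ultimately show ?thesis by blast
qed

text \<open>In a 2-regular graph either an alternating vector on a 2-cycle or a 4-cycle is a kernel
  vector, or a vertex together with its two neighbours forms a tight odd set.\<close>

lemma two_regular_kernel_or_tight:
  assumes G: "mgraph V E h" and x: "fractional_pm V E h x" and pos: "\<forall>e\<in>E. 0 < x e"
    and deg: "\<forall>v\<in>V. card (inc h E v) = 2" and ne: "V \<noteq> {}"
  shows "(\<exists>y. (\<exists>e\<in>E. y e \<noteq> 0) \<and> (\<forall>v\<in>V. sum y (inc h E v) = (0 :: real))) \<or>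
    (\<exists>U\<subseteq>V. odd (card U) \<and> card U \<noteq> 1 \<and> card (V - U) \<noteq> 1 \<and> sum x (cut h E U) = 1)"
proof -
  have fin: "finite E" "finite V" using G by (auto simp: mgraph_def)
  have fininc: "finite (inc h E z)" for z using fin by (simp add: inc_def)
  obtain v where v: "v \<in> V" using ne by auto
  then obtain e f where ef: "inc h E v = {e, f}" "e \<noteq> f" using deg by (meson card_2_iff)
  have eE: "e \<in> E" "v \<in> h e" "f \<in> E" "v \<in> h f" using ef by (auto simp: inc_def)
  obtain u where u: "h e = {v, u}" "u \<noteq> v" "u \<in> V" using mgraph_other_end[OF G eE(1,2)] .
  obtain u' where u': "h f = {v, u'}" "u' \<noteq> v" "u' \<in> V" using mgraph_other_end[OF G eE(3,4)] .
  show ?thesis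
  proof (cases "u = u'")
    case True
    define y where "y i = (if i = e then 1 else if i = f then - 1 else (0 :: real))" for i
    have "sum y (inc h E z) = 0" for z
    proof -
      have "sum y (inc h E z) = sum y (inc h E z \<inter> {e, f})"
        using fininc by (intro sum.mono_neutral_right) (auto simp: y_def)
      also have "inc h E z \<inter> {e, f} = (if z \<in> h e then {e, f} else {})"
        using u u' True eE by (auto simp: inc_def)
      also have "sum y \<dots> = 0" using ef by (simp add: y_def)
      finally show ?thesis .
    qed
    moreover have "y e \<noteq> 0" by (simp add: y_def)
    ultimately show ?thesis using eE by blast
  next
    case False
    define U where "U = {v, u, u'}"
    define I where "I = {i \<in> E. h i \<subseteq> U}"
    have U: "U \<subseteq> V" "card U = 3" using v u u' False by (auto simp: U_def)
    have efI: "{e, f} \<subseteq> I" using eE u u' by (auto simp: I_def U_def)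
    have "finite I" using fin by (simp add: I_def)
    have xv: "\<And>z. z \<in> V \<Longrightarrow> sum x (inc h E z) = 1" using x by (simp add: fractional_pm_def)
    have xef: "sum x {e, f} = 1" using xv[OF v] ef by simp
    have "(\<Sum>z\<in>U. sum x (inc h E z)) = 3"
      using xv U v u u' False by (simp add: U_def)
    then have three: "sum x (cut h E U) + 2 * sum x I = 3" using sum_inc[OF G U(1), of x] by (simp add: I_def)
    have "1 \<le> sum x (cut h E U)" using x U by (auto simp: fractional_pm_def)
    moreover have "sum x {e, f} \<le> sum x I"
      using efI \<open>finite I\<close> pos by (intro sum_mono2) (auto simp: I_def intro: less_imp_le)
    ultimately have tight: "sum x (cut h E U) = 1" "sum x I = 1" using three xef by simp_all
    have I: "I = {e, f}"
    proof (rule ccontr)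
      assume "I \<noteq> {e, f}"
      then obtain g where g: "g \<in> I" "g \<notin> {e, f}" using efI by blast
      have "sum x (insert g {e, f}) \<le> sum x I"
        using efI g \<open>finite I\<close> pos by (intro sum_mono2) (auto simp: I_def intro: less_imp_le)
      moreover have "0 < x g" using g pos by (simp add: I_def)
      ultimately show False using g xef tight(2) by simp
    qed
    show ?thesis
    proof (cases "card (V - U) = 1")
      case False
      then show ?thesis using U tight by auto
    next
      case True
      then obtain z where z: "V - U = {z}" by (meson card_1_singletonE)
      have other: "\<exists>k. inc h E p = {g, k} \<and> k \<noteq> g \<and> k \<in> E \<and> h k = {p, z}"
        if p: "p \<in> V" "p \<in> U" "g \<in> inc h E p" "\<forall>i\<in>I. p \<in> h i \<longrightarrow> i = g" for p g
      proof -
        obtain i j where ij: "inc h E p = {i, j}" "i \<noteq> j" using deg p(1) by (meson card_2_iff)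
        define k where "k = (if i = g then j else i)"
        have k: "inc h E p = {g, k}" "k \<noteq> g" using ij p(3) by (auto simp: k_def)
        then have kE: "k \<in> E" "p \<in> h k" by (auto simp: inc_def)
        obtain q where q: "h k = {p, q}" "q \<noteq> p" "q \<in> V" using mgraph_other_end[OF G kE] .
        have "k \<notin> I" using p(4) k(2) kE by auto
        then have "q \<notin> U" using q p kE by (auto simp: I_def)
        then have "q = z" using q z by auto
        then show ?thesis using k kE q by auto
      qed
      have "\<exists>k. inc h E u = {e, k} \<and> k \<noteq> e \<and> k \<in> E \<and> h k = {u, z}"
        using u u' False eE I by (intro other) (auto simp: U_def inc_def)
      then obtain e' where e': "inc h E u = {e, e'}" "e' \<noteq> e" "e' \<in> E" "h e' = {u, z}" by blast
      have "\<exists>k. inc h E u' = {f, k} \<and> k \<noteq> f \<and> k \<in> E \<and> h k = {u', z}"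
        using u u' False eE I by (intro other) (auto simp: U_def inc_def)
      then obtain f' where f': "inc h E u' = {f, f'}" "f' \<noteq> f" "f' \<in> E" "h f' = {u', z}" by blast
      have zU: "z \<in> V" "z \<notin> U" using z by auto
      have ne4: "e' \<noteq> f'" "e' \<noteq> f" "f' \<noteq> e"
        using e' f' u u' False zU by (auto simp: U_def doubleton_eq_iff)
      have "{e', f'} \<subseteq> inc h E z" using e' f' by (auto simp: inc_def)
      moreover have "card (inc h E z) = card {e', f'}" using deg zU ne4 by simp
      ultimately have incz: "inc h E z = {e', f'}" using fininc by (metis card_subset_eq)
      define y where "y i = (if i = e \<or> i = f' then 1 else - 1 :: real)" for i
      have "sum y (inc h E p) = 0" if "p \<in> V" for p
      proof -
        have "p \<in> {v, u, u', z}" using that z by (auto simp: U_def)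
        then show ?thesis using ef e' f' incz ne4 by (auto simp: y_def)
      qed
      moreover have "y e \<noteq> 0" by (simp add: y_def)
      ultimately show ?thesis using eE by blast
    qed
  qed
qed

text \<open>A zero edge is deleted, and a nontrivial tight odd cut is contracted from either side;
  both lower |V| + |E|. Otherwise these inequalities are strict. If there is also no leaf to split
  off, a kernel vector of the degree equations slides the point into one of the first two situations
  at no greater weight. For |E| > |V| such a vector exists by dimension.\<close>

theorem edmonds_perfect_matching:
  assumes "mgraph V E h"
  shows "edmonds V E h"
  using assms
proof (induction "card V + card E" arbitrary: V E h rule: less_induct)
  case less
  note G = less.prems
  have fin: "finite E" "finite V" using G by (auto simp: mgraph_def)
  show ?case
    unfolding edmonds_def
  proof (intro allI impI)
    fix x w :: "_ \<Rightarrow> real"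
    assume x: "fractional_pm V E h x"
    have evenV: "even (card V)" using fractional_pm_even[OF G x] .
    \<comment> \<open>Stated for every point \<open>x'\<close> because the slide below replaces
      \<open>x\<close>.\<close>
    have zero: "\<exists>M. perfect_matching V E h M \<and> sum w M \<le> (\<Sum>e\<in>E. w e * x' e)"
      if x': "fractional_pm V E h x'" and "\<exists>e\<in>E. x' e = 0" for x'
    proof -
      from \<open>\<exists>e\<in>E. x' e = 0\<close> obtain e where e: "e \<in> E" "x' e = 0" by auto
      have "card (E - {e}) < card E" using e fin by (meson card_Diff1_less)
      then have "edmonds V (E - {e}) h" using less.hyps mgraph_subset[OF G] by auto
      then show ?thesis using edmonds_zero_edge[OF G x' e] by blast
    qed
    have tight: "\<exists>M. perfect_matching V E h M \<and> sum w M \<le> (\<Sum>e\<in>E. w e * x' e)"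
      if x': "fractional_pm V E h x'" and U: "U \<subseteq> V" "odd (card U)" "card U \<noteq> 1" "card (V - U) \<noteq> 1"
        "sum x' (cut h E U) = 1" for x' U
    proof -
      have finU: "finite U" using U fin finite_subset by auto
      have cardVU: "card (V - U) + card U = card V"
        using U finU fin card_mono[of V U] by (simp add: card_Diff_subset)
      then have oddVU: "odd (card (V - U))" using evenV U by presburger
      obtain u where u: "u \<in> U" using U by fastforce
      obtain w0 where w0: "w0 \<in> V - U" using oddVU by (metis card.empty all_not_in_conv even_zero)
      have less1: "card {e \<in> E. P e} \<le> card E" for P using fin by (intro card_mono) auto
      have "card (insert u (V - U)) < card V"
        using contract_card[OF fin(2) U(1) u] U by presburger
      then have 1: "edmonds (insert u (V - U)) {e \<in> E. \<not> h e \<subseteq> U} (contract U u h)"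
        using less1[of "\<lambda>e. \<not> h e \<subseteq> U"] contract_mgraph[OF G u U(1)] by (intro less.hyps) linarith+
      have VU: "V - (V - U) = U" using U by auto
      have "card (insert w0 U) < card V"
      proof -
        have "card (insert w0 U) + card (V - U) = card V + 1"
          using contract_card[OF fin(2) _ w0] VU by simp
        moreover have "2 \<le> card (V - U)" using oddVU U(4) by (cases "card (V - U)") auto
        ultimately show ?thesis by simp
      qed
      then have 2: "edmonds (insert w0 U) {e \<in> E. \<not> h e \<subseteq> V - U} (contract (V - U) w0 h)"
        using less1[of "\<lambda>e. \<not> h e \<subseteq> V - U"] contract_mgraph[OF G w0] VU by (intro less.hyps) auto
      show ?thesis using edmonds_tight_cut[OF G x' U(1,2) oddVU U(5) u w0 1 2] .
    qed
    show "\<exists>M. perfect_matching V E h M \<and> sum w M \<le> (\<Sum>e\<in>E. w e * x e)"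
    proof (cases "V = {}")
      case True
      then have "E = {}" using G by (force simp: mgraph_def)
      then show ?thesis using True by (intro exI[of _ "{}"]) (simp add: perfect_matching_def)
    next
      case ne: False
      consider (Z) "\<exists>e\<in>E. x e = 0"
        | (T) "\<exists>U\<subseteq>V. odd (card U) \<and> card U \<noteq> 1 \<and> card (V - U) \<noteq> 1 \<and> sum x (cut h E U) = 1"
        | (N) "\<forall>e\<in>E. 0 < x e"
          "\<forall>U\<subseteq>V. odd (card U) \<longrightarrow> card U \<noteq> 1 \<longrightarrow> card (V - U) \<noteq> 1 \<longrightarrow> sum x (cut h E U) \<noteq> 1"
        using x unfolding fractional_pm_def by (metis order_le_less)
      then show ?thesis
      proof cases
        case Z
        then show ?thesis using zero x by blast
      next
        case T
        then show ?thesis using tight x by blast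
      next
        case N
        have kernel: ?thesis if ker: "\<exists>y. (\<exists>e\<in>E. y e \<noteq> 0) \<and> (\<forall>v\<in>V. sum y (inc h E v) = (0 :: real))"
        proof -
          obtain y e0 where y: "e0 \<in> E" "y e0 \<noteq> 0" "\<forall>v\<in>V. sum y (inc h E v) = (0 :: real)"
            using ker by blast
          obtain x' where x': "fractional_pm V E h x'" "(\<Sum>e\<in>E. w e * x' e) \<le> (\<Sum>e\<in>E. w e * x e)"
            "(\<exists>e\<in>E. x' e = 0) \<or>
              (\<exists>U\<subseteq>V. odd (card U) \<and> card U \<noteq> 1 \<and> card (V - U) \<noteq> 1 \<and> sum x' (cut h E U) = 1)"
            using fractional_pm_slide[OF G x N y, of w] by blast
          then have "\<exists>M. perfect_matching V E h M \<and> sum w M \<le> (\<Sum>e\<in>E. w e * x' e)"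
            using zero tight by blast
          then show ?thesis using x'(2) by force
        qed
        show ?thesis
        proof (cases "\<exists>v\<in>V. card (inc h E v) = 1")
          case True
          then obtain v e where v: "v \<in> V" "inc h E v = {e}" by (meson card_1_singletonE)
          then have e: "e \<in> E" "v \<in> h e" by (auto simp: inc_def)
          obtain u where u: "h e = {v, u}" "u \<noteq> v" "u \<in> V" using mgraph_other_end[OF G e] .
          have avoid: "h f \<inter> {u, v} = {}" if f: "f \<in> E - {e}" for f
          proof (rule ccontr)
            assume "h f \<inter> {u, v} \<noteq> {}"
            then have "u \<in> h f" using f v by (auto simp: inc_def)
            have "x e = 1" using x v unfolding fractional_pm_def by force
            have "sum x {e, f} \<le> sum x (inc h E u)"
              using f e u \<open>u \<in> h f\<close> fin N(1) by (intro sum_mono2) (auto simp: inc_def intro: less_imp_le)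
            moreover have "sum x (inc h E u) = 1" using x u by (simp add: fractional_pm_def)
            moreover have "0 < x f" using N f by simp
            moreover have "e \<noteq> f" using f by auto
            ultimately show False using \<open>x e = 1\<close> by simp
          qed
          have "mgraph (V - {u, v}) (E - {e}) h"
            using G avoid unfolding mgraph_def by blast
          moreover have "card (E - {e}) < card E" "card (V - {u, v}) \<le> card V"
            using e fin card_Diff1_less[of E e] card_mono[of V "V - {u, v}"] by auto
          ultimately have "edmonds (V - {u, v}) (E - {e}) h" by (intro less.hyps) auto
          then show ?thesis
            using edmonds_isolated_edge[OF G x N(1) e(1) _ v(2)] u by (metis insert_commute)
        next
          case no1: False
          show ?thesis
          proof (cases "card V < card E")
            case True
            obtain y where y: "\<exists>e\<in>E. y e \<noteq> 0"
              "\<forall>v\<in>V. (\<Sum>e\<in>E. (if v \<in> h e then 1 else 0) * y e) = (0 :: real)"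
              using underdetermined_kernel[OF fin(2,1) True, of "\<lambda>v e. if v \<in> h e then 1 else 0"] by blast
            have "sum y (inc h E v) = (\<Sum>e\<in>E. (if v \<in> h e then 1 else 0) * y e)" for v
              unfolding inc_def using fin by (subst sum.inter_filter) (auto intro!: sum.cong)
            then show ?thesis using y by (intro kernel exI[of _ y]) auto
          next
            case False
            \<comment> \<open>Without leaves and with |E| <= |V|, counting edge ends makes the graph
              2-regular.\<close>
            have two: "2 \<le> card (inc h E v)" if "v \<in> V" for v
            proof -
              have "inc h E v \<noteq> {}" using x that unfolding fractional_pm_def by force
              moreover have "finite (inc h E v)" using fin by (simp add: inc_def)
              ultimately have "card (inc h E v) \<noteq> 0" by simp
              moreover have "card (inc h E v) \<noteq> 1" using no1 that by blast
              ultimately show ?thesis by linarith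
            qed
            have "(\<Sum>v\<in>V. card (inc h E v)) = 2 * card E"
            proof -
              have "{e \<in> E. h e \<subseteq> V} = E" using G by (auto simp: mgraph_def)
              then show ?thesis
                using sum_inc[OF G subset_refl, of "\<lambda>_. 1 :: nat"] cut_everything[OF G] by simp
            qed
            then have "(\<Sum>v\<in>V. card (inc h E v)) \<le> (\<Sum>v\<in>V. 2)" using False by simp
            have deg: "\<forall>v\<in>V. card (inc h E v) = 2"
            proof (rule ccontr)
              assume "\<not> ?thesis"
              then obtain v where "v \<in> V" "2 < card (inc h E v)" using two by force
              then have "(\<Sum>v\<in>V. 2) < (\<Sum>v\<in>V. card (inc h E v))"
                using two fin by (intro sum_strict_mono_ex1) auto
              then show False using \<open>(\<Sum>v\<in>V. card (inc h E v)) \<le> (\<Sum>v\<in>V. 2)\<close> by simp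
            qed
            from two_regular_kernel_or_tight[OF G x N(1) deg ne] show ?thesis
            proof
              assume "\<exists>U\<subseteq>V. odd (card U) \<and> card U \<noteq> 1 \<and> card (V - U) \<noteq> 1 \<and> sum x (cut h E U) = 1"
              then show ?thesis using N(2) by blast
            qed (rule kernel)
          qed
        qed
      qed
    qed
  qed
qed

subsection \<open>Two-factors with few cycles\<close>

text \<open>The cut condition expresses connected and bridgeless at once. Cuts pull back directly
  along the reductions, whereas paths would have to be rerouted.\<close>

definition cubic_2ec :: "'v set \<Rightarrow> 'e set \<Rightarrow> ('e \<Rightarrow> 'v set) \<Rightarrow> bool" where
  "cubic_2ec V E h \<longleftrightarrow> mgraph V E h \<and> V \<noteq> {} \<and> (\<forall>v\<in>V. card (inc h E v) = 3) \<and>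
     (\<forall>X. X \<subseteq> V \<and> X \<noteq> {} \<and> X \<noteq> V \<longrightarrow> 2 \<le> card (cut h E X))"

definition adj :: "('e \<Rightarrow> 'v set) \<Rightarrow> 'e set \<Rightarrow> 'v rel" where
  "adj h F = {(x, y). \<exists>e\<in>F. h e = {x, y}}"

definition component :: "('e \<Rightarrow> 'v set) \<Rightarrow> 'e set \<Rightarrow> 'v \<Rightarrow> 'v set" where
  "component h F v = (adj h F)\<^sup>* `` {v}"

text \<open>Only the classes that meet \<open>S\<close> are counted, so that vertices can be added
  one at a time. A vertex without edges is a class of its own.\<close>

definition ncomp :: "'v set \<Rightarrow> ('e \<Rightarrow> 'v set) \<Rightarrow> 'e set \<Rightarrow> nat" where
  "ncomp S h F = card (component h F ` S)"

lemma conn_sym: "(u, v) \<in> (adj h F)\<^sup>* \<Longrightarrow> (v, u) \<in> (adj h F)\<^sup>*"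
proof -
  have "sym (adj h F)" by (auto simp: sym_def adj_def insert_commute)
  then show "(u, v) \<in> (adj h F)\<^sup>* \<Longrightarrow> (v, u) \<in> (adj h F)\<^sup>*" by (metis sym_rtrancl symD)
qed

lemma conn_edge: "e \<in> F \<Longrightarrow> h e = {u, v} \<Longrightarrow> (u, v) \<in> (adj h F)\<^sup>*"
  by (auto simp: adj_def)

lemma conn_mono: "F \<subseteq> F' \<Longrightarrow> (u, v) \<in> (adj h F)\<^sup>* \<Longrightarrow> (u, v) \<in> (adj h F')\<^sup>*"
  by (rule rtrancl_mono[THEN subsetD, rotated]) (auto simp: adj_def)

lemma component_eq_iff: "component h F u = component h F v \<longleftrightarrow> (u, v) \<in> (adj h F)\<^sup>*"
  unfolding component_def by (auto intro: rtrancl_trans conn_sym)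

lemma in_component_iff: "u \<in> component h F v \<longleftrightarrow> (v, u) \<in> (adj h F)\<^sup>*"
  by (simp add: component_def)

lemma self_in_component [simp]: "v \<in> component h F v"
  by (simp add: component_def)

lemma component_closed:
  assumes "v \<in> S" "\<And>e x y. e \<in> F \<Longrightarrow> h e = {x, y} \<Longrightarrow> x \<in> S \<Longrightarrow> y \<in> S"
  shows "component h F v \<subseteq> S"
proof
  fix u assume "u \<in> component h F v"
  then have "(v, u) \<in> (adj h F)\<^sup>*" by (simp add: component_def)
  then show "u \<in> S"
    by (induction rule: rtrancl_induct) (use assms in \<open>auto simp: adj_def\<close>)
qed

lemma component_subset: "mgraph V F h \<Longrightarrow> v \<in> V \<Longrightarrow> component h F v \<subseteq> V"
  by (rule component_closed) (auto simp: mgraph_def)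

lemma component_edge:
  assumes "e \<in> F" "h e = {x, y}" "x \<in> component h F v"
  shows "y \<in> component h F v"
  using assms conn_edge[of e F h x y] unfolding in_component_iff by (meson rtrancl_trans)

lemma cut_component:
  assumes "mgraph V F h"
  shows "cut h F (component h F v) = {}"
proof -
  have False if e: "e \<in> cut h F (component h F v)" for e
  proof -
    have "e \<in> F" using e by (simp add: cut_def)
    then obtain a b where ab: "h e = {a, b}" using mgraph_ends[OF assms] by metis
    then have "a \<in> component h F v \<longleftrightarrow> b \<in> component h F v"
      using component_edge[of e F h] \<open>e \<in> F\<close> by (metis insert_commute)
    then show False using e ab by (auto simp: cut_def)
  qed
  then show ?thesis by blast
qed

lemma component_isolated:
  assumes "\<And>e. e \<in> F \<Longrightarrow> v \<notin> h e"
  shows "component h F v = {v}"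
proof -
  have "component h F v \<subseteq> {v}" using assms by (intro component_closed) auto
  then show ?thesis by auto
qed

text \<open>The value of \<open>f\<close> can be recovered from that of \<open>g\<close>. This
  serves to compare numbers of components when one connectivity relation refines another.\<close>

lemma card_image_factor:
  assumes "finite A" "\<And>x y. x \<in> A \<Longrightarrow> y \<in> A \<Longrightarrow> g x = g y \<Longrightarrow> f x = f y"
  shows "card (f ` A) \<le> card (g ` A)"
proof -
  have "f ` A = (\<lambda>z. f (SOME x. x \<in> A \<and> g x = z)) ` g ` A"
  proof -
    have "f x = f (SOME x'. x' \<in> A \<and> g x' = g x)" if "x \<in> A" for x
      using someI[of "\<lambda>x'. x' \<in> A \<and> g x' = g x" x] that assms(2) by metis
    then show ?thesis by (auto simp: image_iff)
  qed
  moreover have "card ((\<lambda>z. f (SOME x. x \<in> A \<and> g x = z)) ` g ` A) \<le> card (g ` A)"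
    using assms(1) by (intro card_image_le) simp
  ultimately show ?thesis by simp
qed

lemma ncomp_insert_isolated:
  assumes "finite S" "v \<notin> S" "\<And>e. e \<in> F \<Longrightarrow> v \<notin> h e"
  shows "ncomp (insert v S) h F = ncomp S h F + 1"
proof -
  have "component h F v \<noteq> component h F s" if "s \<in> S" for s
    using component_isolated[of F v h] assms(3) that assms(2) self_in_component[of s h F]
    by (metis singletonD)
  then have "component h F v \<notin> component h F ` S" by auto
  then show ?thesis using assms(1) by (simp add: ncomp_def)
qed

text \<open>A walk can be shortened until it crosses \<open>e\<close> at most once, in one of the
  two directions.\<close>

lemma conn_insert_edge:
  assumes "(s, t) \<in> (adj h (insert e F))\<^sup>*" "h e = {a, b}"
  shows "(s, t) \<in> (adj h F)\<^sup>* \<or> (s, a) \<in> (adj h F)\<^sup>* \<and> (b, t) \<in> (adj h F)\<^sup>* \<or>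
    (s, b) \<in> (adj h F)\<^sup>* \<and> (a, t) \<in> (adj h F)\<^sup>*"
  using assms(1)
proof (induction rule: rtrancl_induct)
  case (step y z)
  show ?case
  proof (cases "(y, z) \<in> adj h F")
    case True
    then show ?thesis using step.IH by (meson rtrancl.rtrancl_into_rtrancl)
  next
    case False
    then have "{y, z} = {a, b}" using step.hyps(2) assms(2) by (auto simp: adj_def)
    then have "y = a \<and> z = b \<or> y = b \<and> z = a" by (auto simp: doubleton_eq_iff)
    then show ?thesis using step.IH by auto
  qed
qed simp

lemma ncomp_insert_edge:
  assumes "finite S" "h e = {a, b}"
  shows "ncomp S h F \<le> ncomp S h (insert e F) + 1"
proof -
  \<comment> \<open>Setting aside the class of \<open>b\<close> is enough: two vertices not joined
    to \<open>b\<close> by \<open>F\<close> that are joined after adding \<open>e\<close> were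
    joined before.\<close>
  define S' where "S' = {s \<in> S. (s, b) \<notin> (adj h F)\<^sup>*}"
  have fin: "finite S'" using assms by (simp add: S'_def)
  have "component h F s \<in> insert (component h F b) (component h F ` S')" if "s \<in> S" for s
  proof (cases "(s, b) \<in> (adj h F)\<^sup>*")
    case True
    then show ?thesis by (simp add: component_eq_iff)
  next
    case False
    then have "s \<in> S'" using that by (simp add: S'_def)
    then show ?thesis by blast
  qed
  then have "component h F ` S \<subseteq> insert (component h F b) (component h F ` S')" by blast
  then have "ncomp S h F \<le> card (insert (component h F b) (component h F ` S'))"
    unfolding ncomp_def using fin by (intro card_mono) auto
  also have "\<dots> \<le> card (component h F ` S') + 1" using fin by (simp add: card_insert_if)
  also have "card (component h F ` S') \<le> card (component h (insert e F) ` S')"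
  proof (rule card_image_factor[OF fin])
    fix x y assume xy: "x \<in> S'" "y \<in> S'" "component h (insert e F) x = component h (insert e F) y"
    then show "component h F x = component h F y"
      using conn_insert_edge[of x y h e F a b] assms(2) conn_sym[of b y h F]
      by (auto simp: component_eq_iff S'_def)
  qed
  also have "\<dots> \<le> ncomp S h (insert e F)"
    unfolding ncomp_def using assms by (intro card_mono image_mono) (auto simp: S'_def)
  finally show ?thesis by simp
qed

lemma ncomp_insert_redundant_edge:
  assumes "h e = {a, b}" "(a, b) \<in> (adj h F)\<^sup>*"
  shows "ncomp S h (insert e F) = ncomp S h F"
proof -
  have "(s, t) \<in> (adj h (insert e F))\<^sup>* \<longleftrightarrow> (s, t) \<in> (adj h F)\<^sup>*" for s t
    using conn_insert_edge[of s t h e F a b] assms(1) conn_mono[of F "insert e F" s t h] assms(2)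
      conn_sym[OF assms(2)] by (meson rtrancl_trans subset_insertI)
  then show ?thesis by (simp add: ncomp_def component_def Image_def)
qed

lemma two_factor_compl:
  assumes "mgraph V E h" "perfect_matching V E h M" "v \<in> V" "card (inc h E v) = 3"
  shows "card (inc h (E - M) v) = 2"
proof -
  have "inc h (E - M) v = inc h E v - inc h M v" by (auto simp: inc_def)
  moreover have "inc h M v \<subseteq> inc h E v" using assms by (auto simp: inc_def perfect_matching_def)
  moreover have "finite (inc h E v)" using assms by (auto simp: inc_def mgraph_def)
  ultimately show ?thesis using assms by (simp add: card_Diff_subset finite_subset perfect_matching_def)
qed

text \<open>Deleting a vertex from a cycle leaves a path: otherwise the part reached from one of its
  neighbours would contain exactly one vertex of odd degree.\<close>

lemma two_factor_neighbours_connected: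
  assumes G: "mgraph V F h" and deg: "\<forall>z\<in>V. card (inc h F z) = 2"
    and v: "inc h F v = {e1, e2}" "e1 \<noteq> e2" "h e1 = {v, a}" "h e2 = {v, b}" "a \<noteq> v" "b \<noteq> v"
  shows "(a, b) \<in> (adj h (F - {e1, e2}))\<^sup>*"
proof (rule ccontr)
  assume nc: "\<not> ?thesis"
  define F0 where "F0 = F - {e1, e2}"
  define Y where "Y = component h F0 a"
  have e: "e1 \<in> F" "e2 \<in> F" using v by (auto simp: inc_def)
  have aV: "a \<in> V" using G e v by (auto simp: mgraph_def)
  have G0: "mgraph V F0 h" using mgraph_subset[OF G] by (auto simp: F0_def)
  have YV: "Y \<subseteq> V" unfolding Y_def using component_subset[OF G0 aV] .
  have "component h F0 v = {v}" using v(1) by (intro component_isolated) (auto simp: F0_def inc_def)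
  then have vY: "v \<notin> Y" using v(5) unfolding Y_def by (metis component_eq_iff in_component_iff self_in_component singletonD)
  have bY: "b \<notin> Y" using nc by (simp add: Y_def in_component_iff F0_def)
  have aY: "a \<in> Y" by (simp add: Y_def)
  have "cut h F0 Y = {}" unfolding Y_def by (rule cut_component[OF G0])
  moreover have "e1 \<in> cut h F Y" "e2 \<notin> cut h F Y" using e v vY bY aY by (auto simp: cut_def)
  ultimately have "cut h F Y = {e1}" by (auto simp: cut_def F0_def)
  then have "(\<Sum>z\<in>Y. card (inc h F z)) = 1 + 2 * card {e \<in> F. h e \<subseteq> Y}"
    using sum_inc[OF G YV, of "\<lambda>_. 1 :: nat"] by simp
  moreover have "(\<Sum>z\<in>Y. card (inc h F z)) = 2 * card Y"
    using deg YV by (subst sum.cong[OF refl, of _ _ "\<lambda>_. 2"]) auto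
  ultimately show False by presburger
qed

text \<open>Peel off the vertices of \<open>R\<close> one at a time, each through an edge leaving the current set.
  A cycle of a 2-factor is first broken at a vertex both of whose remaining neighbours are
  connected in what is left, and the edge through which that vertex is peeled is then matched.
  The peeling edges of this kind are counted by the cyclomatic number.\<close>

lemma peeling:
  assumes G: "cubic_2ec V E h" and R: "R \<subseteq> V" "R \<noteq> V"
  shows "\<exists>D\<subseteq>E. (\<forall>e\<in>D. h e \<inter> R \<noteq> {}) \<and>
    card D + card R \<le> card {e \<in> E. h e \<subseteq> R} + ncomp R h {e \<in> E. h e \<subseteq> R} \<and>
    (\<forall>M. perfect_matching V E h M \<longrightarrow>
      card (component h (E - M) ` {v \<in> R. component h (E - M) v \<subseteq> R}) \<le> card (M \<inter> D))"
proof -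
  have mg: "mgraph V E h" using G by (simp add: cubic_2ec_def)
  have fin: "finite V" "finite E" using mg by (auto simp: mgraph_def)
  have "finite R" using R fin finite_subset by auto
  then show ?thesis using R
  proof (induction R rule: finite_psubset_induct)
    case (psubset R)
    define EI where "EI S = {e \<in> E. h e \<subseteq> S}" for S
    show ?case
    proof (cases "R = {}")
      case True
      then show ?thesis by (intro exI[of _ "{}"]) simp
    next
      case False
      \<comment> \<open>Two-edge-connectivity supplies an edge \<open>e0\<close> leaving
        \<open>R\<close>. Its end \<open>v\<close> in \<open>R\<close> is the vertex to peel, so at
        most two of the three edges at \<open>v\<close> stay inside \<open>R\<close>.\<close>
      then have "2 \<le> card (cut h E R)" using G psubset.prems unfolding cubic_2ec_def by blast
      then have "cut h E R \<noteq> {}" by auto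
      then obtain e0 where e0: "e0 \<in> E" "h e0 \<inter> R \<noteq> {}" "\<not> h e0 \<subseteq> R" by (auto simp: cut_def)
      obtain p q where "h e0 = {p, q}" using mgraph_ends[OF mg e0(1)] by metis
      then obtain v u where vu: "h e0 = {v, u}" "v \<in> R" "u \<notin> R" using e0 by (auto simp: insert_commute)
      have vV: "v \<in> V" using vu psubset.prems by auto
      define R' where "R' = R - {v}"
      have R': "R = insert v R'" "v \<notin> R'" "finite R'" using vu psubset.hyps by (auto simp: R'_def)
      define N where "N = {e \<in> E. v \<in> h e \<and> h e \<subseteq> R}"
      have EIR: "EI R = EI R' \<union> N" "EI R' \<inter> N = {}" by (auto simp: EI_def N_def R'_def)
      have finN: "finite N" "finite (EI R')" using fin by (auto simp: N_def EI_def)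
      have inc3: "card (inc h E v) = 3" using G vV by (simp add: cubic_2ec_def)
      have Ninc: "N \<subseteq> inc h E v - {e0}" using e0 by (auto simp: N_def inc_def)
      have "card (inc h E v - {e0}) = 2" using inc3 vu e0 by (simp add: inc_def)
      then have cardN: "card N \<le> 2"
        using Ninc by (metis card_mono card.infinite zero_neq_numeral)
      have "R' \<subset> R" using vu by (auto simp: R'_def)
      then obtain D where D: "D \<subseteq> E" "\<forall>e\<in>D. h e \<inter> R' \<noteq> {}"
        "card D + card R' \<le> card (EI R') + ncomp R' h (EI R')"
        "\<And>M. perfect_matching V E h M \<Longrightarrow>
          card (component h (E - M) ` {v \<in> R'. component h (E - M) v \<subseteq> R'}) \<le> card (M \<inter> D)"
        using psubset.IH[of R'] psubset.prems unfolding EI_def by blast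
      have finD: "finite D" using D fin finite_subset by auto
      have e0D: "e0 \<notin> D" using D(2) vu by (auto simp: R'_def)
      have iso: "ncomp R h (EI R') = ncomp R' h (EI R') + 1"
        unfolding R'(1) using R'(2,3) by (intro ncomp_insert_isolated) (auto simp: EI_def)
      have cardR: "card R = card R' + 1" using R' by simp
      have cardEI: "card (EI R) = card (EI R') + card N"
        unfolding EIR(1) using EIR(2) finN by (simp add: card_Un_disjoint)
      have Nend: "\<exists>a. h e = {v, a} \<and> a \<noteq> v \<and> a \<in> R'" if "e \<in> N" for e
      proof -
        have "e \<in> E" "v \<in> h e" "h e \<subseteq> R" using that by (auto simp: N_def)
        moreover obtain a where "h e = {v, a}" "a \<noteq> v"
          using mgraph_other_end[OF mg \<open>e \<in> E\<close> \<open>v \<in> h e\<close>] .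
        ultimately show ?thesis by (auto simp: R'_def)
      qed
      define K where "K M S = component h (E - M) ` {v \<in> S. component h (E - M) v \<subseteq> S}" for M S
      \<comment> \<open>Enlarging \<open>R'\<close> by \<open>v\<close> completes at most one
        further component, the one through \<open>v\<close>.\<close>
      have K1: "card (K M R) \<le> card (K M R') + (if component h (E - M) v \<subseteq> R then 1 else 0)" for M
      proof -
        have "K M R \<subseteq> K M R' \<union> (if component h (E - M) v \<subseteq> R then {component h (E - M) v} else {})"
        proof
          fix C assume "C \<in> K M R"
          then obtain z where z: "z \<in> R" "C = component h (E - M) z" "C \<subseteq> R" by (auto simp: K_def)
          show "C \<in> K M R' \<union> (if component h (E - M) v \<subseteq> R then {component h (E - M) v} else {})"
          proof (cases "v \<in> C")
            case True
            then have "C = component h (E - M) v" using z by (simp add: component_eq_iff in_component_iff)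
            then show ?thesis using z by simp
          next
            case False
            then have "C \<subseteq> R'" "z \<in> R'" using z R'_def by auto
            then show ?thesis using z by (auto simp: K_def)
          qed
        qed
        moreover have "finite (K M R')" using R' by (simp add: K_def)
        ultimately have "card (K M R) \<le> card (K M R' \<union>
            (if component h (E - M) v \<subseteq> R then {component h (E - M) v} else {}))"
          by (intro card_mono) auto
        also have "\<dots> \<le> card (K M R') + (if component h (E - M) v \<subseteq> R then 1 else 0)"
          by (rule order_trans[OF card_Un_le]) simp
        finally show ?thesis .
      qed
      \<comment> \<open>A cycle through \<open>v\<close> that stays in \<open>R\<close> cannot use
        \<open>e0\<close>, so \<open>e0\<close> is matched. Its two edges at \<open>v\<close> are
        then all of \<open>N\<close>, and the rest of the cycle joins their other ends within
        \<open>R'\<close>.\<close>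
      have K2: "e0 \<in> M \<and> (\<exists>e1 e2 a b. N = {e1, e2} \<and> e1 \<noteq> e2 \<and> h e1 = {v, a} \<and> h e2 = {v, b} \<and>
          (a, b) \<in> (adj h (EI R'))\<^sup>*)"
        if M: "perfect_matching V E h M" and C: "component h (E - M) v \<subseteq> R" for M
      proof -
        define F where "F = E - M"
        have mgF: "mgraph V F h" using mgraph_subset[OF mg] by (auto simp: F_def)
        have deg2: "\<forall>z\<in>V. card (inc h F z) = 2"
          using two_factor_compl[OF mg M] G by (simp add: F_def cubic_2ec_def)
        have e0M: "e0 \<in> M"
        proof (rule ccontr)
          assume "e0 \<notin> M"
          then have "u \<in> component h F v" using e0 vu component_edge[of e0 F h v u v] by (auto simp: F_def)
          then show False using C vu by (auto simp: F_def)
        qed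
        have sub: "inc h F v \<subseteq> N"
        proof
          fix e assume e: "e \<in> inc h F v"
          then have eF: "e \<in> F" "v \<in> h e" by (auto simp: inc_def)
          obtain a where a: "h e = {v, a}" using mgraph_other_end[OF mgF eF] by metis
          then have "a \<in> component h F v" using component_edge[of e F h v a v] eF(1) a by simp
          then show "e \<in> N" using C eF a vu by (auto simp: N_def F_def)
        qed
        then have N: "N = inc h F v" using deg2 vV cardN finN by (metis card_seteq)
        then obtain e1 e2 where e12: "N = {e1, e2}" "e1 \<noteq> e2" using deg2 vV by (metis card_2_iff)
        obtain a where a: "h e1 = {v, a}" "a \<noteq> v" "a \<in> R'" using Nend e12 by blast
        obtain b where b: "h e2 = {v, b}" "b \<noteq> v" "b \<in> R'" using Nend e12 by blast
        have ab: "(a, b) \<in> (adj h (F - {e1, e2}))\<^sup>*"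
          using two_factor_neighbours_connected[OF mgF deg2 _ e12(2) a(1) b(1) a(2) b(2)] N e12 by simp
        have "(a, b) \<in> (adj h (EI R'))\<^sup>* \<and> b \<in> component h F v"
          using ab
        proof (induction rule: rtrancl_induct)
          case base
          have "a \<in> component h F v" using component_edge[of e1 F h v a v] a(1) N e12 by (auto simp: inc_def)
          then show ?case by simp
        next
          case (step y z)
          then obtain e where e: "e \<in> F - {e1, e2}" "h e = {y, z}" by (auto simp: adj_def)
          have z: "z \<in> component h F v" using component_edge[of e F h y z v] e step by auto
          have "v \<notin> h e" using e N e12 by (auto simp: inc_def)
          moreover have "h e \<subseteq> R" using e step z C by (auto simp: F_def)
          ultimately have "e \<in> EI R'" using e by (auto simp: EI_def R'_def F_def)
          then have "(y, z) \<in> adj h (EI R')" using e by (auto simp: adj_def)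
          then show ?case using step z by (meson rtrancl.rtrancl_into_rtrancl)
        qed
        then show ?thesis using e0M e12 a b by blast
      qed
      \<comment> \<open>\<open>D\<close> is kept when no cycle can be completed at \<open>v\<close>;
        \<open>bound\<close> says that the cyclomatic number has not dropped.\<close>
      have stay: ?thesis
        if bound: "card N + ncomp R h (EI R) \<ge> ncomp R' h (EI R') + 1"
          and no: "\<And>M. perfect_matching V E h M \<Longrightarrow> \<not> component h (E - M) v \<subseteq> R"
      proof (intro exI[of _ D] conjI allI impI)
        show "\<forall>e\<in>D. h e \<inter> R \<noteq> {}" using D(2) by (auto simp: R'_def)
        show "card D + card R \<le> card {e \<in> E. h e \<subseteq> R} + ncomp R h {e \<in> E. h e \<subseteq> R}"
          using D(3) bound cardR cardEI by (simp add: EI_def)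
        fix M assume "perfect_matching V E h M"
        then show "card (component h (E - M) ` {v \<in> R. component h (E - M) v \<subseteq> R}) \<le> card (M \<inter> D)"
          using K1[of M] no D(4)[of M] by (simp add: K_def)
      qed (use D in auto)
      consider "N = {}" | e where "N = {e}" | e1 e2 where "N = {e1, e2}" "e1 \<noteq> e2"
      proof -
        have "card N = 0 \<or> card N = 1 \<or> card N = 2" using cardN by linarith
        then show thesis using that finN by (metis card_0_eq card_1_singletonE card_2_iff)
      qed
      then show ?thesis
      proof cases
        case 1
        then show ?thesis using iso EIR K2 by (intro stay) auto
      next
        case (2 e)
        obtain a where a: "h e = {v, a}" using Nend 2 by blast
        have "EI R = insert e (EI R')" using EIR 2 by auto
        then have "ncomp R h (EI R') \<le> ncomp R h (EI R) + 1"
          using ncomp_insert_edge[of R h e v a "EI R'"] psubset.hyps(1) a by simp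
        then show ?thesis using iso K2 2 by (intro stay) (auto simp: singleton_insert_inj_eq')
      next
        case (3 e1 e2)
        obtain a where a: "h e1 = {v, a}" "a \<noteq> v" using Nend 3 by blast
        obtain b where b: "h e2 = {v, b}" "b \<noteq> v" using Nend 3 by blast
        have EI3: "EI R = insert e2 (insert e1 (EI R'))" using EIR 3 by auto
        have n1: "ncomp R h (EI R') \<le> ncomp R h (insert e1 (EI R')) + 1"
          using ncomp_insert_edge[of R h e1 v a "EI R'"] psubset.hyps(1) a(1) by simp
        show ?thesis
        proof (cases "(a, b) \<in> (adj h (EI R'))\<^sup>*")
          case True
          have "(v, a) \<in> (adj h (insert e1 (EI R')))\<^sup>*" using a by (intro conn_edge) auto
          moreover have "(a, b) \<in> (adj h (insert e1 (EI R')))\<^sup>*" using True by (rule conn_mono[rotated]) auto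
          ultimately have "(v, b) \<in> (adj h (insert e1 (EI R')))\<^sup>*" by (rule rtrancl_trans)
          then have "ncomp R h (EI R) = ncomp R h (insert e1 (EI R'))"
            using ncomp_insert_redundant_edge[of h e2 v b] b(1) EI3 by simp
          \<comment> \<open>The second edge at \<open>v\<close> closes a cycle in the induced graph.
            This increase of the cyclomatic number pays for adding \<open>e0\<close> to
            \<open>D\<close>.\<close>
          with n1 iso have nc: "ncomp R' h (EI R') \<le> ncomp R h (EI R)" by simp
          show ?thesis
          proof (intro exI[of _ "insert e0 D"] conjI allI impI)
            show "insert e0 D \<subseteq> E" using D e0 by auto
            show "\<forall>e\<in>insert e0 D. h e \<inter> R \<noteq> {}" using D(2) e0 by (auto simp: R'_def)
            show "card (insert e0 D) + card R \<le> card {e \<in> E. h e \<subseteq> R} + ncomp R h {e \<in> E. h e \<subseteq> R}"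
              using D(3) nc cardR cardEI 3 e0D finD by (simp add: EI_def)
            fix M assume M: "perfect_matching V E h M"
            have "card (M \<inter> insert e0 D) = card (M \<inter> D) + (if e0 \<in> M then 1 else 0)"
              using e0D finD by simp
            then show "card (component h (E - M) ` {v \<in> R. component h (E - M) v \<subseteq> R}) \<le> card (M \<inter> insert e0 D)"
              using K1[of M] K2[OF M] D(4)[OF M] by (auto simp: K_def split: if_splits)
          qed
        next
          case False
          have "ncomp R h (insert e1 (EI R')) \<le> ncomp R h (EI R) + 1"
            using ncomp_insert_edge[of R h e2 v b "insert e1 (EI R')"] psubset.hyps(1) b(1) EI3 by simp
          moreover have "\<not> component h (E - M) v \<subseteq> R" if M: "perfect_matching V E h M" for M
          proof
            assume "component h (E - M) v \<subseteq> R"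
            then obtain f1 f2 c d where f: "N = {f1, f2}" "f1 \<noteq> f2" "h f1 = {v, c}" "h f2 = {v, d}"
              "(c, d) \<in> (adj h (EI R'))\<^sup>*" using K2[OF M] by blast
            then have "f1 = e1 \<and> f2 = e2 \<or> f1 = e2 \<and> f2 = e1" using 3 by (auto simp: doubleton_eq_iff)
            then have "c = a \<and> d = b \<or> c = b \<and> d = a" using f a b by (auto simp: doubleton_eq_iff)
            then show False using f(5) False conn_sym by metis
          qed
          ultimately show ?thesis using n1 iso 3 by (intro stay) auto
        qed
      qed
    qed
  qed
qed

definition two_factor :: "'v set \<Rightarrow> 'e set \<Rightarrow> ('e \<Rightarrow> 'v set) \<Rightarrow> 'e set \<Rightarrow> bool" where
  "two_factor V E h F \<longleftrightarrow> F \<subseteq> E \<and> (\<forall>v\<in>V. card (inc h F v) = 2)"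

lemma cubic_handshake:
  assumes "mgraph V E h" "\<forall>v\<in>V. card (inc h E v) = 3" "X \<subseteq> V"
  shows "3 * card X = card (cut h E X) + 2 * card {e \<in> E. h e \<subseteq> X}"
proof -
  have "(\<Sum>v\<in>X. card (inc h E v)) = 3 * card X"
    using assms by (subst sum.cong[OF refl, of _ _ "\<lambda>_. 3"]) auto
  then show ?thesis using sum_inc[OF assms(1,3), of "\<lambda>_. 1 :: nat"] by simp
qed

lemma cubic_card_even:
  assumes "cubic_2ec V E h"
  shows "2 * card E = 3 * card V" "even (card V)"
proof -
  have mg: "mgraph V E h" and deg: "\<forall>v\<in>V. card (inc h E v) = 3" using assms by (auto simp: cubic_2ec_def)
  have "{e \<in> E. h e \<subseteq> V} = E" using mg by (auto simp: mgraph_def)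
  then show "2 * card E = 3 * card V" using cubic_handshake[OF mg deg, of V] cut_everything[OF mg] by simp
  then show "even (card V)" by presburger
qed

text \<open>By the handshake count an odd set has an odd cut, and bridgelessness excludes size one.
  So at least three edges leave it, which is what the value 1/3 requires.\<close>

lemma third_fractional_pm:
  assumes G: "cubic_2ec V E h"
  shows "fractional_pm V E h (\<lambda>_. 1 / 3)"
  unfolding fractional_pm_def
proof (intro conjI ballI allI impI)
  have mg: "mgraph V E h" and deg: "\<forall>v\<in>V. card (inc h E v) = 3" using G by (auto simp: cubic_2ec_def)
  show "sum (\<lambda>_. 1 / 3) (inc h E v) = (1 :: real)" if "v \<in> V" for v using deg that by simp
  fix X assume X: "X \<subseteq> V" "odd (card X)"
  then have "X \<noteq> {}" "X \<noteq> V" using cubic_card_even[OF G] by auto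
  then have "2 \<le> card (cut h E X)" using G X by (simp add: cubic_2ec_def)
  moreover have "odd (card (cut h E X))" 
  proof -
    have "odd (3 * card X)" using X(2) by simp
    then show ?thesis unfolding cubic_handshake[OF mg deg X(1)] by simp
  qed
  ultimately have "3 \<le> card (cut h E X)" by (cases "card (cut h E X) = 2") auto
  then show "1 \<le> sum (\<lambda>_. 1 / 3 :: real) (cut h E X)" by simp
qed simp

text \<open>A cut vertex \<open>r\<close> would have to share its three edges between two parts,
  each of which needs at least two edges leaving it.\<close>

lemma delete_vertex_connected:
  assumes G: "cubic_2ec V E h" and r: "r \<in> V"
  shows "ncomp (V - {r}) h {e \<in> E. h e \<subseteq> V - {r}} \<le> 1"
proof -
  define R where "R = V - {r}"
  define I where "I = {e \<in> E. h e \<subseteq> R}"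
  have mg: "mgraph V E h" using G by (simp add: cubic_2ec_def)
  have mgI: "mgraph R I h" using mg by (auto simp: I_def R_def mgraph_def)
  have fin: "finite E" using mg by (simp add: mgraph_def)
  have "component h I b = component h I a" if ab: "a \<in> R" "b \<in> R" for a b
  proof (rule ccontr)
    assume ne: "component h I b \<noteq> component h I a"
    define Y where "Y = component h I a"
    have Y: "Y \<subseteq> R" unfolding Y_def using component_subset[OF mgI] ab by simp
    have bY: "b \<notin> Y" using ne unfolding Y_def by (metis component_eq_iff in_component_iff)
    have aY: "a \<in> Y" by (simp add: Y_def)
    have cI: "cut h I Y = {}" unfolding Y_def by (rule cut_component[OF mgI])
    have r_end: "r \<in> h e" if "e \<in> E" "h e \<inter> Y \<noteq> {}" "\<not> h e \<subseteq> Y" for e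
    proof (rule ccontr)
      assume "r \<notin> h e"
      then have "e \<in> I" using that mg by (auto simp: I_def R_def mgraph_def)
      then show False using that cI by (auto simp: cut_def)
    qed
    have "Y \<subseteq> V" "Y \<noteq> {}" "Y \<noteq> V" "R - Y \<subseteq> V" "R - Y \<noteq> {}" "R - Y \<noteq> V"
      using Y aY bY ab r by (auto simp: R_def)
    then have two: "2 \<le> card (cut h E Y)" "2 \<le> card (cut h E (R - Y))"
      using G unfolding cubic_2ec_def by blast+
    have "cut h E Y \<inter> cut h E (R - Y) = {}"
    proof -
      have False if e: "e \<in> cut h E Y" "e \<in> cut h E (R - Y)" for e
      proof -
        have eE: "e \<in> E" "r \<in> h e" using e r_end by (auto simp: cut_def)
        obtain p where "h e = {r, p}" using mgraph_other_end[OF mg eE] by metis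
        then show False using e Y by (auto simp: cut_def R_def)
      qed
      then show ?thesis by blast
    qed
    moreover have "cut h E Y \<union> cut h E (R - Y) \<subseteq> inc h E r"
    proof
      fix e assume "e \<in> cut h E Y \<union> cut h E (R - Y)"
      then consider "e \<in> cut h E Y" | "e \<in> cut h E (R - Y)" by blast
      then show "e \<in> inc h E r"
      proof cases
        case 1
        then show ?thesis using r_end by (auto simp: cut_def inc_def)
      next
        case 2
        then have e: "e \<in> E" "h e \<inter> (R - Y) \<noteq> {}" "\<not> h e \<subseteq> R - Y" by (auto simp: cut_def)
        show ?thesis
        proof (rule ccontr)
          assume "e \<notin> inc h E r"
          then have "h e \<subseteq> R" using e mg by (auto simp: inc_def R_def mgraph_def)
          then have "r \<in> h e" using e by (intro r_end) auto
          then show False using \<open>h e \<subseteq> R\<close> by (auto simp: R_def)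
        qed
      qed
    qed
    ultimately have "card (cut h E Y) + card (cut h E (R - Y)) \<le> card (inc h E r)"
      using fin by (metis card_Un_disjoint card_mono cut_subset finite_subset inc_subset)
    also have "\<dots> = 3" using G r by (simp add: cubic_2ec_def)
    finally show False using two by simp
  qed
  then have "component h I ` R \<subseteq> {component h I a}" if "a \<in> R" for a using that by blast
  then have "card (component h I ` R) \<le> 1"
    by (cases "R = {}") (auto, metis card.empty card_insert_disjoint card_mono empty_iff finite.intros One_nat_def all_not_in_conv)
  then show ?thesis by (simp add: ncomp_def R_def I_def)
qed

text \<open>The matching is optimised for the indicator of \<open>D\<close> plus \<open>c\<close>,
  so that a single 2-factor obeys the combined bound. The free cost \<open>c\<close> is later
  concentrated on one edge in order to favour 2-factors containing it.\<close>

theorem two_factor_few_cycles: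
  assumes G: "cubic_2ec V E h"
  shows "\<exists>F. two_factor V E h F \<and>
    6 * real (ncomp V h F) + 6 * sum c (E - F) \<le> real (card V) + 4 + 2 * sum c E"
proof -
  have mg: "mgraph V E h" and deg: "\<forall>v\<in>V. card (inc h E v) = 3" using G by (auto simp: cubic_2ec_def)
  have fin: "finite V" "finite E" using mg by (auto simp: mgraph_def)
  obtain r where r: "r \<in> V" using G by (auto simp: cubic_2ec_def)
  define R where "R = V - {r}"
  obtain D where D: "D \<subseteq> E" "card D + card R \<le> card {e \<in> E. h e \<subseteq> R} + ncomp R h {e \<in> E. h e \<subseteq> R}"
    "\<And>M. perfect_matching V E h M \<Longrightarrow>
      card (component h (E - M) ` {v \<in> R. component h (E - M) v \<subseteq> R}) \<le> card (M \<inter> D)"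
    using peeling[OF G, of R] r unfolding R_def by auto
  have "{e \<in> E. h e \<subseteq> R} = E - inc h E r" using mg by (auto simp: R_def inc_def mgraph_def)
  then have "card {e \<in> E. h e \<subseteq> R} + 3 = card E"
    using deg r fin card_mono[OF fin(2) inc_subset[of h E r]]
    by (simp add: card_Diff_subset inc_subset finite_subset[OF inc_subset])
  moreover have "card R + 1 = card V" using r fin unfolding R_def by (metis Suc_eq_plus1 card_Suc_Diff1)
  ultimately have cardD: "2 * card D + 2 \<le> card V"
    using D(2) delete_vertex_connected[OF G r] cubic_card_even(1)[OF G] by (simp add: R_def)
  define w where "w e = (if e \<in> D then 1 else 0) + c e" for e
  obtain M where M: "perfect_matching V E h M" "sum w M \<le> (\<Sum>e\<in>E. w e * (1 / 3))"
    using edmonds_perfect_matching[OF mg] third_fractional_pm[OF G] unfolding edmonds_def by blast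
  have ME: "M \<subseteq> E" using M by (simp add: perfect_matching_def)
  then have finM: "finite M" using fin finite_subset by auto
  have "sum w M = real (card (M \<inter> D)) + sum c M"
    unfolding w_def using finM by (simp add: sum.distrib sum.inter_restrict[symmetric])
  moreover have "sum w E = real (card D) + sum c E"
    unfolding w_def using fin D(1) by (simp add: sum.distrib sum.inter_restrict[symmetric] Int_absorb1)
  ultimately have bound: "3 * real (card (M \<inter> D)) + 3 * sum c M \<le> real (card D) + sum c E"
    using M(2) by (simp add: sum_divide_distrib[symmetric])
  define F where "F = E - M"
  have F: "two_factor V E h F"
    using two_factor_compl[OF mg M(1)] deg by (auto simp: two_factor_def F_def)
  \<comment> \<open>The component through the deleted vertex \<open>r\<close> is the only one that
    the peeling does not count.\<close>
  have "ncomp V h F \<le> card (M \<inter> D) + 1"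
  proof -
    have mgF: "mgraph V F h" using mgraph_subset[OF mg] by (auto simp: F_def)
    define K where "K = component h F ` {v \<in> R. component h F v \<subseteq> R}"
    have "component h F v \<in> insert (component h F r) K" if "v \<in> V" for v
    proof (cases "r \<in> component h F v")
      case True
      then show ?thesis by (simp add: component_eq_iff in_component_iff)
    next
      case False
      then have "component h F v \<subseteq> R" using component_subset[OF mgF that] by (auto simp: R_def)
      moreover from this have "v \<in> R" using self_in_component[of v h F] by blast
      ultimately show ?thesis by (auto simp: K_def)
    qed
    then have "component h F ` V \<subseteq> insert (component h F r) K" by blast
    moreover have "finite K" using fin by (simp add: K_def R_def)
    ultimately have "ncomp V h F \<le> card (insert (component h F r) K)"
      unfolding ncomp_def by (intro card_mono) auto
    also have "\<dots> \<le> card K + 1" using \<open>finite K\<close> by (simp add: card_insert_if)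
    finally show ?thesis using D(3)[OF M(1)] by (simp add: K_def F_def)
  qed
  moreover have "E - F = M" using ME by (auto simp: F_def)
  ultimately have "6 * real (ncomp V h F) + 6 * sum c (E - F) \<le> real (card V) + 4 + 2 * sum c E"
    using bound cardD by simp
  then show ?thesis using F by blast
qed

subsection \<open>Reducing short cycles\<close>

text \<open>In a cubic graph the even degrees are 0 and 2. So this describes disjoint cycles
  together with uncovered vertices, each of which \<open>ncomp\<close> counts as a
  component.\<close>

definition even_sub :: "'v set \<Rightarrow> 'e set \<Rightarrow> ('e \<Rightarrow> 'v set) \<Rightarrow> 'e set \<Rightarrow> bool" where
  "even_sub V E h F \<longleftrightarrow> F \<subseteq> E \<and> (\<forall>v\<in>V. even (card (inc h F v)))"

lemma two_factor_even_sub: "two_factor V E h F \<Longrightarrow> even_sub V E h F"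
  by (auto simp: two_factor_def even_sub_def)

lemma two_factor_card:
  assumes "mgraph V E h" "two_factor V E h F"
  shows "card F = card V"
proof -
  have mg: "mgraph V F h" using assms mgraph_subset by (auto simp: two_factor_def)
  have "(\<Sum>v\<in>V. card (inc h F v)) = 2 * card V"
    using assms by (subst sum.cong[OF refl, of _ _ "\<lambda>_. 2"]) (auto simp: two_factor_def)
  moreover have "{e \<in> F. h e \<subseteq> V} = F" using mg by (auto simp: mgraph_def)
  ultimately show ?thesis
    using sum_inc[OF mg subset_refl, of "\<lambda>_. 1 :: nat"] cut_everything[OF mg] by simp
qed

lemma component_eq_edge:
  "e \<in> F \<Longrightarrow> h e = {x, y} \<Longrightarrow> component h F x = component h F y"
  by (simp add: component_eq_iff conn_edge)

text \<open>Common tool of all lifts: \<open>\<rho>\<close> carries components of the smaller graph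
  to components of the lift, and \<open>Z\<close> represents the components that the lift
  adds.\<close>

lemma ncomp_le_map:
  assumes mg: "mgraph V' F' h'" and "finite Z"
    and edge: "\<And>e. e \<in> F' \<Longrightarrow> \<exists>x y. h' e = {x, y} \<and> component h F (\<rho> x) = component h F (\<rho> y)"
    and cover: "\<And>v. v \<in> V \<Longrightarrow> component h F v \<in> component h F ` (\<rho> ` V' \<union> Z)"
  shows "ncomp V h F \<le> ncomp V' h' F' + card Z"
proof -
  have fin: "finite V'" using mg by (simp add: mgraph_def)
  have step: "component h F (\<rho> x) = component h F (\<rho> y)" if "(x, y) \<in> (adj h' F')\<^sup>*" for x y
    using that
  proof (induction rule: rtrancl_induct)
    case (step y z)
    then obtain e where e: "e \<in> F'" "h' e = {y, z}" by (auto simp: adj_def)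
    obtain a b where ab: "h' e = {a, b}" "component h F (\<rho> a) = component h F (\<rho> b)" using edge[OF e(1)] by blast
    then have "y = a \<and> z = b \<or> y = b \<and> z = a" using e by (auto simp: doubleton_eq_iff)
    then show ?case using step.IH ab by auto
  qed simp
  have "ncomp V h F \<le> card ((\<lambda>x. component h F (\<rho> x)) ` V' \<union> component h F ` Z)"
    unfolding ncomp_def using cover fin assms(2) by (intro card_mono) (auto simp: image_Un image_image)
  also have "\<dots> \<le> card ((\<lambda>x. component h F (\<rho> x)) ` V') + card (component h F ` Z)"
    by (rule card_Un_le)
  also have "card ((\<lambda>x. component h F (\<rho> x)) ` V') \<le> card (component h' F' ` V')"
    by (rule card_image_factor[OF fin]) (use step in \<open>auto simp: component_eq_iff\<close>)
  also have "card (component h F ` Z) \<le> card Z" by (rule card_image_le[OF assms(2)])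
  finally show ?thesis by (simp add: ncomp_def)
qed

section \<open>Uncrossing small cuts\<close>

lemma card_inc_sum: "finite F \<Longrightarrow> card (inc h F v) = (\<Sum>e\<in>F. if v \<in> h e then 1 else 0)"
  unfolding inc_def by (simp add: sum.inter_filter[symmetric])

lemma card_cut_sum:
  "finite F \<Longrightarrow> card (cut h F X) = (\<Sum>e\<in>F. if h e \<inter> X \<noteq> {} \<and> \<not> h e \<subseteq> X then 1 else 0)"
  unfolding cut_def by (simp add: sum.inter_filter[symmetric])

lemma cut_submodular:
  assumes "finite E"
  shows "card (cut h E (X \<inter> Y)) + card (cut h E (X \<union> Y)) \<le> card (cut h E X) + card (cut h E Y)"
  unfolding card_cut_sum[OF assms] sum.distrib[symmetric]
  by (rule sum_mono) auto

text \<open>The edge \<open>g\<close> belongs to both cuts on the right and to neither on the left,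
  hence the extra 2. For every other edge the inequality is checked from the positions of its
  ends.\<close>

lemma cut_posimodular:
  assumes "finite E" "g \<in> E" "h g = {a, b}" "a \<in> X \<inter> Y" "b \<notin> X \<union> Y"
    and two: "\<And>e. e \<in> E \<Longrightarrow> \<exists>x y. h e = {x, y}"
  shows "card (cut h E (X - Y)) + card (cut h E (Y - X)) + 2 \<le> card (cut h E X) + card (cut h E Y)"
proof -
  have fin: "finite (E - {g})" using assms by simp
  have split: "card (cut h E Z) = card (cut h (E - {g}) Z) + (if h g \<inter> Z \<noteq> {} \<and> \<not> h g \<subseteq> Z then 1 else 0)" for Z
    using assms(1,2) by (simp add: card_cut_sum sum.remove)
  have "card (cut h (E - {g}) (X - Y)) + card (cut h (E - {g}) (Y - X)) \<le>
      card (cut h (E - {g}) X) + card (cut h (E - {g}) Y)"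
    unfolding card_cut_sum[OF fin] sum.distrib[symmetric]
  proof (rule sum_mono)
    fix e assume "e \<in> E - {g}"
    then obtain x y where "h e = {x, y}" using two by blast
    then show "(if h e \<inter> (X - Y) \<noteq> {} \<and> \<not> h e \<subseteq> X - Y then 1 else 0) +
       (if h e \<inter> (Y - X) \<noteq> {} \<and> \<not> h e \<subseteq> Y - X then 1 else 0) \<le>
       (if h e \<inter> X \<noteq> {} \<and> \<not> h e \<subseteq> X then 1 else 0) + (if h e \<inter> Y \<noteq> {} \<and> \<not> h e \<subseteq> Y then 1 else (0 :: nat))"
      by (cases "x \<in> X"; cases "x \<in> Y"; cases "y \<in> X"; cases "y \<in> Y"; simp)
  qed
  then show ?thesis using assms(3-5) by (simp add: split)
qed

lemma cubic_cut_parity: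
  assumes "cubic_2ec V E h" "X \<subseteq> V"
  shows "even (card (cut h E X)) \<longleftrightarrow> even (card X)"
proof -
  have "3 * card X = card (cut h E X) + 2 * card {e \<in> E. h e \<subseteq> X}"
    using assms by (intro cubic_handshake) (auto simp: cubic_2ec_def)
  then have "even (3 * card X) \<longleftrightarrow> even (card (cut h E X) + 2 * card {e \<in> E. h e \<subseteq> X})" by simp
  then show ?thesis by simp
qed

text \<open>Uncrossing forces both sets to have cuts of size 3, whereas their intersection and
  differences have cuts of size 2. This contradicts the parity of cuts in a cubic graph.\<close>

lemma no_crossing_three_cuts:
  assumes G: "cubic_2ec V E h" and X: "X \<subseteq> V" "card (cut h E X) \<le> 3"
    and Y: "Y \<subseteq> V" "card (cut h E Y) \<le> 3"
    and g: "g \<in> E" "h g = {a, b}" "a \<in> X \<inter> Y" "b \<notin> X \<union> Y"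
    and union: "4 \<le> card (cut h E (X \<union> Y))"
  shows False
proof -
  have mg: "mgraph V E h" using G by (simp add: cubic_2ec_def)
  have fin: "finite E" "finite V" using mg by (auto simp: mgraph_def)
  have "b \<in> V" using mg g by (auto simp: mgraph_def)
  have "\<not> X \<subseteq> Y" "\<not> Y \<subseteq> X"
    using union X(2) Y(2) by (auto simp: Un_absorb1 Un_absorb2)
  then have "X - Y \<noteq> {}" "Y - X \<noteq> {}" by auto
  have ge2: "2 \<le> card (cut h E Z)" if "Z \<subseteq> V" "Z \<noteq> {}" "b \<notin> Z" for Z
    using G that \<open>b \<in> V\<close> unfolding cubic_2ec_def by blast
  have "2 \<le> card (cut h E (X \<inter> Y))" "2 \<le> card (cut h E (X - Y))" "2 \<le> card (cut h E (Y - X))"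
    using X Y g \<open>X - Y \<noteq> {}\<close> \<open>Y - X \<noteq> {}\<close> by (auto intro!: ge2)
  moreover have "card (cut h E (X \<inter> Y)) + card (cut h E (X \<union> Y)) \<le> card (cut h E X) + card (cut h E Y)"
    by (rule cut_submodular[OF fin(1)])
  moreover have "card (cut h E (X - Y)) + card (cut h E (Y - X)) + 2 \<le> card (cut h E X) + card (cut h E Y)"
  proof (rule cut_posimodular[of E g h a b])
    show "\<exists>x y. h e = {x, y}" if "e \<in> E" for e using mgraph_ends[OF mg that] by metis
  qed (fact fin g)+
  \<comment> \<open>The differences have cuts of size at least 2, so the two given cuts sum to 6.
    The 4 edges leaving the union then leave just 2 for the intersection.\<close>
  ultimately have c: "card (cut h E X) = 3" "card (cut h E (X \<inter> Y)) = 2" "card (cut h E (X - Y)) = 2"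
    using X(2) Y(2) union by linarith+
  have "even (card (X \<inter> Y))" "even (card (X - Y))" "odd (card X)"
    using cubic_cut_parity[OF G, of "X \<inter> Y"] cubic_cut_parity[OF G, of "X - Y"] cubic_cut_parity[OF G, of X] X c
    by auto
  moreover have "card X = card (X \<inter> Y) + card (X - Y)"
    using X fin finite_subset by (metis card_Int_Diff)
  ultimately show False by simp
qed

section \<open>Squares and their two reductions\<close>

locale square =
  fixes V :: "'v set" and E :: "'e set" and h :: "'e \<Rightarrow> 'v set"
    and p1 p2 p3 p4 q1 q2 q3 q4 :: 'v and e12 e23 e34 e41 g1 g2 g3 g4 :: 'e
  assumes G: "cubic_2ec V E h"
    and p: "distinct [p1, p2, p3, p4]" "{p1, p2, p3, p4} \<subseteq> V"
    and ends: "h e12 = {p1, p2}" "h e23 = {p2, p3}" "h e34 = {p3, p4}" "h e41 = {p4, p1}"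
      "h g1 = {p1, q1}" "h g2 = {p2, q2}" "h g3 = {p3, q3}" "h g4 = {p4, q4}"
    and inE: "{e12, e23, e34, e41, g1, g2, g3, g4} \<subseteq> E"
    and q: "{q1, q2, q3, q4} \<inter> {p1, p2, p3, p4} = {}"
begin

lemma rotate: "square V E h p2 p3 p4 p1 q2 q3 q4 q1 e23 e34 e41 e12 g2 g3 g4 g1"
  using G p ends inE q by unfold_locales auto

definition P where "P = {p1, p2, p3, p4}"
definition S where "S = {e12, e23, e34, e41, g1, g2, g3, g4}"
definition E0 where "E0 = E - S"

lemma mg: "mgraph V E h" and deg3: "v \<in> V \<Longrightarrow> card (inc h E v) = 3"
  using G by (auto simp: cubic_2ec_def)

lemma fin: "finite V" "finite E" "finite E0"
  using mg by (auto simp: mgraph_def E0_def)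

lemma edges_distinct: "distinct [e12, e23, e34, e41, g1, g2, g3, g4]"
proof -
  have "distinct (map h [e12, e23, e34, e41, g1, g2, g3, g4])"
    using p q by (auto simp: ends doubleton_eq_iff)
  then show ?thesis by (simp only: distinct_map)
qed

lemma q_in: "q1 \<in> V" "q2 \<in> V" "q3 \<in> V" "q4 \<in> V"
  using mg inE ends by (auto simp: mgraph_def)

lemma q_notin [simp]: "q1 \<notin> P" "q2 \<notin> P" "q3 \<notin> P" "q4 \<notin> P"
  using q by (auto simp: P_def)

lemma inc_eq: "v \<in> V \<Longrightarrow> B \<subseteq> E \<Longrightarrow> (\<And>e. e \<in> B \<Longrightarrow> v \<in> h e) \<Longrightarrow> card B = 3 \<Longrightarrow> inc h E v = B"
  using deg3[of v] fin by (intro card_subset_eq[symmetric]) (auto simp: inc_def)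

lemma incs: "inc h E p1 = {e41, e12, g1}" "inc h E p2 = {e12, e23, g2}"
  "inc h E p3 = {e23, e34, g3}" "inc h E p4 = {e34, e41, g4}"
  by (rule inc_eq; use p inE edges_distinct in \<open>auto simp: ends\<close>)+

lemma E0_avoid: "e \<in> E0 \<Longrightarrow> h e \<inter> P = {}"
  using incs unfolding E0_def S_def P_def inc_def by blast

lemma E_split: "E = E0 \<union> S" "E0 \<inter> S = {}"
  using inE by (auto simp: E0_def S_def)

lemma sum_S: "(\<Sum>e\<in>S. f e) = f e12 + f e23 + f e34 + f e41 + f g1 + f g2 + f g3 + (f g4 :: nat)"
  using edges_distinct by (simp add: S_def add.assoc)

lemma card_cut_avoiding:
  assumes "X \<inter> P = {}"
  shows "card (cut h E X) = card (cut h E0 X) + of_bool (q1 \<in> X) + of_bool (q2 \<in> X) + of_bool (q3 \<in> X) + of_bool (q4 \<in> X)"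
proof -
  have "finite S" by (simp add: S_def)
  then have "card (cut h E X) = card (cut h E0 X) + (\<Sum>e\<in>S. if h e \<inter> X \<noteq> {} \<and> \<not> h e \<subseteq> X then 1 else 0)"
    unfolding card_cut_sum[OF fin(2)] card_cut_sum[OF fin(3)]
    using fin(3) E_split(2) by (subst E_split(1)) (rule sum.union_disjoint)
  then show ?thesis using assms by (simp add: sum_S ends P_def)
qed

lemma cut_E0_compl: "X \<subseteq> V - P \<Longrightarrow> cut h E0 (V - P - X) = cut h E0 X"
  using E0_avoid mg by (intro cut_compl) (auto simp: mgraph_def E0_def)

text \<open>If the edges from \<open>x\<close> and \<open>y\<close> to the square are replaced by
  one edge joining \<open>x\<close> to \<open>y\<close>, the cut of such a set loses two edges and
  drops to at most one. So these sets are the obstacles to 2-edge-connectivity.\<close>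

definition bad where
  "bad x y X \<longleftrightarrow> X \<subseteq> V - P \<and> x \<in> X \<and> y \<in> X \<and> card (cut h E X) \<le> 3"

text \<open>At least four edges leave the union of the two sets: if it misses \<open>q4\<close>, the
  rest of the graph outside the square has, besides \<open>g4\<close>, another edge leaving it, and
  this edge must end in the union. The edge \<open>g2\<close> from the intersection to the square
  makes the uncrossing lemma applicable.\<close>

lemma bad_cross:
  assumes "bad q1 q2 X" "bad q2 q3 Y"
  shows False
proof -
  have XY: "X \<subseteq> V - P" "Y \<subseteq> V - P" "q1 \<in> X" "q2 \<in> X \<inter> Y" "q3 \<in> Y"
    "card (cut h E X) \<le> 3" "card (cut h E Y) \<le> 3" using assms by (auto simp: bad_def)
  have "4 \<le> card (cut h E (X \<union> Y))"
  proof (cases "q4 \<in> X \<union> Y")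
    case True
    then show ?thesis using XY by (subst card_cut_avoiding) auto
  next
    case False
    define D where "D = V - P - (X \<union> Y)"
    have D: "D \<subseteq> V" "q4 \<in> D" "q1 \<notin> D" "q2 \<notin> D" "q3 \<notin> D" "D \<inter> P = {}"
      using False q_in XY by (auto simp: D_def)
    moreover have "D \<noteq> V" using p by (auto simp: D_def P_def)
    ultimately have D: "D \<subseteq> V" "q4 \<in> D" "D \<noteq> V" "q1 \<notin> D" "q2 \<notin> D" "q3 \<notin> D" "D \<inter> P = {}"
      by blast+
    then have "2 \<le> card (cut h E D)" using G unfolding cubic_2ec_def by blast
    then have "1 \<le> card (cut h E0 D)" using D by (simp add: card_cut_avoiding)
    moreover have "cut h E0 D = cut h E0 (X \<union> Y)" unfolding D_def using XY by (intro cut_E0_compl) auto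
    ultimately show ?thesis using XY False by (subst card_cut_avoiding) auto
  qed
  then show False
    using no_crossing_three_cuts[OF G _ XY(6) _ XY(7), of g2 q2 p2] XY inE ends by (auto simp: P_def insert_commute)
qed

text \<open>The square and its four outgoing edges are replaced by two edges joining \<open>q1\<close> to \<open>q2\<close>
  and \<open>q3\<close> to \<open>q4\<close>.\<close>

definition h4 where "h4 = h(g1 := {q1, q2}, g3 := {q3, q4})"
definition E4 where "E4 = E0 \<union> {g1, g3}"

lemma h4_E0: "e \<in> E0 \<Longrightarrow> h4 e = h e"
  by (auto simp: h4_def E0_def S_def)

lemma h4_g [simp]: "h4 g1 = {q1, q2}" "h4 g3 = {q3, q4}"
  using edges_distinct by (auto simp: h4_def)

lemma g_notin: "g1 \<notin> E0" "g3 \<notin> E0" "g1 \<noteq> g3"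
  using edges_distinct by (auto simp: E0_def S_def)

text \<open>The cut of a set changes only if the set contains both ends of a new edge, and then
  loses two edges. With one such pair the set is not bad, so its cut had size at least 4; with both
  pairs the complement is considered.\<close>

lemma replaced_cubic_2ec:
  assumes ne: "q1 \<noteq> q2" "q3 \<noteq> q4"
    and good: "\<And>X. \<not> bad q1 q2 X" "\<And>X. \<not> bad q3 q4 X"
  shows "cubic_2ec (V - P) E4 h4"
proof -
  have mg4: "mgraph (V - P) E4 h4"
    unfolding mgraph_def
  proof (intro conjI ballI)
    fix e assume "e \<in> E4"
    then consider "e \<in> E0" | "e = g1" | "e = g3" by (auto simp: E4_def)
    then have "h4 e \<subseteq> V - P \<and> card (h4 e) = 2"
    proof cases
      case 1
      then have "h e \<subseteq> V" "card (h e) = 2" using mg by (auto simp: mgraph_def E0_def)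
      then show ?thesis using E0_avoid[OF 1] by (auto simp: h4_E0[OF 1])
    qed (use ne q_in in auto)
    then show "h4 e \<subseteq> V - P" "card (h4 e) = 2" by auto
  qed (use fin in \<open>auto simp: E4_def\<close>)
  have splitE4: "(\<Sum>e\<in>E4. f e) = (\<Sum>e\<in>E0. f e) + f g1 + (f g3 :: nat)" for f
    unfolding E4_def using fin g_notin by (simp add: add.assoc add.commute)
  have splitE: "(\<Sum>e\<in>E. f e) = (\<Sum>e\<in>E0. f e) + (\<Sum>e\<in>S. (f e :: nat))" for f
    using fin(3) E_split(2) by (subst E_split(1)) (rule sum.union_disjoint, auto simp: S_def)
  have deg: "card (inc h4 E4 v) = 3" if v: "v \<in> V - P" for v
  proof -
    have "card (inc h4 E4 v) = card (inc h E v)"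
    proof -
      have "(\<Sum>e\<in>E0. if v \<in> h4 e then 1 else 0 :: nat) = (\<Sum>e\<in>E0. if v \<in> h e then 1 else 0)"
        by (intro sum.cong) (auto simp: h4_E0)
      moreover have "finite E4" using fin by (simp add: E4_def)
      ultimately show ?thesis
        using v ne fin by (auto simp: card_inc_sum splitE4 splitE sum_S ends P_def)
    qed
    then show ?thesis using deg3 v by simp
  qed
  have cut4: "card (cut h4 E4 X) = card (cut h E0 X) + of_bool ((q1 \<in> X) \<noteq> (q2 \<in> X)) + of_bool ((q3 \<in> X) \<noteq> (q4 \<in> X))" for X
  proof -
    have "(\<Sum>e\<in>E0. if h4 e \<inter> X \<noteq> {} \<and> \<not> h4 e \<subseteq> X then 1 else 0 :: nat) = (\<Sum>e\<in>E0. if h e \<inter> X \<noteq> {} \<and> \<not> h e \<subseteq> X then 1 else 0)"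
      by (intro sum.cong) (auto simp: h4_E0)
    moreover have "finite E4" using fin by (simp add: E4_def)
    ultimately show ?thesis using fin by (auto simp: card_cut_sum splitE4)
  qed
  have two: "2 \<le> card (cut h E X)" if "X \<subseteq> V - P" "X \<noteq> {}" for X
  proof -
    have "X \<subseteq> V" "X \<noteq> V" using that p by (auto simp: P_def)
    then show ?thesis using G that unfolding cubic_2ec_def by blast
  qed
  have "2 \<le> card (cut h4 E4 X)" if X: "X \<subseteq> V - P" "X \<noteq> {}" "X \<noteq> V - P" for X
  proof -
    have XP: "X \<inter> P = {}" using X by auto
    consider "\<not> (q1 \<in> X \<and> q2 \<in> X)" "\<not> (q3 \<in> X \<and> q4 \<in> X)"
      | "q1 \<in> X \<and> q2 \<in> X" "\<not> (q3 \<in> X \<and> q4 \<in> X)"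
      | "\<not> (q1 \<in> X \<and> q2 \<in> X)" "q3 \<in> X \<and> q4 \<in> X"
      | "{q1, q2, q3, q4} \<subseteq> X" by blast
    then show ?thesis
    proof cases
      case 1
      then show ?thesis using two[OF X(1,2)] by (auto simp: cut4 card_cut_avoiding[OF XP])
    next
      case 2
      then have "4 \<le> card (cut h E X)" using good(1)[of X] X by (simp add: bad_def)
      then show ?thesis using 2 by (auto simp: cut4 card_cut_avoiding[OF XP])
    next
      case 3
      then have "4 \<le> card (cut h E X)" using good(2)[of X] X by (simp add: bad_def)
      then show ?thesis using 3 by (auto simp: cut4 card_cut_avoiding[OF XP])
    next
      case 4
      define D where "D = V - P - X"
      have D: "D \<subseteq> V - P" "D \<noteq> {}" "D \<inter> P = {}" "D \<inter> {q1, q2, q3, q4} = {}" using X 4 by (auto simp: D_def)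
      have "cut h4 E4 X = cut h4 E4 D" unfolding D_def using cut_compl[OF mg4 X(1)] by simp
      then show ?thesis using two[OF D(1,2)] D by (simp add: cut4 card_cut_avoiding[OF D(3)])
    qed
  qed
  moreover have "V - P \<noteq> {}" using q_in by auto
  ultimately show ?thesis using mg4 deg by (simp add: cubic_2ec_def)
qed

end

context square
begin

lemma edge_neq [simp]:
  "e12 \<noteq> e23" "e12 \<noteq> e34" "e12 \<noteq> e41" "e23 \<noteq> e34" "e23 \<noteq> e41" "e34 \<noteq> e41"
  "e12 \<noteq> g1" "e12 \<noteq> g2" "e12 \<noteq> g3" "e12 \<noteq> g4" "e23 \<noteq> g1" "e23 \<noteq> g2" "e23 \<noteq> g3" "e23 \<noteq> g4"
  "e34 \<noteq> g1" "e34 \<noteq> g2" "e34 \<noteq> g3" "e34 \<noteq> g4" "e41 \<noteq> g1" "e41 \<noteq> g2" "e41 \<noteq> g3" "e41 \<noteq> g4"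
  "g1 \<noteq> g2" "g1 \<noteq> g3" "g1 \<noteq> g4" "g2 \<noteq> g3" "g2 \<noteq> g4" "g3 \<noteq> g4"
  using edges_distinct by auto

lemmas edge_neq_sym [simp] = edge_neq[symmetric]

lemma card_inc_split:
  assumes "F0 \<subseteq> E0" "T \<subseteq> S"
  shows "card (inc h (F0 \<union> T) v) = card (inc h F0 v) + card (inc h T v)"
proof -
  have "finite F0" "finite T" using assms fin finite_subset[of T S] by (auto simp: S_def intro: finite_subset)
  moreover have "inc h (F0 \<union> T) v = inc h F0 v \<union> inc h T v" "inc h F0 v \<inter> inc h T v = {}"
    using assms E_split by (auto simp: inc_def)
  ultimately show ?thesis by (simp add: card_Un_disjoint inc_def)
qed

lemma inc_corner:
  assumes "T \<subseteq> S"
  shows "inc h T p1 = T \<inter> {e41, e12, g1}" "inc h T p2 = T \<inter> {e12, e23, g2}"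
    "inc h T p3 = T \<inter> {e23, e34, g3}" "inc h T p4 = T \<inter> {e34, e41, g4}"
proof -
  have "T \<subseteq> E" using assms inE by (auto simp: S_def)
  then have "inc h T v = T \<inter> inc h E v" for v by (auto simp: inc_def)
  then show "inc h T p1 = T \<inter> {e41, e12, g1}" "inc h T p2 = T \<inter> {e12, e23, g2}"
    "inc h T p3 = T \<inter> {e23, e34, g3}" "inc h T p4 = T \<inter> {e34, e41, g4}" by (simp_all add: incs)
qed

lemma inc_E0_corner: "F0 \<subseteq> E0 \<Longrightarrow> v \<in> P \<Longrightarrow> inc h F0 v = {}"
  using E0_avoid by (auto simp: inc_def)

lemma card_inc_outside:
  assumes "T \<subseteq> S" "v \<notin> P"
  shows "card (inc h T v) = of_bool (g1 \<in> T \<and> v = q1) + of_bool (g2 \<in> T \<and> v = q2)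
    + of_bool (g3 \<in> T \<and> v = q3) + of_bool (g4 \<in> T \<and> v = q4)"
proof -
  have "inc h T v = {e \<in> S. e \<in> T \<and> v \<in> h e}" using assms by (auto simp: inc_def)
  then have "card (inc h T v) = (\<Sum>e\<in>S. if e \<in> T \<and> v \<in> h e then 1 else 0)"
    by (simp add: S_def sum.inter_filter[symmetric])
  also have "\<dots> = of_bool (g1 \<in> T \<and> v = q1) + of_bool (g2 \<in> T \<and> v = q2)
    + of_bool (g3 \<in> T \<and> v = q3) + of_bool (g4 \<in> T \<and> v = q4)"
    unfolding sum_S using assms(2) by (auto simp: ends P_def)
  finally show ?thesis .
qed

lemma comp_edge:
  "e12 \<in> F \<Longrightarrow> component h F p1 = component h F p2" "e23 \<in> F \<Longrightarrow> component h F p2 = component h F p3"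
  "e34 \<in> F \<Longrightarrow> component h F p3 = component h F p4" "e41 \<in> F \<Longrightarrow> component h F p4 = component h F p1"
  "g1 \<in> F \<Longrightarrow> component h F p1 = component h F q1" "g2 \<in> F \<Longrightarrow> component h F p2 = component h F q2"
  "g3 \<in> F \<Longrightarrow> component h F p3 = component h F q3" "g4 \<in> F \<Longrightarrow> component h F p4 = component h F q4"
  using component_eq_edge[of _ F h] ends by metis+

text \<open>A new edge used by \<open>F'\<close> becomes a path through two corners, or through all
  four if \<open>F'\<close> avoids the other new edge. Only when \<open>F'\<close> avoids both must
  the square itself become an additional cycle.\<close>

lemma two_factor_lift:
  assumes ne: "q1 \<noteq> q2" "q3 \<noteq> q4" and G4: "mgraph (V - P) E4 h4" and F': "two_factor (V - P) E4 h4 F'"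
  shows "\<exists>F. two_factor V E h F \<and>
    ncomp V h F \<le> ncomp (V - P) h4 F' + of_bool (g1 \<notin> F' \<and> g3 \<notin> F')"
proof -
  define F0 where "F0 = F' \<inter> E0"
  have F0: "F0 \<subseteq> E0" by (simp add: F0_def)
  have F'E: "F' \<subseteq> E4" using F' by (simp add: two_factor_def)
  have F'_eq: "F' = F0 \<union> (F' \<inter> {g1, g3})" using F'E by (auto simp: F0_def E4_def)
  have finF0: "finite F0" using F0 fin finite_subset by auto
  have degF': "card (inc h F0 v) + of_bool (g1 \<in> F' \<and> v \<in> {q1, q2}) + of_bool (g3 \<in> F' \<and> v \<in> {q3, q4}) = 2"
    if v: "v \<in> V - P" for v
  proof -
    have "inc h4 F' v = inc h F0 v \<union> {e \<in> {g1, g3}. e \<in> F' \<and> v \<in> h4 e}"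
      using F'E h4_E0 by (auto simp: inc_def F0_def E4_def)
    moreover have "inc h F0 v \<inter> {e \<in> {g1, g3}. e \<in> F' \<and> v \<in> h4 e} = {}"
      using g_notin F0 by (auto simp: inc_def)
    moreover have "card {e \<in> {g1, g3}. e \<in> F' \<and> v \<in> h4 e} =
        of_bool (g1 \<in> F' \<and> v \<in> {q1, q2}) + of_bool (g3 \<in> F' \<and> v \<in> {q3, q4})"
    proof -
      have "card {e \<in> {g1, g3}. e \<in> F' \<and> v \<in> h4 e} = (\<Sum>e\<in>{g1, g3}. if e \<in> F' \<and> v \<in> h4 e then 1 else 0)"
        by (simp only: sum.inter_filter[symmetric] finite.intros card_eq_sum)
      then show ?thesis by simp
    qed
    ultimately have "card (inc h4 F' v) = card (inc h F0 v) +
        (of_bool (g1 \<in> F' \<and> v \<in> {q1, q2}) + of_bool (g3 \<in> F' \<and> v \<in> {q3, q4}))"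
      using finF0 by (simp add: card_Un_disjoint inc_def)
    then show ?thesis using F' v by (simp add: two_factor_def)
  qed
  \<comment> \<open>\<open>T\<close> is the part of the lift around the square, and \<open>Z\<close>
    represents the component that it adds, if any.\<close>
  have main: ?thesis
    if T: "T \<subseteq> S" "g1 \<in> T \<longleftrightarrow> g1 \<in> F'" "g2 \<in> T \<longleftrightarrow> g1 \<in> F'" "g3 \<in> T \<longleftrightarrow> g3 \<in> F'" "g4 \<in> T \<longleftrightarrow> g3 \<in> F'"
      and corner: "card (inc h T p1) = 2" "card (inc h T p2) = 2" "card (inc h T p3) = 2" "card (inc h T p4) = 2"
      and conn: "g1 \<in> F' \<Longrightarrow> component h (F0 \<union> T) q1 = component h (F0 \<union> T) q2"
        "g3 \<in> F' \<Longrightarrow> component h (F0 \<union> T) q3 = component h (F0 \<union> T) q4"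
      and cover: "finite Z" "card Z = of_bool (g1 \<notin> F' \<and> g3 \<notin> F')"
        "\<And>v. v \<in> {p1, p2, p3, p4} \<Longrightarrow> component h (F0 \<union> T) v \<in> component h (F0 \<union> T) ` ({q1, q2, q3, q4} \<union> Z)"
    for T Z
  proof (intro exI[of _ "F0 \<union> T"] conjI)
    show "two_factor V E h (F0 \<union> T)"
      unfolding two_factor_def
    proof (intro conjI ballI)
      show "F0 \<union> T \<subseteq> E" using F0 T E_split by auto
      fix v assume v: "v \<in> V"
      show "card (inc h (F0 \<union> T) v) = 2"
      proof (cases "v \<in> P")
        case True
        then show ?thesis using corner by (auto simp: card_inc_split[OF F0 T(1)] inc_E0_corner[OF F0 True] P_def)
      next
        case False
        then show ?thesis using degF'[of v] v ne
          by (auto simp: card_inc_split[OF F0 T(1)] card_inc_outside[OF T(1) False] T(2-5))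
      qed
    qed
    have "mgraph (V - P) F' h4" by (rule mgraph_subset[OF G4 F'E])
    then have "ncomp V h (F0 \<union> T) \<le> ncomp (V - P) h4 F' + card Z"
    proof (rule ncomp_le_map[where \<rho> = "\<lambda>v. v"])
      fix e assume e: "e \<in> F'"
      then consider "e \<in> F0" | "e = g1" | "e = g3" using F'_eq by blast
      then show "\<exists>x y. h4 e = {x, y} \<and> component h (F0 \<union> T) x = component h (F0 \<union> T) y"
      proof cases
        case 1
        then have "e \<in> E" using F0 E_split by auto
        then obtain x y where "h e = {x, y}" using mgraph_ends[OF mg] by metis
        moreover have "h4 e = h e" using 1 F0 h4_E0 by auto
        ultimately show ?thesis using component_eq_edge[of e "F0 \<union> T" h x y] 1 by auto
      qed (use conn e in auto)
    next
      fix v assume v: "v \<in> V"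
      have "{q1, q2, q3, q4} \<subseteq> V - P" using q_in by auto
      then show "component h (F0 \<union> T) v \<in> component h (F0 \<union> T) ` ((\<lambda>v. v) ` (V - P) \<union> Z)"
        using cover(3)[of v] v by (cases "v \<in> P") (auto simp: P_def)
    qed (rule cover)
    then show "ncomp V h (F0 \<union> T) \<le> ncomp (V - P) h4 F' + of_bool (g1 \<notin> F' \<and> g3 \<notin> F')"
      using cover(2) by simp
  qed
  consider "g1 \<in> F'" "g3 \<in> F'" | "g1 \<in> F'" "g3 \<notin> F'" | "g1 \<notin> F'" "g3 \<in> F'" | "g1 \<notin> F'" "g3 \<notin> F'" by blast
  then show ?thesis
  proof cases
    case 1
    let ?T = "{g1, g2, g3, g4, e12, e34}" let ?c = "component h (F0 \<union> ?T)"
    have TS: "?T \<subseteq> S" by (auto simp: S_def)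
    have "?c p1 = ?c q1" "?c p2 = ?c q2" "?c p3 = ?c q3" "?c p4 = ?c q4" "?c p1 = ?c p2" "?c p3 = ?c p4"
      by (rule comp_edge; simp)+
    then show ?thesis using 1 by (intro main[of ?T "{}"] TS) (auto simp: inc_corner[OF TS])
  next
    case 2
    let ?T = "{g1, g2, e41, e34, e23}" let ?c = "component h (F0 \<union> ?T)"
    have TS: "?T \<subseteq> S" by (auto simp: S_def)
    have "?c p1 = ?c q1" "?c p2 = ?c q2" "?c p4 = ?c p1" "?c p3 = ?c p4" "?c p2 = ?c p3"
      by (rule comp_edge; simp)+
    then show ?thesis using 2 by (intro main[of ?T "{}"] TS) (auto simp: inc_corner[OF TS])
  next
    case 3
    let ?T = "{g3, g4, e23, e12, e41}" let ?c = "component h (F0 \<union> ?T)"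
    have TS: "?T \<subseteq> S" by (auto simp: S_def)
    have "?c p3 = ?c q3" "?c p4 = ?c q4" "?c p4 = ?c p1" "?c p1 = ?c p2" "?c p2 = ?c p3"
      by (rule comp_edge; simp)+
    then show ?thesis using 3 by (intro main[of ?T "{}"] TS) (auto simp: inc_corner[OF TS])
  next
    case 4
    let ?T = "{e12, e23, e34, e41}" let ?c = "component h (F0 \<union> ?T)"
    have TS: "?T \<subseteq> S" by (auto simp: S_def)
    have "?c p4 = ?c p1" "?c p1 = ?c p2" "?c p2 = ?c p3"
      by (rule comp_edge; simp)+
    then show ?thesis using 4 by (intro main[of ?T "{p1}"] TS) (auto simp: inc_corner[OF TS])
  qed
qed

end

context square
begin

text \<open>Deleting \<open>e41\<close> and suppressing its ends \<open>p1\<close> and \<open>p4\<close>.\<close>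

definition V2 where "V2 = V - {p1, p4}"
definition h2 where "h2 = h(g1 := {q1, p2}, g4 := {q4, p3})"
definition E2 where "E2 = E0 \<union> {g1, g2, g3, g4, e23}"

lemma h2_E0: "e \<in> E0 \<Longrightarrow> h2 e = h e"
  by (auto simp: h2_def E0_def S_def)

lemma h2_simps [simp]: "h2 g1 = {q1, p2}" "h2 g2 = {p2, q2}" "h2 g3 = {p3, q3}" "h2 g4 = {q4, p3}" "h2 e23 = {p2, p3}"
  by (auto simp: h2_def ends)

lemma sum_E: "(\<Sum>e\<in>E. f e) = (\<Sum>e\<in>E0. f e) + (\<Sum>e\<in>S. (f e :: nat))"
  using fin(3) E_split(2) by (subst E_split(1)) (rule sum.union_disjoint, auto simp: S_def)

lemma sum_E2: "(\<Sum>e\<in>E2. f e) = (\<Sum>e\<in>E0. f e) + f g1 + f g2 + f g3 + f g4 + (f e23 :: nat)"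
proof -
  have "E0 \<inter> {g1, g2, g3, g4, e23} = {}" by (auto simp: E0_def S_def)
  then have "(\<Sum>e\<in>E2. f e) = (\<Sum>e\<in>E0. f e) + (\<Sum>e\<in>{g1, g2, g3, g4, e23}. f e)"
    unfolding E2_def using fin(3) by (intro sum.union_disjoint) auto
  then show ?thesis by (simp add: add.assoc)
qed

lemma fin2: "finite E2" "finite V2"
  using fin by (auto simp: E2_def V2_def)

lemma corner_neq [simp]: "p1 \<noteq> p2" "p1 \<noteq> p3" "p1 \<noteq> p4" "p2 \<noteq> p3" "p2 \<noteq> p4" "p3 \<noteq> p4"
  "p2 \<noteq> p1" "p3 \<noteq> p1" "p4 \<noteq> p1" "p3 \<noteq> p2" "p4 \<noteq> p2" "p4 \<noteq> p3"
  using p by auto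

lemma q_neq [simp]: "q1 \<noteq> p1" "q1 \<noteq> p2" "q1 \<noteq> p3" "q1 \<noteq> p4" "q2 \<noteq> p1" "q2 \<noteq> p2" "q2 \<noteq> p3" "q2 \<noteq> p4"
  "q3 \<noteq> p1" "q3 \<noteq> p2" "q3 \<noteq> p3" "q3 \<noteq> p4" "q4 \<noteq> p1" "q4 \<noteq> p2" "q4 \<noteq> p3" "q4 \<noteq> p4"
  using q by auto

lemmas q_neq_sym [simp] = q_neq[symmetric]

text \<open>A vertex set is lifted by putting \<open>p1\<close> with \<open>p2\<close> and
  \<open>p4\<close> with \<open>p3\<close>. The two cuts then differ only by the deleted edge
  \<open>e41\<close>, which counts exactly when \<open>p2\<close> and \<open>p3\<close> are
  separated; \<open>good\<close> supplies the spare edge in that case.\<close>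

lemma pinch_cubic_2ec:
  assumes good: "\<And>X. X \<subseteq> V \<Longrightarrow> p1 \<in> X \<Longrightarrow> p2 \<in> X \<Longrightarrow> p3 \<notin> X \<Longrightarrow> p4 \<notin> X \<Longrightarrow> 3 \<le> card (cut h E X)"
  shows "cubic_2ec V2 E2 h2"
proof -
  have mg2: "mgraph V2 E2 h2"
    unfolding mgraph_def
  proof (intro conjI ballI)
    fix e assume "e \<in> E2"
    then consider "e \<in> E0" | "e \<in> {g1, g2, g3, g4, e23}" by (auto simp: E2_def)
    then have "h2 e \<subseteq> V2 \<and> card (h2 e) = 2"
    proof cases
      case 1
      then have "h e \<subseteq> V" "card (h e) = 2" using mg by (auto simp: mgraph_def E0_def)
      then show ?thesis using E0_avoid[OF 1] by (auto simp: h2_E0[OF 1] V2_def P_def)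
    qed (use q_in p in \<open>auto simp: V2_def\<close>)
    then show "h2 e \<subseteq> V2" "card (h2 e) = 2" by auto
  qed (fact fin2)+
  have E0_eq: "(\<Sum>e\<in>E0. f (h2 e)) = (\<Sum>e\<in>E0. f (h e) :: nat)" for f
    by (intro sum.cong) (auto simp: h2_E0)
  have deg: "card (inc h2 E2 v) = 3" if v: "v \<in> V2" for v
  proof (cases "v \<in> P")
    case True
    then have "v = p2 \<or> v = p3" using v by (auto simp: P_def V2_def)
    moreover have "(\<Sum>e\<in>E0. if v \<in> h e then 1 else 0 :: nat) = 0"
      using E0_avoid True by (intro sum.neutral) auto
    ultimately show ?thesis
      unfolding card_inc_sum[OF fin2(1)] sum_E2 E0_eq[of "\<lambda>A. if v \<in> A then 1 else 0"] by auto
  next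
    case False
    have "card (inc h2 E2 v) = card (inc h E v)"
      unfolding card_inc_sum[OF fin2(1)] card_inc_sum[OF fin(2)] sum_E2 sum_E sum_S E0_eq[of "\<lambda>A. if v \<in> A then 1 else 0"]
      using False by (auto simp: ends P_def)
    then show ?thesis using deg3 v by (simp add: V2_def)
  qed
  have cut2: "card (cut h E (X \<union> (if p2 \<in> X then {p1} else {}) \<union> (if p3 \<in> X then {p4} else {}))) =
      card (cut h2 E2 X) + of_bool ((p2 \<in> X) \<noteq> (p3 \<in> X))" if X: "X \<subseteq> V2" for X
  proof -
    define Y where "Y = X \<union> (if p2 \<in> X then {p1} else {}) \<union> (if p3 \<in> X then {p4} else {})"
    have Y: "p1 \<in> Y \<longleftrightarrow> p2 \<in> X" "p2 \<in> Y \<longleftrightarrow> p2 \<in> X" "p3 \<in> Y \<longleftrightarrow> p3 \<in> X" "p4 \<in> Y \<longleftrightarrow> p3 \<in> X"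
      "q1 \<in> Y \<longleftrightarrow> q1 \<in> X" "q2 \<in> Y \<longleftrightarrow> q2 \<in> X" "q3 \<in> Y \<longleftrightarrow> q3 \<in> X" "q4 \<in> Y \<longleftrightarrow> q4 \<in> X"
      using X by (auto simp: Y_def V2_def)
    have "(\<Sum>e\<in>E0. if h e \<inter> X \<noteq> {} \<and> \<not> h e \<subseteq> X then 1 else 0 :: nat) =
        (\<Sum>e\<in>E0. if h e \<inter> Y \<noteq> {} \<and> \<not> h e \<subseteq> Y then 1 else 0)"
    proof (intro sum.cong refl)
      fix e assume "e \<in> E0"
      then have "p1 \<notin> h e" "p4 \<notin> h e" using E0_avoid[of e] by (auto simp: P_def)
      then have "h e \<inter> X = h e \<inter> Y" "h e \<subseteq> X \<longleftrightarrow> h e \<subseteq> Y" by (auto simp: Y_def split: if_splits)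
      then show "(if h e \<inter> X \<noteq> {} \<and> \<not> h e \<subseteq> X then 1 else 0 :: nat) = (if h e \<inter> Y \<noteq> {} \<and> \<not> h e \<subseteq> Y then 1 else 0)"
        by simp
    qed
    then have "card (cut h E Y) = card (cut h2 E2 X) + of_bool ((p2 \<in> X) \<noteq> (p3 \<in> X))"
      unfolding card_cut_sum[OF fin2(1)] card_cut_sum[OF fin(2)] sum_E2 sum_E sum_S
        E0_eq[of "\<lambda>A. if A \<inter> X \<noteq> {} \<and> \<not> A \<subseteq> X then 1 else 0"]
      using Y by (auto simp: ends)
    then show ?thesis by (simp add: Y_def)
  qed
  have "2 \<le> card (cut h2 E2 X)" if X: "X \<subseteq> V2" "X \<noteq> {}" "X \<noteq> V2" for X
  proof -
    define Y where "Y = X \<union> (if p2 \<in> X then {p1} else {}) \<union> (if p3 \<in> X then {p4} else {})"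
    have YX: "Y - {p1, p4} = X" using X by (auto simp: Y_def V2_def)
    have YV: "Y \<subseteq> V" using X p by (auto simp: Y_def V2_def split: if_splits)
    moreover have "Y \<noteq> {}" "Y \<noteq> V" using YX X by (auto simp: V2_def)
    ultimately have YV: "Y \<subseteq> V" "Y \<noteq> {}" "Y \<noteq> V" by blast+
    have c: "card (cut h E Y) = card (cut h2 E2 X) + of_bool ((p2 \<in> X) \<noteq> (p3 \<in> X))"
      using cut2[OF X(1)] by (simp add: Y_def)
    show ?thesis
    proof (cases "(p2 \<in> X) = (p3 \<in> X)")
      case True
      moreover have "2 \<le> card (cut h E Y)" using YV G by (simp add: cubic_2ec_def)
      ultimately show ?thesis using c by simp
    next
      case False
      have "p1 \<notin> X" "p4 \<notin> X" using X by (auto simp: V2_def)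
      have "3 \<le> card (cut h E Y)"
      proof (cases "p2 \<in> X")
        case True
        then show ?thesis using False YV \<open>p4 \<notin> X\<close> by (intro good) (auto simp: Y_def)
      next
        case F: False
        then have "3 \<le> card (cut h E (V - Y))" using False p \<open>p1 \<notin> X\<close> by (intro good) (auto simp: Y_def)
        then show ?thesis using cut_compl[OF mg YV(1)] by simp
      qed
      then show ?thesis using c False by simp
    qed
  qed
  moreover have "V2 \<noteq> {}" using p by (auto simp: V2_def)
  ultimately show ?thesis using mg2 deg by (simp add: cubic_2ec_def)
qed

text \<open>The two cuts would consist of \<open>e23\<close>, \<open>e41\<close> and of
  \<open>e12\<close>, \<open>e34\<close>. Then \<open>q2\<close> lies in both sets, and only
  \<open>g2\<close> leads out of their intersection without \<open>p2\<close>, so it would be a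
  bridge.\<close>

lemma no_crossing_two_cuts:
  assumes X: "X \<subseteq> V" "p1 \<in> X" "p2 \<in> X" "p3 \<notin> X" "p4 \<notin> X" "card (cut h E X) \<le> 2"
    and Y: "Y \<subseteq> V" "p2 \<in> Y" "p3 \<in> Y" "p4 \<notin> Y" "p1 \<notin> Y" "card (cut h E Y) \<le> 2"
  shows False
proof -
  have finc: "finite (cut h E Z)" for Z using fin by (simp add: cut_def)
  have "{e23, e41} \<subseteq> cut h E X" using X inE by (auto simp: cut_def ends)
  moreover have "card {e23, e41} = 2" by simp
  ultimately have cX: "cut h E X = {e23, e41}" using X(6) finc by (metis card_seteq)
  have "{e12, e34} \<subseteq> cut h E Y" using Y inE by (auto simp: cut_def ends)
  moreover have "card {e12, e34} = 2" by simp
  ultimately have cY: "cut h E Y = {e12, e34}" using Y(6) finc by (metis card_seteq)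
  define Z where "Z = X \<inter> Y - {p2}"
  have "q2 \<in> X \<inter> Y"
  proof (rule ccontr)
    assume "q2 \<notin> X \<inter> Y"
    then have "g2 \<in> cut h E X \<or> g2 \<in> cut h E Y" using X Y inE by (auto simp: cut_def ends)
    then show False using cX cY by auto
  qed
  then have "q2 \<in> Z" by (simp add: Z_def)
  have "cut h E Z \<subseteq> {g2}"
  proof
    fix e assume e: "e \<in> cut h E Z"
    then have eE: "e \<in> E" by (simp add: cut_def)
    obtain a b where ab: "h e = {a, b}" "a \<in> Z" "b \<notin> Z"
    proof -
      obtain a b where "h e = {a, b}" using mgraph_ends[OF mg eE] by metis
      then show thesis using that[of a b] that[of b a] e by (auto simp: cut_def)
    qed
    have aP: "a \<notin> P" using ab X Y by (auto simp: Z_def P_def)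
    then have "e \<notin> {e23, e41, e12, e34}" using ab by (auto simp: ends P_def doubleton_eq_iff)
    then have "e \<notin> cut h E X" "e \<notin> cut h E Y" using cX cY by auto
    then have "b \<in> X \<inter> Y" using ab eE by (auto simp: cut_def Z_def)
    then have "b = p2" using ab by (simp add: Z_def)
    then have "e \<in> inc h E p2" using ab eE by (simp add: inc_def)
    then show "e \<in> {g2}" using incs(2) \<open>e \<notin> {e23, e41, e12, e34}\<close> by auto
  qed
  then have "card (cut h E Z) \<le> 1" using card_mono[of "{g2}" "cut h E Z"] by simp
  moreover have "Z \<subseteq> V" "Z \<noteq> {}" "Z \<noteq> V" using X \<open>q2 \<in> Z\<close> p by (auto simp: Z_def)
  then have "2 \<le> card (cut h E Z)" using G by (simp add: cubic_2ec_def)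
  ultimately show False by simp
qed

text \<open>Parity at \<open>p2\<close> and \<open>p3\<close> leaves eight patterns for the five
  edges there. Each is completed on the square so that the growth in edges plus twice the growth in
  components is at most 3.\<close>

lemma even_sub_pinch_lift:
  assumes G2: "mgraph V2 E2 h2" and F': "even_sub V2 E2 h2 F'"
  shows "\<exists>F. even_sub V E h F \<and> card F + 2 * ncomp V h F \<le> card F' + 2 * ncomp V2 h2 F' + 3"
proof -
  define F0 where "F0 = F' \<inter> E0"
  define B where "B = F' \<inter> {g1, g2, g3, g4, e23}"
  have F0: "F0 \<subseteq> E0" by (simp add: F0_def)
  have F'E: "F' \<subseteq> E2" using F' by (simp add: even_sub_def)
  have F'_eq: "F' = F0 \<union> B" "F0 \<inter> B = {}" using F'E by (auto simp: F0_def B_def E2_def E0_def S_def)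
  have finF0: "finite F0" using F0 fin finite_subset by auto
  have cardF': "card F' = card F0 + card B"
  proof -
    have "finite B" by (simp add: B_def)
    then show ?thesis using card_Un_disjoint[OF finF0 _ F'_eq(2)] F'_eq(1) by simp
  qed
  have mgF': "mgraph V2 F' h2" by (rule mgraph_subset[OF G2 F'E])
  have corner2: "even (card (F' \<inter> {g1, g2, e23}))" "even (card (F' \<inter> {g3, g4, e23}))"
  proof -
    have "inc h2 F' p2 = F' \<inter> {g1, g2, e23}" "inc h2 F' p3 = F' \<inter> {g3, g4, e23}"
      using F'E E0_avoid h2_E0 by (fastforce simp: inc_def E2_def P_def)+
    moreover have "p2 \<in> V2" "p3 \<in> V2" using p by (auto simp: V2_def)
    ultimately show "even (card (F' \<inter> {g1, g2, e23}))" "even (card (F' \<inter> {g3, g4, e23}))"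
      using F' unfolding even_sub_def by metis+
  qed
  have outside: "even (card (inc h F0 v) + of_bool (g1 \<in> F' \<and> v = q1) + of_bool (g2 \<in> F' \<and> v = q2)
      + of_bool (g3 \<in> F' \<and> v = q3) + of_bool (g4 \<in> F' \<and> v = q4))" if v: "v \<in> V - P" for v
  proof -
    let ?B = "{e \<in> {g1, g2, g3, g4, e23}. e \<in> F' \<and> v \<in> h2 e}"
    have "inc h2 F' v = inc h F0 v \<union> ?B" using F'E h2_E0 by (auto simp: inc_def F0_def E2_def)
    moreover have "inc h F0 v \<inter> ?B = {}" using F'_eq by (auto simp: inc_def B_def)
    moreover have "card ?B = (\<Sum>e\<in>{g1, g2, g3, g4, e23}. if e \<in> F' \<and> v \<in> h2 e then 1 else 0)"
      by (simp only: sum.inter_filter[symmetric] finite.intros card_eq_sum)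
    ultimately have "card (inc h2 F' v) = card (inc h F0 v) + of_bool (g1 \<in> F' \<and> v = q1) + of_bool (g2 \<in> F' \<and> v = q2)
      + of_bool (g3 \<in> F' \<and> v = q3) + of_bool (g4 \<in> F' \<and> v = q4)"
      using finF0 v by (simp add: card_Un_disjoint inc_def P_def)
    moreover have "even (card (inc h2 F' v))" using F' v by (auto simp: even_sub_def V2_def P_def)
    ultimately show ?thesis by simp
  qed
  have even_lift: "even_sub V E h (F0 \<union> T)"
    if T: "T \<subseteq> S" "T \<inter> {g1, g2, g3, g4} = F' \<inter> {g1, g2, g3, g4}"
      and corner: "even (card (T \<inter> {e41, e12, g1}))" "even (card (T \<inter> {e12, e23, g2}))"
        "even (card (T \<inter> {e23, e34, g3}))" "even (card (T \<inter> {e34, e41, g4}))" for T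
    unfolding even_sub_def
  proof (intro conjI ballI)
    show "F0 \<union> T \<subseteq> E" using F0 T E_split by auto
    fix v assume v: "v \<in> V"
    show "even (card (inc h (F0 \<union> T) v))"
    proof (cases "v \<in> P")
      case True
      then have "v = p1 \<or> v = p2 \<or> v = p3 \<or> v = p4" by (simp add: P_def)
      then have "even (card (inc h T v))" using corner inc_corner[OF T(1)] by metis
      then show ?thesis by (simp add: card_inc_split[OF F0 T(1)] inc_E0_corner[OF F0 True])
    next
      case False
      have "g1 \<in> T \<longleftrightarrow> g1 \<in> F'" "g2 \<in> T \<longleftrightarrow> g2 \<in> F'" "g3 \<in> T \<longleftrightarrow> g3 \<in> F'" "g4 \<in> T \<longleftrightarrow> g4 \<in> F'"
        using T(2) by auto
      then show ?thesis using outside[of v] v False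
        by (simp add: card_inc_split[OF F0 T(1)] card_inc_outside[OF T(1) False] add.assoc)
    qed
  qed
  have comps: "ncomp V h (F0 \<union> T) \<le> ncomp W h2 F' + card Z"
    if W: "mgraph W F' h2" "V - P \<subseteq> W" and Z: "finite Z"
      and T: "g1 \<in> F' \<Longrightarrow> component h (F0 \<union> T) q1 = component h (F0 \<union> T) p2"
        "g2 \<in> F' \<Longrightarrow> component h (F0 \<union> T) p2 = component h (F0 \<union> T) q2"
        "g3 \<in> F' \<Longrightarrow> component h (F0 \<union> T) p3 = component h (F0 \<union> T) q3"
        "g4 \<in> F' \<Longrightarrow> component h (F0 \<union> T) q4 = component h (F0 \<union> T) p3"
        "e23 \<in> F' \<Longrightarrow> component h (F0 \<union> T) p2 = component h (F0 \<union> T) p3"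
      and cover: "\<And>v. v \<in> {p1, p2, p3, p4} \<Longrightarrow> component h (F0 \<union> T) v \<in> component h (F0 \<union> T) ` (W \<union> Z)"
    for T W Z
  proof (rule ncomp_le_map[OF W(1) Z, where \<rho> = "\<lambda>v. v"])
    fix e assume e: "e \<in> F'"
    then consider "e \<in> F0" | "e \<in> {g1, g2, g3, g4, e23}" using F'_eq(1) unfolding B_def by blast
    then show "\<exists>x y. h2 e = {x, y} \<and> component h (F0 \<union> T) x = component h (F0 \<union> T) y"
    proof cases
      case 1
      then have "e \<in> E" using F0 E_split by auto
      then obtain x y where "h e = {x, y}" using mgraph_ends[OF mg] by metis
      moreover have "h2 e = h e" using 1 F0 h2_E0 by auto
      ultimately show ?thesis using component_eq_edge[of e "F0 \<union> T" h x y] 1 by auto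
    next
      case 2
      then consider "e = g1" | "e = g2" | "e = g3" | "e = g4" | "e = e23" by blast
      then show ?thesis
      proof cases
        case 1 then show ?thesis using T(1) e by (intro exI[of _ q1] exI[of _ p2]) simp
      next
        case 2 then show ?thesis using T(2) e by (intro exI[of _ p2] exI[of _ q2]) simp
      next
        case 3 then show ?thesis using T(3) e by (intro exI[of _ p3] exI[of _ q3]) simp
      next
        case 4 then show ?thesis using T(4) e by (intro exI[of _ q4] exI[of _ p3]) simp
      next
        case 5 then show ?thesis using T(5) e by (intro exI[of _ p2] exI[of _ p3]) simp
      qed
    qed
  next
    fix v assume v: "v \<in> V"
    show "component h (F0 \<union> T) v \<in> component h (F0 \<union> T) ` ((\<lambda>v. v) ` W \<union> Z)"
      using cover[of v] v W(2) by (cases "v \<in> P") (auto simp: P_def)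
  qed
  have cardT: "card (F0 \<union> T) = card F0 + card T" if "T \<subseteq> S" for T
  proof -
    have "finite T" using that by (rule finite_subset) (simp add: S_def)
    moreover have "F0 \<inter> T = {}" using that F0 E_split by auto
    ultimately show ?thesis using finF0 by (simp add: card_Un_disjoint)
  qed
  have V2P: "V - P \<subseteq> V2" by (auto simp: V2_def P_def)
  have pV2: "p2 \<in> V2" "p3 \<in> V2" using p by (auto simp: V2_def)
  have main: ?thesis
    if T: "T \<subseteq> S" "T \<inter> {g1, g2, g3, g4} = F' \<inter> {g1, g2, g3, g4}"
      and corner: "even (card (T \<inter> {e41, e12, g1}))" "even (card (T \<inter> {e12, e23, g2}))"
        "even (card (T \<inter> {e23, e34, g3}))" "even (card (T \<inter> {e34, e41, g4}))"
      and Z: "finite Z" "card T + 2 * card Z \<le> card B + 3"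
      and conn: "g1 \<in> F' \<Longrightarrow> component h (F0 \<union> T) q1 = component h (F0 \<union> T) p2"
        "g2 \<in> F' \<Longrightarrow> component h (F0 \<union> T) p2 = component h (F0 \<union> T) q2"
        "g3 \<in> F' \<Longrightarrow> component h (F0 \<union> T) p3 = component h (F0 \<union> T) q3"
        "g4 \<in> F' \<Longrightarrow> component h (F0 \<union> T) q4 = component h (F0 \<union> T) p3"
        "e23 \<in> F' \<Longrightarrow> component h (F0 \<union> T) p2 = component h (F0 \<union> T) p3"
      and cover: "component h (F0 \<union> T) p1 \<in> component h (F0 \<union> T) ` ({p2, p3} \<union> Z)"
        "component h (F0 \<union> T) p4 \<in> component h (F0 \<union> T) ` ({p2, p3} \<union> Z)" for T Z
  proof (intro exI[of _ "F0 \<union> T"] conjI even_lift T corner)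
    have "ncomp V h (F0 \<union> T) \<le> ncomp V2 h2 F' + card Z"
      by (rule comps[OF mgF' V2P Z(1) conn]) (use cover pV2 in auto)
    then show "card (F0 \<union> T) + 2 * ncomp V h (F0 \<union> T) \<le> card F' + 2 * ncomp V2 h2 F' + 3"
      using Z(2) cardT[OF T(1)] cardF' by simp
  qed
  have par1: "e23 \<in> F' \<Longrightarrow> (g1 \<in> F' \<longleftrightarrow> g2 \<notin> F')" "e23 \<notin> F' \<Longrightarrow> (g1 \<in> F' \<longleftrightarrow> g2 \<in> F')"
    using corner2(1) by (auto simp: Int_insert_right split: if_splits)
  have par2: "e23 \<in> F' \<Longrightarrow> (g3 \<in> F' \<longleftrightarrow> g4 \<notin> F')" "e23 \<notin> F' \<Longrightarrow> (g3 \<in> F' \<longleftrightarrow> g4 \<in> F')"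
    using corner2(2) by (auto simp: Int_insert_right split: if_splits)
  consider
      (a) "e23 \<in> F'" "g1 \<in> F'" "g2 \<notin> F'" "g3 \<notin> F'" "g4 \<in> F'"
    | (b) "e23 \<in> F'" "g1 \<notin> F'" "g2 \<in> F'" "g3 \<in> F'" "g4 \<notin> F'"
    | (c) "e23 \<in> F'" "g1 \<in> F'" "g2 \<notin> F'" "g3 \<in> F'" "g4 \<notin> F'"
    | (d) "e23 \<in> F'" "g1 \<notin> F'" "g2 \<in> F'" "g3 \<notin> F'" "g4 \<in> F'"
    | (e) "e23 \<notin> F'" "g1 \<in> F'" "g2 \<in> F'" "g3 \<in> F'" "g4 \<in> F'"
    | (f) "e23 \<notin> F'" "g1 \<in> F'" "g2 \<in> F'" "g3 \<notin> F'" "g4 \<notin> F'"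
    | (g) "e23 \<notin> F'" "g1 \<notin> F'" "g2 \<notin> F'" "g3 \<in> F'" "g4 \<in> F'"
    | (i) "e23 \<notin> F'" "g1 \<notin> F'" "g2 \<notin> F'" "g3 \<notin> F'" "g4 \<notin> F'"
    using par1 par2 by (cases "e23 \<in> F'"; cases "g1 \<in> F'"; cases "g3 \<in> F'"; simp)
  then show ?thesis
  proof cases
    case a
    let ?T = "{g1, e12, e23, e34, g4}" let ?c = "component h (F0 \<union> ?T)"
    have "?c p1 = ?c q1" "?c p1 = ?c p2" "?c p2 = ?c p3" "?c p3 = ?c p4" "?c p4 = ?c q4"
      by (rule comp_edge; simp)+
    then show ?thesis using a by (intro main[of ?T "{}"]) (auto simp: S_def B_def Int_insert_right)
  next
    case b
    let ?T = "{g2, e12, e41, e34, g3}" let ?c = "component h (F0 \<union> ?T)"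
    have "?c p2 = ?c q2" "?c p1 = ?c p2" "?c p4 = ?c p1" "?c p3 = ?c p4" "?c p3 = ?c q3"
      by (rule comp_edge; simp)+
    then show ?thesis using b by (intro main[of ?T "{}"]) (auto simp: S_def B_def Int_insert_right)
  next
    \<comment> \<open>A path from \<open>p1\<close> to \<open>p3\<close> along the square misses a
      corner. One additional edge and the uncovered \<open>p4\<close> use up the allowance of
      3.\<close>
    case c
    let ?T = "{g1, e12, e23, g3}" let ?c = "component h (F0 \<union> ?T)"
    have "?c p1 = ?c q1" "?c p1 = ?c p2" "?c p2 = ?c p3" "?c p3 = ?c q3"
      by (rule comp_edge; simp)+
    then show ?thesis using c by (intro main[of ?T "{p4}"]) (auto simp: S_def B_def Int_insert_right)
  next
    case d
    let ?T = "{g2, e23, e34, g4}" let ?c = "component h (F0 \<union> ?T)"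
    have "?c p2 = ?c q2" "?c p2 = ?c p3" "?c p3 = ?c p4" "?c p4 = ?c q4"
      by (rule comp_edge; simp)+
    then show ?thesis using d by (intro main[of ?T "{p1}"]) (auto simp: S_def B_def Int_insert_right)
  next
    case e
    let ?T = "{g1, e12, g2, g3, e34, g4}" let ?c = "component h (F0 \<union> ?T)"
    have "?c p1 = ?c q1" "?c p2 = ?c q2" "?c p1 = ?c p2" "?c p3 = ?c q3" "?c p4 = ?c q4" "?c p3 = ?c p4"
      by (rule comp_edge; simp)+
    then show ?thesis using e by (intro main[of ?T "{}"]) (auto simp: S_def B_def Int_insert_right)
  next
    case f
    let ?T = "{g1, e12, g2}" let ?c = "component h (F0 \<union> ?T)"
    have "?c p1 = ?c q1" "?c p2 = ?c q2" "?c p1 = ?c p2"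
      by (rule comp_edge; simp)+
    then show ?thesis using f by (intro main[of ?T "{p4}"]) (auto simp: S_def B_def Int_insert_right)
  next
    case g
    let ?T = "{g3, e34, g4}" let ?c = "component h (F0 \<union> ?T)"
    have "?c p3 = ?c q3" "?c p4 = ?c q4" "?c p3 = ?c p4"
      by (rule comp_edge; simp)+
    then show ?thesis using g by (intro main[of ?T "{p1}"]) (auto simp: S_def B_def Int_insert_right)
  next
    \<comment> \<open>Here \<open>p2\<close> and \<open>p3\<close> are isolated in \<open>F'\<close>
      and the square joins them; the component saved offsets two of the four new edges. To count it,
      \<open>p3\<close> is dropped from the smaller vertex set.\<close>
    case i
    let ?T = "{e12, e23, e34, e41}" let ?c = "component h (F0 \<union> ?T)"
    have TS: "?T \<subseteq> S" by (auto simp: S_def)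
    have c: "?c p1 = ?c p2" "?c p2 = ?c p3" "?c p3 = ?c p4" by (rule comp_edge; simp)+
    have "B = {}" using i by (auto simp: B_def)
    then have avoid: "p3 \<notin> h2 e" if "e \<in> F'" for e
    proof -
      have "e \<in> E0" using that F'_eq \<open>B = {}\<close> F0 by auto
      then show ?thesis using E0_avoid[of e] h2_E0[of e] by (auto simp: P_def)
    qed
    have W: "V2 = insert p3 (V2 - {p3})" using pV2 by auto
    have "ncomp V2 h2 F' = ncomp (V2 - {p3}) h2 F' + 1"
      using fin2 avoid by (subst W, intro ncomp_insert_isolated) auto
    moreover have "ncomp V h (F0 \<union> ?T) \<le> ncomp (V2 - {p3}) h2 F' + card ({} :: 'v set)"
    proof (rule comps)
      show "mgraph (V2 - {p3}) F' h2" using mgF' avoid by (auto simp: mgraph_def)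
      show "V - P \<subseteq> V2 - {p3}" using V2P by (auto simp: P_def)
      show "?c v \<in> ?c ` (V2 - {p3} \<union> {})" if "v \<in> {p1, p2, p3, p4}" for v
      proof -
        have "?c v = ?c p2" using that c by auto
        then show ?thesis using pV2 by (metis corner_neq(4) DiffI Un_iff imageI singletonD)
      qed
    qed (use i in auto)
    moreover have "even_sub V E h (F0 \<union> ?T)"
      using i by (intro even_lift TS) (auto simp: Int_insert_right)
    ultimately show ?thesis using cardT[OF TS] cardF' \<open>B = {}\<close> by (intro exI[of _ "F0 \<union> ?T"]) simp
  qed
qed

end

section \<open>Contracting a triangle\<close>

locale triangle =
  fixes V :: "'v set" and E :: "'e set" and h :: "'e \<Rightarrow> 'v set" and a b c :: 'v and t1 t2 t3 :: 'e
  assumes G: "cubic_2ec V E h"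
    and abc: "a \<noteq> b" "b \<noteq> c" "a \<noteq> c"
    and ends: "h t1 = {b, c}" "h t2 = {a, c}" "h t3 = {a, b}"
    and inE: "{t1, t2, t3} \<subseteq> E"
    and large: "V \<noteq> {a, b, c}"
begin

definition T where "T = {a, b, c}"
definition V3 where "V3 = insert a (V - T)"
definition E3 where "E3 = {e \<in> E. \<not> h e \<subseteq> T}"
definition h3 where "h3 = contract T a h"

lemma abc_neq [simp]: "a \<noteq> b" "b \<noteq> c" "a \<noteq> c" "b \<noteq> a" "c \<noteq> b" "c \<noteq> a"
  using abc by auto

lemma mg: "mgraph V E h" and deg3: "v \<in> V \<Longrightarrow> card (inc h E v) = 3"
  using G by (auto simp: cubic_2ec_def)

lemma fin: "finite V" "finite E"
  using mg by (auto simp: mgraph_def)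

lemma TV: "T \<subseteq> V" "T \<noteq> V" "a \<in> T" "card T = 3"
  using mg inE ends large by (auto simp: T_def mgraph_def)

lemma t_neq [simp]: "t1 \<noteq> t2" "t2 \<noteq> t3" "t1 \<noteq> t3" "t2 \<noteq> t1" "t3 \<noteq> t2" "t3 \<noteq> t1"
proof -
  have "h t1 \<noteq> h t2" "h t2 \<noteq> h t3" "h t1 \<noteq> h t3" by (auto simp: ends doubleton_eq_iff)
  then show "t1 \<noteq> t2" "t2 \<noteq> t3" "t1 \<noteq> t3" "t2 \<noteq> t1" "t3 \<noteq> t2" "t3 \<noteq> t1" by auto
qed

text \<open>The nine edge ends at the corners include at least two of edges leaving the triangle, so
  at most three edges lie inside and none is parallel to a side.\<close>

lemma inside: "{e \<in> E. h e \<subseteq> T} = {t1, t2, t3}"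
proof -
  let ?I = "{e \<in> E. h e \<subseteq> T}"
  have "3 * card T = card (cut h E T) + 2 * card ?I"
    using cubic_handshake[OF mg _ TV(1)] deg3 by blast
  moreover have "2 \<le> card (cut h E T)" using G TV by (auto simp: cubic_2ec_def)
  ultimately have "card ?I \<le> card {t1, t2, t3}" using TV(4) by simp
  moreover have "{t1, t2, t3} \<subseteq> ?I" using inE by (auto simp: ends T_def)
  moreover have "finite ?I" using fin by simp
  ultimately show ?thesis using card_seteq[of ?I "{t1, t2, t3}"] by blast
qed

lemma third_edge:
  assumes "v \<in> T" "s1 \<noteq> s2" "{s1, s2} \<subseteq> {t1, t2, t3}" "\<And>s. s \<in> {t1, t2, t3} \<Longrightarrow> v \<in> h s \<longleftrightarrow> s \<in> {s1, s2}"
  obtains g w where "inc h E v = {s1, s2, g}" "g \<in> E" "g \<noteq> s1" "g \<noteq> s2" "h g = {v, w}" "w \<in> V" "w \<notin> T"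
proof -
  have v: "v \<in> V" using assms(1) TV by auto
  have sub: "{s1, s2} \<subseteq> inc h E v" using assms(3,4) inE by (auto simp: inc_def)
  have "card (inc h E v - {s1, s2}) = 1" using deg3[OF v] sub assms(2) by (simp add: card_Diff_subset)
  then obtain g where g: "inc h E v - {s1, s2} = {g}" by (meson card_1_singletonE)
  then have gE: "g \<in> E" "v \<in> h g" "g \<notin> {s1, s2}" by (auto simp: inc_def)
  obtain w where w: "h g = {v, w}" "w \<in> V" using mgraph_other_end[OF mg gE(1,2)] by metis
  have "w \<notin> T"
  proof
    assume "w \<in> T"
    then have "g \<in> {e \<in> E. h e \<subseteq> T}" using w gE assms(1) by auto
    then have "g \<in> {t1, t2, t3}" using inside by simp
    then show False using assms(4)[of g] gE by blast
  qed
  moreover have "inc h E v = {s1, s2, g}" using g sub by blast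
  ultimately show thesis using that[of g w] gE w by auto
qed

lemma third_edges:
  obtains ga gb gc a' b' c' where
    "inc h E a = {t2, t3, ga}" "inc h E b = {t1, t3, gb}" "inc h E c = {t1, t2, gc}"
    "h ga = {a, a'}" "h gb = {b, b'}" "h gc = {c, c'}" "a' \<notin> T" "b' \<notin> T" "c' \<notin> T"
    "{ga, gb, gc} \<subseteq> E" "a' \<in> V" "b' \<in> V" "c' \<in> V"
proof -
  obtain ga a' where 1: "inc h E a = {t2, t3, ga}" "ga \<in> E" "h ga = {a, a'}" "a' \<in> V" "a' \<notin> T"
    by (rule third_edge[of a t2 t3]) (auto simp: ends T_def)
  obtain gb b' where 2: "inc h E b = {t1, t3, gb}" "gb \<in> E" "h gb = {b, b'}" "b' \<in> V" "b' \<notin> T"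
    by (rule third_edge[of b t1 t3]) (auto simp: ends T_def)
  obtain gc c' where 3: "inc h E c = {t1, t2, gc}" "gc \<in> E" "h gc = {c, c'}" "c' \<in> V" "c' \<notin> T"
    by (rule third_edge[of c t1 t2]) (auto simp: ends T_def)
  show thesis using that 1 2 3 by auto
qed

lemma card_V3: "card V3 + 2 = card V"
  using contract_card[OF fin(1) TV(1,3)] TV(4) by (simp add: V3_def)

lemma mg3: "mgraph V3 E3 h3"
  unfolding V3_def E3_def h3_def by (rule contract_mgraph[OF mg TV(3,1)])

lemma cut3:
  assumes "X \<subseteq> V3"
  shows "cut h3 E3 X = cut h E (if a \<in> X then X \<union> T else X)"
proof (cases "a \<in> X")
  case True
  then have "X \<inter> T = {a}" using assms TV by (auto simp: V3_def)
  then show ?thesis using contract_cut_through[OF TV(3) True] True by (simp add: E3_def h3_def)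
next
  case False
  then have "X \<inter> T = {}" using assms by (auto simp: V3_def)
  then show ?thesis using contract_cut_avoid[OF TV(3)] False by (simp add: E3_def h3_def)
qed

lemma contracted_cubic_2ec: "cubic_2ec V3 E3 h3"
proof -
  have "card (inc h3 E3 v) = 3" if "v \<in> V3" for v
  proof (cases "v = a")
    case True
    have "inc h3 E3 a = cut h E T"
      unfolding h3_def E3_def by (rule contract_inc_new[OF TV(3)])
    moreover have "3 * card T = card (cut h E T) + 2 * card {e \<in> E. h e \<subseteq> T}"
      using cubic_handshake[OF mg _ TV(1)] deg3 by blast
    ultimately show ?thesis using True TV(4) by (simp add: inside)
  next
    case False
    then have "v \<notin> T" using that by (simp add: V3_def)
    then have "inc h3 E3 v = inc h E v" unfolding h3_def E3_def by (rule contract_inc_old[OF TV(3)])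
    then show ?thesis using deg3 that \<open>v \<notin> T\<close> TV by (auto simp: V3_def)
  qed
  moreover have "2 \<le> card (cut h3 E3 X)" if X: "X \<subseteq> V3" "X \<noteq> {}" "X \<noteq> V3" for X
  proof -
    define Y where "Y = (if a \<in> X then X \<union> T else X)"
    have "Y \<subseteq> V" "Y \<noteq> {}" using X TV by (auto simp: Y_def V3_def)
    moreover have "Y \<noteq> V"
    proof (cases "a \<in> X")
      case True
      then obtain z where "z \<in> V3" "z \<notin> X" using X by auto
      then have "z \<in> V" "z \<notin> Y" using True by (auto simp: V3_def Y_def)
      then show ?thesis by auto
    next
      case False
      then show ?thesis using TV by (auto simp: Y_def)
    qed
    ultimately have "2 \<le> card (cut h E Y)" using G by (simp add: cubic_2ec_def)
    then show ?thesis by (simp add: cut3[OF X(1)] Y_def)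
  qed
  ultimately show ?thesis using mg3 by (simp add: cubic_2ec_def V3_def)
qed

text \<open>An even set contains 0 or 2 of the three edges at the contracted vertex. Two of them are
  linked through all three corners by two sides; for none, the triangle becomes a cycle in place of
  the isolated vertex. So no component is added. The clause \<open>F \<inter> E3 = F'\<close> allows
  a penalty imposed on an edge of the contracted graph to be read off from the lift.\<close>

lemma even_sub_triangle_lift:
  assumes F': "even_sub V3 E3 h3 F'"
  shows "\<exists>F. even_sub V E h F \<and> F \<inter> E3 = F' \<and> card F + 2 * ncomp V h F \<le> card F' + 2 * ncomp V3 h3 F' + 3 \<and>
    (two_factor V3 E3 h3 F' \<longrightarrow> two_factor V E h F \<and> ncomp V h F \<le> ncomp V3 h3 F')"
proof -
  obtain ga gb gc a' b' c' where incs: "inc h E a = {t2, t3, ga}" "inc h E b = {t1, t3, gb}" "inc h E c = {t1, t2, gc}"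
    and g: "h ga = {a, a'}" "h gb = {b, b'}" "h gc = {c, c'}" "a' \<notin> T" "b' \<notin> T" "c' \<notin> T" "{ga, gb, gc} \<subseteq> E"
    using third_edges by metis
  have F'E: "F' \<subseteq> E3" using F' by (simp add: even_sub_def)
  have g_neq [simp]: "ga \<noteq> gb" "gb \<noteq> gc" "ga \<noteq> gc" "gb \<noteq> ga" "gc \<noteq> gb" "gc \<noteq> ga"
  proof -
    have "h ga \<noteq> h gb" "h gb \<noteq> h gc" "h ga \<noteq> h gc" using g by (auto simp: T_def doubleton_eq_iff)
    then show "ga \<noteq> gb" "gb \<noteq> gc" "ga \<noteq> gc" "gb \<noteq> ga" "gc \<noteq> gb" "gc \<noteq> ga" by auto
  qed
  have t_out: "t \<notin> E3" if "t \<in> {t1, t2, t3}" for t using that inside by (auto simp: E3_def)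
  have g_t: "g \<noteq> t1" "g \<noteq> t2" "g \<noteq> t3" if "g \<in> {ga, gb, gc}" for g
    using that g ends by (auto simp: T_def doubleton_eq_iff)
  have inc_a: "inc h3 F' a = F' \<inter> {ga, gb, gc}"
  proof -
    have "inc h3 E3 a = cut h E T" unfolding h3_def E3_def by (rule contract_inc_new[OF TV(3)])
    also have "cut h E T = {ga, gb, gc}"
    proof
      show "{ga, gb, gc} \<subseteq> cut h E T" using g by (auto simp: cut_def T_def)
      show "cut h E T \<subseteq> {ga, gb, gc}"
      proof
        fix e assume e: "e \<in> cut h E T"
        then have "e \<notin> {t1, t2, t3}" using ends by (auto simp: cut_def T_def)
        moreover have "e \<in> inc h E a \<union> inc h E b \<union> inc h E c" using e by (auto simp: cut_def T_def inc_def)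
        ultimately show "e \<in> {ga, gb, gc}" using incs by auto
      qed
    qed
    finally show ?thesis using F'E by (auto simp: inc_def)
  qed
  have outside: "inc h3 F' v = inc h F' v" if "v \<notin> T" for v
    using that TV(3) by (auto simp: inc_def h3_def contract_def split: if_splits)
  have aV3: "a \<in> V3" by (simp add: V3_def)
  then have "even (card (F' \<inter> {ga, gb, gc}))" using F' inc_a unfolding even_sub_def by metis
  then have par: "ga \<in> F' \<Longrightarrow> gb \<in> F' \<longleftrightarrow> gc \<notin> F'" "ga \<notin> F' \<Longrightarrow> gb \<in> F' \<longleftrightarrow> gc \<in> F'"
    by (auto simp: Int_insert_right split: if_splits)
  have main: ?thesis
    if S: "S \<subseteq> {t1, t2, t3}" "card S \<le> 3"
      and deg: "card ((F' \<union> S) \<inter> {t2, t3, ga}) = 2" "card ((F' \<union> S) \<inter> {t1, t3, gb}) = 2" "card ((F' \<union> S) \<inter> {t1, t2, gc}) = 2"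
      and conn: "component h (F' \<union> S) b = component h (F' \<union> S) a" "component h (F' \<union> S) c = component h (F' \<union> S) a" for S
  proof (intro exI[of _ "F' \<union> S"] conjI impI)
    have FE: "F' \<union> S \<subseteq> E" using F'E S inE by (auto simp: E3_def)
    have degT: "card (inc h (F' \<union> S) v) = 2" if "v \<in> T" for v
    proof -
      have "inc h (F' \<union> S) v = (F' \<union> S) \<inter> inc h E v" using FE by (auto simp: inc_def)
      then show ?thesis using that incs deg by (auto simp: T_def)
    qed
    have incO: "inc h (F' \<union> S) v = inc h3 F' v" if "v \<notin> T" for v
    proof -
      have "v \<notin> h t" if "t \<in> S" for t using that S ends \<open>v \<notin> T\<close> by (auto simp: T_def)
      then show ?thesis using outside[OF that] by (auto simp: inc_def)
    qed
    show "even_sub V E h (F' \<union> S)"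
      unfolding even_sub_def
    proof (intro conjI ballI FE)
      fix v assume "v \<in> V"
      then show "even (card (inc h (F' \<union> S) v))"
        using degT[of v] incO[of v] F' by (cases "v \<in> T") (auto simp: even_sub_def V3_def)
    qed
    show "(F' \<union> S) \<inter> E3 = F'" using F'E t_out S by auto
    have nc: "ncomp V h (F' \<union> S) \<le> ncomp V3 h3 F'"
    proof -
      have "ncomp V h (F' \<union> S) \<le> ncomp V3 h3 F' + card ({} :: 'v set)"
      proof (rule ncomp_le_map[where \<rho> = "\<lambda>v. v"])
        show "mgraph V3 F' h3" by (rule mgraph_subset[OF mg3 F'E])
        fix e assume e: "e \<in> F'"
        then have "e \<in> E" using F'E by (auto simp: E3_def)
        then obtain x y where xy: "h e = {x, y}" using mgraph_ends[OF mg] by metis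
        have "component h (F' \<union> S) x = component h (F' \<union> S) y"
          using component_eq_edge[of e "F' \<union> S" h x y] e xy by auto
        moreover have "component h (F' \<union> S) (if z \<in> T then a else z) = component h (F' \<union> S) z" for z
          using conn by (auto simp: T_def)
        moreover have "h3 e = {if x \<in> T then a else x, if y \<in> T then a else y}"
          by (simp add: h3_def contract_def xy)
        ultimately show "\<exists>x y. h3 e = {x, y} \<and> component h (F' \<union> S) x = component h (F' \<union> S) y" by metis
      next
        fix v assume "v \<in> V"
        show "component h (F' \<union> S) v \<in> component h (F' \<union> S) ` ((\<lambda>v. v) ` V3 \<union> {})"
        proof (cases "v \<in> T")
          case True
          then have "component h (F' \<union> S) v = component h (F' \<union> S) a" using conn by (auto simp: T_def)
          then show ?thesis using aV3 by (metis Un_iff imageI image_ident)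
        next
          case False
          then show ?thesis using \<open>v \<in> V\<close> by (auto simp: V3_def)
        qed
      qed simp
      then show ?thesis by simp
    qed
    have "card (F' \<union> S) \<le> card F' + 3" using S(2) card_Un_le[of F' S] by linarith
    then show "card (F' \<union> S) + 2 * ncomp V h (F' \<union> S) \<le> card F' + 2 * ncomp V3 h3 F' + 3" using nc by linarith
    assume tf: "two_factor V3 E3 h3 F'"
    show "ncomp V h (F' \<union> S) \<le> ncomp V3 h3 F'" by (rule nc)
    show "two_factor V E h (F' \<union> S)"
      unfolding two_factor_def
    proof (intro conjI ballI FE)
      fix v assume "v \<in> V"
      then show "card (inc h (F' \<union> S) v) = 2"
        using degT[of v] incO[of v] tf by (cases "v \<in> T") (auto simp: two_factor_def V3_def)
    qed
  qed
  have ce: "t1 \<in> F \<Longrightarrow> component h F b = component h F c" "t2 \<in> F \<Longrightarrow> component h F a = component h F c"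
    "t3 \<in> F \<Longrightarrow> component h F a = component h F b" for F
    using component_eq_edge[of _ F h] ends by metis+
  have tF' [simp]: "t1 \<notin> F'" "t2 \<notin> F'" "t3 \<notin> F'" using t_out F'E by auto
  have gt [simp]: "ga \<noteq> t1" "ga \<noteq> t2" "ga \<noteq> t3" "gb \<noteq> t1" "gb \<noteq> t2" "gb \<noteq> t3" "gc \<noteq> t1" "gc \<noteq> t2" "gc \<noteq> t3"
    using g_t by auto
  note gt[symmetric, simp]
  consider "ga \<in> F'" "gb \<in> F'" "gc \<notin> F'" | "ga \<in> F'" "gb \<notin> F'" "gc \<in> F'"
    | "ga \<notin> F'" "gb \<in> F'" "gc \<in> F'" | "ga \<notin> F'" "gb \<notin> F'" "gc \<notin> F'"
    using par by (cases "ga \<in> F'"; cases "gb \<in> F'"; simp)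
  then show ?thesis
  proof cases
    case 1
    then show ?thesis using ce[of "F' \<union> {t1, t2}"] by (intro main[of "{t1, t2}"]) (auto simp: Int_insert_right)
  next
    case 2
    then show ?thesis using ce[of "F' \<union> {t1, t3}"] by (intro main[of "{t1, t3}"]) (auto simp: Int_insert_right)
  next
    case 3
    then show ?thesis using ce[of "F' \<union> {t2, t3}"] by (intro main[of "{t2, t3}"]) (auto simp: Int_insert_right)
  next
    case 4
    then show ?thesis using ce[of "F' \<union> {t1, t2, t3}"] by (intro main[of "{t1, t2, t3}"]) (auto simp: Int_insert_right)
  qed
qed

end

section \<open>Replacing a pentagon\<close>

locale pentagon =
  fixes V :: "'v set" and E :: "'e set" and h :: "'e \<Rightarrow> 'v set"
    and p1 p2 p3 p4 p5 q1 q2 q3 q4 q5 :: 'v and e12 e23 e34 e45 e51 g1 g2 g3 g4 g5 :: 'e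
  assumes G: "cubic_2ec V E h"
    and p: "distinct [p1, p2, p3, p4, p5]" "{p1, p2, p3, p4, p5} \<subseteq> V"
    and ends: "h e12 = {p1, p2}" "h e23 = {p2, p3}" "h e34 = {p3, p4}" "h e45 = {p4, p5}" "h e51 = {p5, p1}"
      "h g1 = {p1, q1}" "h g2 = {p2, q2}" "h g3 = {p3, q3}" "h g4 = {p4, q4}" "h g5 = {p5, q5}"
    and inE: "{e12, e23, e34, e45, e51, g1, g2, g3, g4, g5} \<subseteq> E"
    and q: "{q1, q2, q3, q4, q5} \<inter> {p1, p2, p3, p4, p5} = {}" "distinct [q1, q2, q3, q4, q5]"
begin

lemma rotate: "pentagon V E h p2 p3 p4 p5 p1 q2 q3 q4 q5 q1 e23 e34 e45 e51 e12 g2 g3 g4 g5 g1"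
  using G p ends inE q by unfold_locales auto

definition P where "P = {p1, p2, p3, p4, p5}"
definition S where "S = {e12, e23, e34, e45, e51, g1, g2, g3, g4, g5}"
definition E0 where "E0 = E - S"

lemma mg: "mgraph V E h" and deg3: "v \<in> V \<Longrightarrow> card (inc h E v) = 3"
  using G by (auto simp: cubic_2ec_def)

lemma fin: "finite V" "finite E" "finite E0"
  using mg by (auto simp: mgraph_def E0_def)

lemma edges_distinct: "distinct [e12, e23, e34, e45, e51, g1, g2, g3, g4, g5]"
proof -
  have "distinct (map h [e12, e23, e34, e45, e51, g1, g2, g3, g4, g5])"
    using p q by (auto simp: ends doubleton_eq_iff)
  then show ?thesis by (simp only: distinct_map)
qed

lemma edge_neq [simp]:
  "e12 \<noteq> e23" "e12 \<noteq> e34" "e12 \<noteq> e45" "e12 \<noteq> e51" "e23 \<noteq> e34" "e23 \<noteq> e45" "e23 \<noteq> e51" "e34 \<noteq> e45" "e34 \<noteq> e51" "e45 \<noteq> e51"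
  "e12 \<noteq> g1" "e12 \<noteq> g2" "e12 \<noteq> g3" "e12 \<noteq> g4" "e12 \<noteq> g5" "e23 \<noteq> g1" "e23 \<noteq> g2" "e23 \<noteq> g3" "e23 \<noteq> g4" "e23 \<noteq> g5"
  "e34 \<noteq> g1" "e34 \<noteq> g2" "e34 \<noteq> g3" "e34 \<noteq> g4" "e34 \<noteq> g5" "e45 \<noteq> g1" "e45 \<noteq> g2" "e45 \<noteq> g3" "e45 \<noteq> g4" "e45 \<noteq> g5"
  "e51 \<noteq> g1" "e51 \<noteq> g2" "e51 \<noteq> g3" "e51 \<noteq> g4" "e51 \<noteq> g5"
  "g1 \<noteq> g2" "g1 \<noteq> g3" "g1 \<noteq> g4" "g1 \<noteq> g5" "g2 \<noteq> g3" "g2 \<noteq> g4" "g2 \<noteq> g5" "g3 \<noteq> g4" "g3 \<noteq> g5" "g4 \<noteq> g5"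
  using edges_distinct by auto

lemmas edge_neq_sym [simp] = edge_neq[symmetric]

lemma vertex_neq [simp]:
  "p1 \<noteq> p2" "p1 \<noteq> p3" "p1 \<noteq> p4" "p1 \<noteq> p5" "p2 \<noteq> p3" "p2 \<noteq> p4" "p2 \<noteq> p5" "p3 \<noteq> p4" "p3 \<noteq> p5" "p4 \<noteq> p5"
  "q1 \<noteq> q2" "q1 \<noteq> q3" "q1 \<noteq> q4" "q1 \<noteq> q5" "q2 \<noteq> q3" "q2 \<noteq> q4" "q2 \<noteq> q5" "q3 \<noteq> q4" "q3 \<noteq> q5" "q4 \<noteq> q5"
  "q1 \<noteq> p1" "q1 \<noteq> p2" "q1 \<noteq> p3" "q1 \<noteq> p4" "q1 \<noteq> p5" "q2 \<noteq> p1" "q2 \<noteq> p2" "q2 \<noteq> p3" "q2 \<noteq> p4" "q2 \<noteq> p5"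
  "q3 \<noteq> p1" "q3 \<noteq> p2" "q3 \<noteq> p3" "q3 \<noteq> p4" "q3 \<noteq> p5" "q4 \<noteq> p1" "q4 \<noteq> p2" "q4 \<noteq> p3" "q4 \<noteq> p4" "q4 \<noteq> p5"
  "q5 \<noteq> p1" "q5 \<noteq> p2" "q5 \<noteq> p3" "q5 \<noteq> p4" "q5 \<noteq> p5"
  using p q by auto

lemmas vertex_neq_sym [simp] = vertex_neq[symmetric]

lemma p_in: "p1 \<in> V" "p2 \<in> V" "p3 \<in> V" "p4 \<in> V" "p5 \<in> V"
  using p by auto

lemma q_in: "q1 \<in> V" "q2 \<in> V" "q3 \<in> V" "q4 \<in> V" "q5 \<in> V"
  using mg inE ends by (auto simp: mgraph_def)

lemma q_notin [simp]: "q1 \<notin> P" "q2 \<notin> P" "q3 \<notin> P" "q4 \<notin> P" "q5 \<notin> P"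
  using q by (auto simp: P_def)

lemma inc_eq: "v \<in> V \<Longrightarrow> B \<subseteq> E \<Longrightarrow> (\<And>e. e \<in> B \<Longrightarrow> v \<in> h e) \<Longrightarrow> card B = 3 \<Longrightarrow> inc h E v = B"
  using deg3[of v] fin by (intro card_subset_eq[symmetric]) (auto simp: inc_def)

lemma incs: "inc h E p1 = {e51, e12, g1}" "inc h E p2 = {e12, e23, g2}"
  "inc h E p3 = {e23, e34, g3}" "inc h E p4 = {e34, e45, g4}" "inc h E p5 = {e45, e51, g5}"
  by (rule inc_eq; use p_in inE in \<open>auto simp: ends\<close>)+

lemma E0_avoid: "e \<in> E0 \<Longrightarrow> h e \<inter> P = {}"
  using incs unfolding E0_def S_def P_def inc_def by blast

lemma E_split: "E = E0 \<union> S" "E0 \<inter> S = {}"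
  using inE by (auto simp: E0_def S_def)

lemma sum_S: "(\<Sum>e\<in>S. f e) = f e12 + f e23 + f e34 + f e45 + f e51 + f g1 + f g2 + f g3 + f g4 + (f g5 :: nat)"
  by (simp add: S_def add.assoc)

lemma sum_E: "(\<Sum>e\<in>E. f e) = (\<Sum>e\<in>E0. f e) + (\<Sum>e\<in>S. (f e :: nat))"
  using fin(3) E_split(2) by (subst E_split(1)) (rule sum.union_disjoint, auto simp: S_def)

lemma card_cut_avoiding:
  assumes "X \<inter> P = {}"
  shows "card (cut h E X) = card (cut h E0 X) + of_bool (q1 \<in> X) + of_bool (q2 \<in> X) + of_bool (q3 \<in> X)
    + of_bool (q4 \<in> X) + of_bool (q5 \<in> X)"
  unfolding card_cut_sum[OF fin(2)] card_cut_sum[OF fin(3)] sum_E sum_S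
  using assms by (simp add: ends P_def)

definition bad where
  "bad x y X \<longleftrightarrow> X \<subseteq> V - P \<and> x \<in> X \<and> y \<in> X \<and> card (cut h E X) \<le> 3"

text \<open>A maximal bad set contains exactly one vertex of some consecutive pair, and crosses any set
  that is bad for this pair.\<close>

lemma some_pair_not_bad:
  assumes "bad q1 q2 X1" "bad q2 q3 X2" "bad q3 q4 X3" "bad q4 q5 X4" "bad q5 q1 X5"
  shows False
proof -
  define C where "C = {(q1, q2), (q2, q3), (q3, q4), (q4, q5), (q5, q1)}"
  define B where "B = {X. \<exists>(x, y)\<in>C. bad x y X}"
  have "B \<subseteq> Pow V" by (auto simp: B_def bad_def)
  then have "finite B" using fin by (meson finite_Pow_iff finite_subset)
  moreover have "X1 \<in> B" using assms by (auto simp: B_def C_def)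
  ultimately have "Max (card ` B) \<in> card ` B" by (intro Max_in) auto
  then obtain X where X1: "X \<in> B" "card X = Max (card ` B)" by auto
  have X: "X \<in> B" "\<And>Y. Y \<in> B \<Longrightarrow> card Y \<le> card X"
    using X1 \<open>finite B\<close> by simp_all
  have XP: "X \<subseteq> V - P" "card (cut h E X) \<le> 3" using X(1) by (auto simp: B_def bad_def)
  then have "card (cut h E X) = card (cut h E0 X) + of_bool (q1 \<in> X) + of_bool (q2 \<in> X) + of_bool (q3 \<in> X)
    + of_bool (q4 \<in> X) + of_bool (q5 \<in> X)" by (intro card_cut_avoiding) auto
  \<comment> \<open>With all five of these vertices in \<open>X\<close>, its cut would contain five
    edges to the pentagon.\<close>
  then have "\<not> {q1, q2, q3, q4, q5} \<subseteq> X" using XP(2) by auto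
  moreover have "q1 \<in> X \<or> q2 \<in> X \<or> q3 \<in> X \<or> q4 \<in> X \<or> q5 \<in> X" using X(1) by (auto simp: B_def C_def bad_def)
  ultimately have "\<exists>(x, y)\<in>C. (x \<in> X) \<noteq> (y \<in> X)" by (auto simp: C_def)
  then obtain x y where xy: "(x, y) \<in> C" "(x \<in> X) \<noteq> (y \<in> X)" by auto
  obtain Y where Y: "bad x y Y" using xy(1) assms by (auto simp: C_def)
  then have YB: "Y \<subseteq> V - P" "card (cut h E Y) \<le> 3" "x \<in> Y" "y \<in> Y" by (auto simp: bad_def)
  \<comment> \<open>Otherwise the union would be bad for the same pair, contradicting the maximal
    size of \<open>X\<close>.\<close>
  have "4 \<le> card (cut h E (X \<union> Y))"
  proof (rule ccontr)
    assume "\<not> ?thesis"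
    then have "bad x y (X \<union> Y)" using XP YB by (auto simp: bad_def)
    then have "X \<union> Y \<in> B" using xy(1) by (auto simp: B_def)
    then have "card (X \<union> Y) \<le> card X" by (rule X(2))
    moreover have "finite (X \<union> Y)" using XP YB fin by (meson Diff_subset finite_Un finite_subset subset_trans)
    ultimately have "X = X \<union> Y" by (metis Un_upper1 card_seteq)
    then show False using xy(2) YB by auto
  qed
  moreover obtain z g w where "z \<in> X \<inter> Y" "g \<in> E" "h g = {z, w}" "w \<in> P"
  proof -
    obtain z where z: "z \<in> X \<inter> Y" "z \<in> {x, y}" using xy(2) YB by auto
    have "\<exists>g\<in>E. \<exists>w\<in>P. h g = {z, w}" using z(2) xy(1) ends inE by (auto simp: C_def P_def insert_commute)
    then show thesis using that z by auto
  qed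
  ultimately show False
    using no_crossing_three_cuts[OF G _ XP(2) _ YB(2), of g z w] XP YB by auto
qed

text \<open>The pentagon is replaced by an edge joining \<open>q1\<close> to \<open>q2\<close> and the vertex \<open>p4\<close> with
  neighbours \<open>q3\<close>, \<open>q4\<close>, \<open>q5\<close>.\<close>

definition V5 where "V5 = V - {p1, p2, p3, p5}"
definition h5 where "h5 = h(g1 := {q1, q2}, g3 := {q3, p4}, g5 := {q5, p4})"
definition E5 where "E5 = E0 \<union> {g1, g3, g4, g5}"

lemma h5_E0: "e \<in> E0 \<Longrightarrow> h5 e = h e"
  by (auto simp: h5_def E0_def S_def)

lemma h5_simps [simp]: "h5 g1 = {q1, q2}" "h5 g3 = {q3, p4}" "h5 g4 = {p4, q4}" "h5 g5 = {q5, p4}"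
  by (auto simp: h5_def ends)

lemma fin5: "finite E5" "finite V5"
  using fin by (auto simp: E5_def V5_def)

lemma card_V5: "card V5 + 4 = card V"
proof -
  have "card V5 = card V - card {p1, p2, p3, p5}" unfolding V5_def using p_in fin by (intro card_Diff_subset) auto
  moreover have "card {p1, p2, p3, p5} = 4" by simp
  moreover have "card {p1, p2, p3, p5} \<le> card V" using p_in fin by (intro card_mono) auto
  ultimately show ?thesis by simp
qed

lemma sum_E5: "(\<Sum>e\<in>E5. f e) = (\<Sum>e\<in>E0. f e) + f g1 + f g3 + f g4 + (f g5 :: nat)"
proof -
  have "E0 \<inter> {g1, g3, g4, g5} = {}" by (auto simp: E0_def S_def)
  then have "(\<Sum>e\<in>E5. f e) = (\<Sum>e\<in>E0. f e) + (\<Sum>e\<in>{g1, g3, g4, g5}. f e)"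
    unfolding E5_def using fin(3) by (intro sum.union_disjoint) auto
  then show ?thesis by (simp add: add.assoc)
qed

lemma h5_inj_on:
  assumes "inj_on h E" "\<And>e. e \<in> E \<Longrightarrow> h e \<noteq> {q1, q2}"
  shows "inj_on h5 E5"
proof -
  have "inj_on h5 E0" using assms(1) h5_E0 by (auto simp: inj_on_def E0_def)
  moreover have out: "h5 e \<notin> {{q1, q2}, {q3, p4}, {p4, q4}, {q5, p4}}" if "e \<in> E0" for e
  proof -
    have "h5 e \<noteq> {q1, q2}" using assms(2) that h5_E0 by (auto simp: E0_def)
    moreover have "p4 \<notin> h5 e" using E0_avoid[OF that] h5_E0[OF that] by (auto simp: P_def)
    ultimately show ?thesis by auto
  qed
  moreover have "inj_on h5 {g1, g3, g4, g5}" by (auto simp: inj_on_def doubleton_eq_iff)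
  moreover have "h5 x \<noteq> h5 y" if "x \<in> E0" "y \<in> {g1, g3, g4, g5}" for x y
    using out[OF that(1)] that(2) by (elim insertE) simp_all
  ultimately show ?thesis unfolding E5_def inj_on_def by (metis Un_iff)
qed

text \<open>By passing to complements it suffices to treat sets avoiding \<open>p4\<close>. From
  such a set \<open>g3\<close>, \<open>g4\<close> and \<open>g5\<close> lead out as before, so only
  the new edge between \<open>q1\<close> and \<open>q2\<close> can lose cut edges.\<close>

lemma pentagon_reduced_cubic_2ec:
  assumes good: "\<And>X. \<not> bad q1 q2 X"
  shows "cubic_2ec V5 E5 h5"
proof -
  have mg5: "mgraph V5 E5 h5"
    unfolding mgraph_def
  proof (intro conjI ballI)
    fix e assume "e \<in> E5"
    then consider "e \<in> E0" | "e \<in> {g1, g3, g4, g5}" by (auto simp: E5_def)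
    then have "h5 e \<subseteq> V5 \<and> card (h5 e) = 2"
    proof cases
      case 1
      then have "h e \<subseteq> V" "card (h e) = 2" using mg by (auto simp: mgraph_def E0_def)
      then show ?thesis using E0_avoid[OF 1] by (auto simp: h5_E0[OF 1] V5_def P_def)
    qed (use q_in p_in in \<open>auto simp: V5_def\<close>)
    then show "h5 e \<subseteq> V5" "card (h5 e) = 2" by auto
  qed (fact fin5)+
  have E0_eq: "(\<Sum>e\<in>E0. f (h5 e)) = (\<Sum>e\<in>E0. f (h e) :: nat)" for f
    by (intro sum.cong) (auto simp: h5_E0)
  have deg: "card (inc h5 E5 v) = 3" if v: "v \<in> V5" for v
  proof (cases "v \<in> P")
    case True
    then have "v = p4" using v by (auto simp: P_def V5_def)
    moreover have "(\<Sum>e\<in>E0. if v \<in> h e then 1 else 0 :: nat) = 0"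
      using E0_avoid True by (intro sum.neutral) auto
    ultimately show ?thesis
      unfolding card_inc_sum[OF fin5(1)] sum_E5 E0_eq[of "\<lambda>A. if v \<in> A then 1 else 0"] by auto
  next
    case False
    have "card (inc h5 E5 v) = card (inc h E v)"
      unfolding card_inc_sum[OF fin5(1)] card_inc_sum[OF fin(2)] sum_E5 sum_E sum_S E0_eq[of "\<lambda>A. if v \<in> A then 1 else 0"]
      using False by (auto simp: ends P_def)
    then show ?thesis using deg3 v by (simp add: V5_def)
  qed
  have avoid: "2 \<le> card (cut h5 E5 X)" if X: "X \<subseteq> V5" "X \<noteq> {}" "p4 \<notin> X" for X
  proof -
    have XP: "X \<inter> P = {}" "X \<subseteq> V - P" using X by (auto simp: V5_def P_def)
    have "X \<subseteq> V" "X \<noteq> V" using X p_in by (auto simp: V5_def)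
    then have two: "2 \<le> card (cut h E X)" using G X by (simp add: cubic_2ec_def)
    have c5: "card (cut h5 E5 X) = card (cut h E0 X) + of_bool ((q1 \<in> X) \<noteq> (q2 \<in> X)) + of_bool (q3 \<in> X)
       + of_bool (q4 \<in> X) + of_bool (q5 \<in> X)"
      unfolding card_cut_sum[OF fin5(1)] card_cut_sum[OF fin(3)] sum_E5
        E0_eq[of "\<lambda>A. if A \<inter> X \<noteq> {} \<and> \<not> A \<subseteq> X then 1 else 0"]
      using X(3) by auto
    show ?thesis
    proof (cases "q1 \<in> X \<and> q2 \<in> X")
      case True
      then have "4 \<le> card (cut h E X)" using good[of X] XP by (simp add: bad_def)
      then show ?thesis using True by (simp add: c5 card_cut_avoiding[OF XP(1)])
    next
      case False
      then show ?thesis using two by (auto simp: c5 card_cut_avoiding[OF XP(1)])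
    qed
  qed
  have "2 \<le> card (cut h5 E5 X)" if X: "X \<subseteq> V5" "X \<noteq> {}" "X \<noteq> V5" for X
  proof (cases "p4 \<in> X")
    case True
    then have "2 \<le> card (cut h5 E5 (V5 - X))" using X by (intro avoid) auto
    then show ?thesis using cut_compl[OF mg5 X(1)] by simp
  qed (use avoid X in blast)
  moreover have "V5 \<noteq> {}" using p_in by (auto simp: V5_def)
  ultimately show ?thesis using mg5 deg by (simp add: cubic_2ec_def)
qed

lemma card_inc_split:
  assumes "F0 \<subseteq> E0" "T \<subseteq> S"
  shows "card (inc h (F0 \<union> T) v) = card (inc h F0 v) + card (inc h T v)"
proof -
  have "finite F0" "finite T" using assms fin finite_subset[of T S] by (auto simp: S_def intro: finite_subset)
  moreover have "inc h (F0 \<union> T) v = inc h F0 v \<union> inc h T v" "inc h F0 v \<inter> inc h T v = {}"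
    using assms E_split by (auto simp: inc_def)
  ultimately show ?thesis by (simp add: card_Un_disjoint inc_def)
qed

lemma inc_corner:
  assumes "T \<subseteq> S"
  shows "inc h T p1 = T \<inter> {e51, e12, g1}" "inc h T p2 = T \<inter> {e12, e23, g2}"
    "inc h T p3 = T \<inter> {e23, e34, g3}" "inc h T p4 = T \<inter> {e34, e45, g4}" "inc h T p5 = T \<inter> {e45, e51, g5}"
proof -
  have "T \<subseteq> E" using assms inE by (auto simp: S_def)
  then have "inc h T v = T \<inter> inc h E v" for v by (auto simp: inc_def)
  then show "inc h T p1 = T \<inter> {e51, e12, g1}" "inc h T p2 = T \<inter> {e12, e23, g2}"
    "inc h T p3 = T \<inter> {e23, e34, g3}" "inc h T p4 = T \<inter> {e34, e45, g4}" "inc h T p5 = T \<inter> {e45, e51, g5}"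
    by (simp_all add: incs)
qed

lemma inc_E0_corner: "F0 \<subseteq> E0 \<Longrightarrow> v \<in> P \<Longrightarrow> inc h F0 v = {}"
  using E0_avoid by (auto simp: inc_def)

lemma card_inc_outside:
  assumes "T \<subseteq> S" "v \<notin> P"
  shows "card (inc h T v) = of_bool (g1 \<in> T \<and> v = q1) + of_bool (g2 \<in> T \<and> v = q2)
    + of_bool (g3 \<in> T \<and> v = q3) + of_bool (g4 \<in> T \<and> v = q4) + of_bool (g5 \<in> T \<and> v = q5)"
proof -
  have "inc h T v = {e \<in> S. e \<in> T \<and> v \<in> h e}" using assms by (auto simp: inc_def)
  then have "card (inc h T v) = (\<Sum>e\<in>S. if e \<in> T \<and> v \<in> h e then 1 else 0)"
    by (simp add: S_def sum.inter_filter[symmetric])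
  also have "\<dots> = of_bool (g1 \<in> T \<and> v = q1) + of_bool (g2 \<in> T \<and> v = q2)
    + of_bool (g3 \<in> T \<and> v = q3) + of_bool (g4 \<in> T \<and> v = q4) + of_bool (g5 \<in> T \<and> v = q5)"
    unfolding sum_S using assms(2) by (auto simp: ends P_def)
  finally show ?thesis .
qed

lemma comp_edge:
  "e12 \<in> F \<Longrightarrow> component h F p1 = component h F p2" "e23 \<in> F \<Longrightarrow> component h F p2 = component h F p3"
  "e34 \<in> F \<Longrightarrow> component h F p3 = component h F p4" "e45 \<in> F \<Longrightarrow> component h F p4 = component h F p5"
  "e51 \<in> F \<Longrightarrow> component h F p5 = component h F p1"
  "g1 \<in> F \<Longrightarrow> component h F p1 = component h F q1" "g2 \<in> F \<Longrightarrow> component h F p2 = component h F q2"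
  "g3 \<in> F \<Longrightarrow> component h F p3 = component h F q3" "g4 \<in> F \<Longrightarrow> component h F p4 = component h F q4"
  "g5 \<in> F \<Longrightarrow> component h F p5 = component h F q5"
  using component_eq_edge[of _ F h] ends by metis+

text \<open>Parity at \<open>p4\<close> leaves eight patterns for \<open>g1\<close>,
  \<open>g3\<close>, \<open>g4\<close>, \<open>g5\<close>. Each can be completed along the pentagon
  with at most one corner uncovered, and the worst of them cost 5, with or without a new
  component.\<close>

lemma even_sub_pentagon_lift:
  assumes G5: "mgraph V5 E5 h5" and F': "even_sub V5 E5 h5 F'"
  shows "\<exists>F. even_sub V E h F \<and> card F + 2 * ncomp V h F \<le> card F' + 2 * ncomp V5 h5 F' + 5"
proof -
  define F0 where "F0 = F' \<inter> E0"
  define B where "B = F' \<inter> {g1, g3, g4, g5}"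
  have F0: "F0 \<subseteq> E0" by (simp add: F0_def)
  have F'E: "F' \<subseteq> E5" using F' by (simp add: even_sub_def)
  have F'_eq: "F' = F0 \<union> B" "F0 \<inter> B = {}" using F'E by (auto simp: F0_def B_def E5_def E0_def S_def)
  have finF0: "finite F0" using F0 fin finite_subset by auto
  have cardF': "card F' = card F0 + card B"
  proof -
    have "finite B" by (simp add: B_def)
    then show ?thesis using card_Un_disjoint[OF finF0 _ F'_eq(2)] F'_eq(1) by simp
  qed
  have mgF': "mgraph V5 F' h5" by (rule mgraph_subset[OF G5 F'E])
  have corner5: "even (card (F' \<inter> {g3, g4, g5}))"
  proof -
    have "inc h5 F' p4 = F' \<inter> {g3, g4, g5}"
      using F'E E0_avoid h5_E0 by (fastforce simp: inc_def E5_def P_def)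
    moreover have "p4 \<in> V5" using p_in by (auto simp: V5_def)
    ultimately show ?thesis using F' unfolding even_sub_def by metis
  qed
  have outside: "even (card (inc h F0 v) + of_bool (g1 \<in> F' \<and> (v = q1 \<or> v = q2))
      + of_bool (g3 \<in> F' \<and> v = q3) + of_bool (g4 \<in> F' \<and> v = q4) + of_bool (g5 \<in> F' \<and> v = q5))" if v: "v \<in> V - P" for v
  proof -
    let ?B = "{e \<in> {g1, g3, g4, g5}. e \<in> F' \<and> v \<in> h5 e}"
    have "inc h5 F' v = inc h F0 v \<union> ?B" using F'E h5_E0 by (auto simp: inc_def F0_def E5_def)
    moreover have "inc h F0 v \<inter> ?B = {}" using F'_eq by (auto simp: inc_def B_def)
    moreover have "card ?B = (\<Sum>e\<in>{g1, g3, g4, g5}. if e \<in> F' \<and> v \<in> h5 e then 1 else 0)"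
      by (simp only: sum.inter_filter[symmetric] finite.intros card_eq_sum)
    ultimately have "card (inc h5 F' v) = card (inc h F0 v) + of_bool (g1 \<in> F' \<and> (v = q1 \<or> v = q2))
      + of_bool (g3 \<in> F' \<and> v = q3) + of_bool (g4 \<in> F' \<and> v = q4) + of_bool (g5 \<in> F' \<and> v = q5)"
      using finF0 v by (simp add: card_Un_disjoint inc_def P_def)
    moreover have "even (card (inc h5 F' v))" using F' v by (auto simp: even_sub_def V5_def P_def)
    ultimately show ?thesis by simp
  qed
  \<comment> \<open>\<open>r\<close> is the corner that takes over the role of \<open>p4\<close> in
    the lift; it is chosen different from \<open>p4\<close> only when the lift leaves
    \<open>p4\<close> uncovered.\<close>
  define \<rho> where "\<rho> r v = (if v = p4 then r else v)" for r v
  have V5P: "V - P \<subseteq> V5" by (auto simp: V5_def P_def)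
  have main: ?thesis
    if T: "T \<subseteq> S" "g1 \<in> T \<longleftrightarrow> g1 \<in> F'" "g2 \<in> T \<longleftrightarrow> g1 \<in> F'" "T \<inter> {g3, g4, g5} = F' \<inter> {g3, g4, g5}"
      and corner: "even (card (T \<inter> {e51, e12, g1}))" "even (card (T \<inter> {e12, e23, g2}))"
        "even (card (T \<inter> {e23, e34, g3}))" "even (card (T \<inter> {e34, e45, g4}))" "even (card (T \<inter> {e45, e51, g5}))"
      and Z: "finite Z" "card T + 2 * card Z \<le> card B + 5"
      and conn: "g1 \<in> F' \<Longrightarrow> component h (F0 \<union> T) q1 = component h (F0 \<union> T) q2"
        "g3 \<in> F' \<Longrightarrow> component h (F0 \<union> T) q3 = component h (F0 \<union> T) r"
        "g4 \<in> F' \<Longrightarrow> component h (F0 \<union> T) r = component h (F0 \<union> T) q4"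
        "g5 \<in> F' \<Longrightarrow> component h (F0 \<union> T) q5 = component h (F0 \<union> T) r"
      and cover: "\<And>v. v \<in> {p1, p2, p3, p4, p5} \<Longrightarrow> component h (F0 \<union> T) v \<in> component h (F0 \<union> T) ` ({r, q1} \<union> Z)"
    for T Z r
  proof (intro exI[of _ "F0 \<union> T"] conjI)
    have finT: "finite T" using T(1) by (rule finite_subset) (simp add: S_def)
    have "F0 \<inter> T = {}" using T F0 E_split by auto
    then have cardT: "card (F0 \<union> T) = card F0 + card T" using finT finF0 by (simp add: card_Un_disjoint)
    show "even_sub V E h (F0 \<union> T)"
      unfolding even_sub_def
    proof (intro conjI ballI)
      show "F0 \<union> T \<subseteq> E" using F0 T E_split by auto
      fix v assume v: "v \<in> V"
      show "even (card (inc h (F0 \<union> T) v))"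
      proof (cases "v \<in> P")
        case True
        then have "v = p1 \<or> v = p2 \<or> v = p3 \<or> v = p4 \<or> v = p5" by (simp add: P_def)
        then have "even (card (inc h T v))" using corner inc_corner[OF T(1)] by metis
        then show ?thesis by (simp add: card_inc_split[OF F0 T(1)] inc_E0_corner[OF F0 True])
      next
        case False
        have g: "g3 \<in> T \<longleftrightarrow> g3 \<in> F'" "g4 \<in> T \<longleftrightarrow> g4 \<in> F'" "g5 \<in> T \<longleftrightarrow> g5 \<in> F'"
          using T(4) by auto
        have "of_bool (g1 \<in> F' \<and> v = q1) + of_bool (g1 \<in> F' \<and> v = q2) = (of_bool (g1 \<in> F' \<and> (v = q1 \<or> v = q2)) :: nat)"
          by auto
        then show ?thesis using outside[of v] v False
          by (simp add: card_inc_split[OF F0 T(1)] card_inc_outside[OF T(1) False] g T(2,3) add.assoc)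
      qed
    qed
    have "ncomp V h (F0 \<union> T) \<le> ncomp V5 h5 F' + card Z"
    proof (rule ncomp_le_map[OF mgF' Z(1), where \<rho> = "\<rho> r"])
      fix e assume e: "e \<in> F'"
      then consider "e \<in> F0" | "e = g1" | "e = g3" | "e = g4" | "e = g5" using F'_eq(1) unfolding B_def by blast
      then show "\<exists>x y. h5 e = {x, y} \<and> component h (F0 \<union> T) (\<rho> r x) = component h (F0 \<union> T) (\<rho> r y)"
      proof cases
        case 1
        then have "e \<in> E0" "e \<in> E" using F0 E_split by auto
        then obtain x y where xy: "h e = {x, y}" using mgraph_ends[OF mg] by metis
        then have "x \<noteq> p4" "y \<noteq> p4" using E0_avoid[OF \<open>e \<in> E0\<close>] by (auto simp: P_def)
        moreover have "h5 e = h e" using 1 F0 h5_E0 by auto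
        ultimately show ?thesis using component_eq_edge[of e "F0 \<union> T" h x y] 1 xy by (auto simp: \<rho>_def)
      next
        case 2 then show ?thesis using conn(1) e by (intro exI[of _ q1] exI[of _ q2]) (simp add: \<rho>_def)
      next
        case 3 then show ?thesis using conn(2) e by (intro exI[of _ q3] exI[of _ p4]) (simp add: \<rho>_def)
      next
        case 4 then show ?thesis using conn(3) e by (intro exI[of _ p4] exI[of _ q4]) (simp add: \<rho>_def)
      next
        case 5 then show ?thesis using conn(4) e by (intro exI[of _ q5] exI[of _ p4]) (simp add: \<rho>_def)
      qed
    next
      fix v assume v: "v \<in> V"
      have "p4 \<in> V5" "q1 \<in> V5" using p_in q_in by (auto simp: V5_def)
      then have "r \<in> \<rho> r ` V5" "q1 \<in> \<rho> r ` V5" by (auto simp: \<rho>_def image_iff)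
      moreover have "v \<in> \<rho> r ` V5" if "v \<notin> P"
        using that v V5P by (auto simp: \<rho>_def image_iff P_def intro!: bexI[of _ v])
      ultimately show "component h (F0 \<union> T) v \<in> component h (F0 \<union> T) ` (\<rho> r ` V5 \<union> Z)"
        using cover[of v] v by (cases "v \<in> P") (auto simp: P_def)
    qed
    then show "card (F0 \<union> T) + 2 * ncomp V h (F0 \<union> T) \<le> card F' + 2 * ncomp V5 h5 F' + 5"
      using Z(2) cardT cardF' by simp
  qed
  have par: "g3 \<in> F' \<Longrightarrow> (g4 \<in> F' \<longleftrightarrow> g5 \<notin> F')" "g3 \<notin> F' \<Longrightarrow> (g4 \<in> F' \<longleftrightarrow> g5 \<in> F')"
    using corner5 by (auto simp: Int_insert_right split: if_splits)
  consider
      (a) "g1 \<notin> F'" "g3 \<in> F'" "g4 \<in> F'" "g5 \<notin> F'"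
    | (b) "g1 \<notin> F'" "g3 \<notin> F'" "g4 \<in> F'" "g5 \<in> F'"
    | (c) "g1 \<notin> F'" "g3 \<in> F'" "g4 \<notin> F'" "g5 \<in> F'"
    | (d) "g1 \<notin> F'" "g3 \<notin> F'" "g4 \<notin> F'" "g5 \<notin> F'"
    | (e) "g1 \<in> F'" "g3 \<in> F'" "g4 \<in> F'" "g5 \<notin> F'"
    | (f) "g1 \<in> F'" "g3 \<notin> F'" "g4 \<in> F'" "g5 \<in> F'"
    | (g) "g1 \<in> F'" "g3 \<in> F'" "g4 \<notin> F'" "g5 \<in> F'"
    | (i) "g1 \<in> F'" "g3 \<notin> F'" "g4 \<notin> F'" "g5 \<notin> F'"
    using par by (cases "g1 \<in> F'"; cases "g3 \<in> F'"; cases "g4 \<in> F'"; simp)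
  then show ?thesis
  proof cases
    case a
    let ?T = "{g3, e23, e12, e51, e45, g4}" let ?c = "component h (F0 \<union> ?T)"
    have "?c p3 = ?c q3" "?c p2 = ?c p3" "?c p1 = ?c p2" "?c p5 = ?c p1" "?c p4 = ?c p5" "?c p4 = ?c q4"
      by (rule comp_edge; simp)+
    then show ?thesis using a by (intro main[of ?T "{}" p4]) (auto simp: S_def B_def Int_insert_right)
  next
    case b
    let ?T = "{g4, e34, e23, e12, e51, g5}" let ?c = "component h (F0 \<union> ?T)"
    have "?c p4 = ?c q4" "?c p3 = ?c p4" "?c p2 = ?c p3" "?c p1 = ?c p2" "?c p5 = ?c p1" "?c p5 = ?c q5"
      by (rule comp_edge; simp)+
    then show ?thesis using b by (intro main[of ?T "{}" p4]) (auto simp: S_def B_def Int_insert_right)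
  next
    case c
    let ?T = "{g3, e23, e12, e51, g5}" let ?c = "component h (F0 \<union> ?T)"
    have "?c p3 = ?c q3" "?c p2 = ?c p3" "?c p1 = ?c p2" "?c p5 = ?c p1" "?c p5 = ?c q5"
      by (rule comp_edge; simp)+
    then show ?thesis using c by (intro main[of ?T "{p4}" p3]) (auto simp: S_def B_def Int_insert_right)
  next
    \<comment> \<open>The isolated vertex \<open>p4\<close> grows into the whole pentagon, so no
      component is added.\<close>
    case d
    let ?T = "{e12, e23, e34, e45, e51}" let ?c = "component h (F0 \<union> ?T)"
    have "?c p1 = ?c p2" "?c p2 = ?c p3" "?c p3 = ?c p4" "?c p4 = ?c p5"
      by (rule comp_edge; simp)+
    then show ?thesis using d by (intro main[of ?T "{}" p4]) (auto simp: S_def B_def Int_insert_right)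
  next
    case e
    let ?T = "{g1, g2, e12, g3, e34, g4}" let ?c = "component h (F0 \<union> ?T)"
    have "?c p1 = ?c q1" "?c p2 = ?c q2" "?c p1 = ?c p2" "?c p3 = ?c q3" "?c p3 = ?c p4" "?c p4 = ?c q4"
      by (rule comp_edge; simp)+
    then show ?thesis using e by (intro main[of ?T "{p5}" p4]) (auto simp: S_def B_def Int_insert_right)
  next
    case f
    let ?T = "{g1, g2, e12, g4, e45, g5}" let ?c = "component h (F0 \<union> ?T)"
    have "?c p1 = ?c q1" "?c p2 = ?c q2" "?c p1 = ?c p2" "?c p4 = ?c q4" "?c p4 = ?c p5" "?c p5 = ?c q5"
      by (rule comp_edge; simp)+
    then show ?thesis using f by (intro main[of ?T "{p3}" p4]) (auto simp: S_def B_def Int_insert_right)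
  next
    case g
    let ?T = "{g1, g2, e12, g3, e34, e45, g5}" let ?c = "component h (F0 \<union> ?T)"
    have "?c p1 = ?c q1" "?c p2 = ?c q2" "?c p1 = ?c p2" "?c p3 = ?c q3" "?c p3 = ?c p4" "?c p4 = ?c p5" "?c p5 = ?c q5"
      by (rule comp_edge; simp)+
    then show ?thesis using g by (intro main[of ?T "{}" p4]) (auto simp: S_def B_def Int_insert_right)
  next
    case i
    let ?T = "{g1, g2, e51, e45, e34, e23}" let ?c = "component h (F0 \<union> ?T)"
    have "?c p1 = ?c q1" "?c p2 = ?c q2" "?c p5 = ?c p1" "?c p4 = ?c p5" "?c p3 = ?c p4" "?c p2 = ?c p3"
      by (rule comp_edge; simp)+
    then show ?thesis using i by (intro main[of ?T "{}" p4]) (auto simp: S_def B_def Int_insert_right)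
  qed
qed

end

subsection \<open>Finding short cycles\<close>

definition cyc3 :: "'v set set \<Rightarrow> 'v \<Rightarrow> 'v \<Rightarrow> 'v \<Rightarrow> bool" where
  "cyc3 A a b c \<longleftrightarrow> distinct [a, b, c] \<and> {{a, b}, {b, c}, {a, c}} \<subseteq> A"

definition cyc4 :: "'v set set \<Rightarrow> 'v \<Rightarrow> 'v \<Rightarrow> 'v \<Rightarrow> 'v \<Rightarrow> bool" where
  "cyc4 A a b c d \<longleftrightarrow> distinct [a, b, c, d] \<and> {{a, b}, {b, c}, {c, d}, {d, a}} \<subseteq> A"

definition cyc5 :: "'v set set \<Rightarrow> 'v \<Rightarrow> 'v \<Rightarrow> 'v \<Rightarrow> 'v \<Rightarrow> 'v \<Rightarrow> bool" where
  "cyc5 A a b c d e \<longleftrightarrow> distinct [a, b, c, d, e] \<and> {{a, b}, {b, c}, {c, d}, {d, e}, {e, a}} \<subseteq> A"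

lemma edge_image_ends:
  assumes "mgraph V E h" "{u, w} \<in> h ` E"
  shows "u \<noteq> w" "u \<in> V" "w \<in> V"
proof -
  obtain e where "e \<in> E" "h e = {u, w}" using assms(2) by auto
  then have "card {u, w} = 2" "{u, w} \<subseteq> V" using assms(1) by (auto simp: mgraph_def)
  then show "u \<noteq> w" "u \<in> V" "w \<in> V" by auto
qed

text \<open>Injectivity of \<open>h\<close> excludes cycles of length two, so the two edges at
  \<open>u\<close> lead to different vertices.\<close>

lemma two_factor_next:
  assumes mg: "mgraph V E h" and inj: "inj_on h E" and F: "two_factor V E h F" and u: "{u, w} \<in> h ` F"
  shows "\<exists>w'. w' \<noteq> w \<and> {u, w'} \<in> h ` F \<and> (\<forall>z. {u, z} \<in> h ` F \<longrightarrow> z = w \<or> z = w')"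
proof -
  have FE: "F \<subseteq> E" using F by (simp add: two_factor_def)
  have mgF: "mgraph V F h" by (rule mgraph_subset[OF mg FE])
  have uV: "u \<in> V" using edge_image_ends[OF mgF u] by simp
  obtain e where e: "e \<in> F" "h e = {u, w}" using u by auto
  have "card (inc h F u) = 2" using F uV by (simp add: two_factor_def)
  then obtain i j where ij: "inc h F u = {i, j}" "i \<noteq> j" by (meson card_2_iff)
  define f where "f = (if i = e then j else i)"
  have "e \<in> inc h F u" using e by (simp add: inc_def)
  then have f: "inc h F u = {e, f}" "f \<noteq> e" using ij by (auto simp: f_def)
  then have fF: "f \<in> F" "u \<in> h f" by (auto simp: inc_def)
  obtain w' where w': "h f = {u, w'}" using mgraph_other_end[OF mgF fF] by metis
  have "w' \<noteq> w"
  proof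
    assume "w' = w"
    then have "h f = h e" using w' e by simp
    then have "f = e" using inj_onD[OF inj] fF(1) e(1) FE by blast
    then show False using f(2) by simp
  qed
  moreover have "z = w \<or> z = w'" if z: "{u, z} \<in> h ` F" for z
  proof -
    obtain k where k: "k \<in> F" "h k = {u, z}" using z by auto
    then have "k \<in> inc h F u" by (simp add: inc_def)
    then have "k = e \<or> k = f" using f by auto
    then show ?thesis using k e w' by (auto simp: doubleton_eq_iff)
  qed
  moreover have "{u, w'} \<in> h ` F" using w' fF by (metis imageI)
  ultimately show ?thesis by blast
qed

text \<open>Follow the cycle from \<open>v\<close> over \<open>b\<close>, \<open>c\<close>,
  \<open>d\<close>, \<open>f\<close>, and let \<open>r\<close> be the neighbour of \<open>v\<close>
  on the other side. Either \<open>c\<close>, \<open>d\<close> or \<open>f\<close> equals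
  \<open>r\<close> and a cycle of length 3, 4 or 5 closes, or six different vertices have been
  met.\<close>

lemma short_cycle_or_large_component:
  assumes mg: "mgraph V E h" and inj: "inj_on h E" and F: "two_factor V E h F" and v: "v \<in> V"
  shows "6 \<le> card (component h F v) \<or>
    (\<exists>x y z. cyc3 (h ` E) x y z \<and> {x, y, z} \<subseteq> component h F v) \<or>
    (\<exists>x y z w. cyc4 (h ` E) x y z w \<and> {x, y, z, w} \<subseteq> component h F v) \<or>
    (\<exists>x y z w u. cyc5 (h ` E) x y z w u \<and> {x, y, z, w, u} \<subseteq> component h F v)"
proof -
  define N where "N u w \<longleftrightarrow> {u, w} \<in> h ` F" for u w
  have FE: "F \<subseteq> E" using F by (simp add: two_factor_def)
  have mgF: "mgraph V F h" by (rule mgraph_subset[OF mg FE])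
  have sym: "N u w \<Longrightarrow> N w u" for u w by (simp add: N_def insert_commute)
  have neq: "N u w \<Longrightarrow> u \<noteq> w" for u w unfolding N_def using edge_image_ends[OF mgF] by blast
  have nxt: "\<exists>w'. w' \<noteq> w \<and> N u w' \<and> (\<forall>z. N u z \<longrightarrow> z = w \<or> z = w')" if "N u w" for u w
    using two_factor_next[OF mg inj F, of u w] that by (simp add: N_def)
  have NE: "N u w \<Longrightarrow> {u, w} \<in> h ` E" for u w using FE by (auto simp: N_def)
  define C where "C = component h F v"
  have NC: "w \<in> C" if "u \<in> C" "N u w" for u w
    using that component_edge[of _ F h u w v] by (auto simp: C_def N_def)
  have finC: "finite C" using component_subset[OF mgF v] mg by (auto simp: C_def mgraph_def intro: finite_subset)
  have "inc h F v \<noteq> {}" using F v by (auto simp: two_factor_def)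
  then obtain e where e: "e \<in> F" "v \<in> h e" by (auto simp: inc_def)
  then obtain b where b: "N v b" using mgraph_other_end[OF mgF e] by (metis N_def imageI)
  obtain r where r: "r \<noteq> b" "N v r" "\<forall>z. N v z \<longrightarrow> z = b \<or> z = r" using nxt[OF b] by blast
  obtain c where c: "c \<noteq> v" "N b c" "\<forall>z. N b z \<longrightarrow> z = v \<or> z = c" using nxt[OF sym[OF b]] by blast
  obtain d where d: "d \<noteq> b" "N c d" "\<forall>z. N c z \<longrightarrow> z = b \<or> z = d" using nxt[OF sym[OF c(2)]] by blast
  obtain f where f: "f \<noteq> c" "N d f" "\<forall>z. N d z \<longrightarrow> z = c \<or> z = f" using nxt[OF sym[OF d(2)]] by blast
  have vC: "v \<in> C" by (simp add: C_def)
  then have bC: "b \<in> C" using NC b by blast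
  then have cC: "c \<in> C" using NC c(2) by blast
  then have dC: "d \<in> C" using NC d(2) by blast
  have inC: "v \<in> C" "b \<in> C" "r \<in> C" "c \<in> C" "d \<in> C" "f \<in> C"
    using vC bC cC dC NC[OF vC r(2)] NC[OF dC f(2)] by blast+
  have ne: "v \<noteq> b" "v \<noteq> r" "b \<noteq> c" "c \<noteq> d" "d \<noteq> f" using neq b r(2) c(2) d(2) f(2) by auto
  consider "c = r" | "c \<noteq> r" "d = r" | "c \<noteq> r" "d \<noteq> r" "f = r" | "c \<noteq> r" "d \<noteq> r" "f \<noteq> r" by blast
  then show ?thesis
  proof cases
    case 1
    then have "cyc3 (h ` E) v b r" using ne b r c NE by (auto simp: cyc3_def)
    then show ?thesis using inC unfolding C_def by blast
  next
    case 2
    have "d \<noteq> v" using d(2) sym r(3) 2 c(1) ne by metis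
    then have "cyc4 (h ` E) v b c r" using 2 ne b r(1,2) c(1,2) d(1,2) NE sym by (auto simp: cyc4_def)
    then show ?thesis using inC unfolding C_def by blast
  next
    case 3
    have "d \<noteq> v" using d(2) sym r(3) 3 c(1) ne by metis
    moreover have "cyc5 (h ` E) v b c d r"
      using 3 ne b r(1,2) c(1,2) d(1,2) f(1,2) \<open>d \<noteq> v\<close> NE sym by (auto simp: cyc5_def)
    ultimately show ?thesis using inC unfolding C_def by blast
  next
    case 4
    have "d \<noteq> v" using d(2) sym r(3) 4 c(1) ne by metis
    moreover have "f \<noteq> v" using f(2) sym r(3) 4 \<open>d \<noteq> v\<close> d(1) by metis
    moreover have "f \<noteq> b" using f(2) sym c(3) \<open>d \<noteq> v\<close> ne by metis
    ultimately have "card {v, b, r, c, d, f} = 6" using 4 ne r(1) c(1) d(1) f(1) by auto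
    moreover have "card {v, b, r, c, d, f} \<le> card C" using finC inC by (intro card_mono) auto
    ultimately show ?thesis by (simp add: C_def)
  qed
qed

lemma large_components_few:
  assumes mg: "mgraph V F h" and large: "\<And>v. v \<in> V \<Longrightarrow> k \<le> card (component h F v)"
  shows "k * ncomp V h F \<le> card V"
proof -
  let ?\<C> = "component h F ` V"
  have fin: "finite V" using mg by (simp add: mgraph_def)
  have sub: "\<And>C. C \<in> ?\<C> \<Longrightarrow> C \<subseteq> V" using component_subset[OF mg] by auto
  have finC: "\<And>C. C \<in> ?\<C> \<Longrightarrow> finite C" by (rule finite_subset[OF sub fin])
  have "disjnt C D" if CD: "C \<in> ?\<C>" "D \<in> ?\<C>" "C \<noteq> D" for C D
  proof -
    obtain x y where xy: "C = component h F x" "D = component h F y" using CD by auto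
    have False if "z \<in> C" "z \<in> D" for z
      using that CD(3) unfolding xy by (metis component_eq_iff in_component_iff)
    then show ?thesis by (auto simp: disjnt_def)
  qed
  then have "card (\<Union>?\<C>) = (\<Sum>C\<in>?\<C>. card C)"
    using finC by (intro card_Union_disjoint) (auto simp: pairwise_def)
  moreover have "(\<Sum>C\<in>?\<C>. k) \<le> (\<Sum>C\<in>?\<C>. card C)" using large by (intro sum_mono) auto
  moreover have "card (\<Union>?\<C>) \<le> card V" using sub fin by (intro card_mono) auto
  ultimately show ?thesis by (simp add: ncomp_def mult.commute)
qed

lemma third_neighbour:
  assumes G: "cubic_2ec V E h" and inj: "inj_on h E" and xy: "{v, x} \<in> h ` E" "{v, y} \<in> h ` E" "x \<noteq> y"
  obtains g w where "g \<in> E" "h g = {v, w}" "w \<noteq> x" "w \<noteq> y" "w \<noteq> v" "w \<in> V"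
    "\<And>z. {v, z} \<in> h ` E \<Longrightarrow> z = x \<or> z = y \<or> z = w"
proof -
  have mg: "mgraph V E h" using G by (simp add: cubic_2ec_def)
  have vV: "v \<in> V" using edge_image_ends[OF mg xy(1)] by simp
  obtain e f where ef: "e \<in> E" "h e = {v, x}" "f \<in> E" "h f = {v, y}" using xy(1,2) by (metis imageE)
  have "e \<noteq> f" using ef xy(3) by (auto simp: doubleton_eq_iff)
  have sub: "{e, f} \<subseteq> inc h E v" using ef by (auto simp: inc_def)
  have "card (inc h E v) = 3" using G vV by (simp add: cubic_2ec_def)
  then have "card (inc h E v - {e, f}) = 1" using sub \<open>e \<noteq> f\<close> by (simp add: card_Diff_subset)
  then obtain g where g: "inc h E v - {e, f} = {g}" by (meson card_1_singletonE)
  then have gE: "g \<in> E" "v \<in> h g" "g \<noteq> e" "g \<noteq> f" by (auto simp: inc_def)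
  obtain w where w: "h g = {v, w}" "w \<noteq> v" "w \<in> V" using mgraph_other_end[OF mg gE(1,2)] .
  have "w \<noteq> x" "w \<noteq> y" using inj ef gE w by (metis inj_onD)+
  moreover have "z = x \<or> z = y \<or> z = w" if z: "{v, z} \<in> h ` E" for z
  proof -
    obtain k where k: "k \<in> E" "h k = {v, z}" using z by auto
    then have "k \<in> {e, f, g}" using g by (auto simp: inc_def)
    then show ?thesis using k ef w by (auto simp: doubleton_eq_iff)
  qed
  ultimately show thesis using that gE w by blast
qed

text \<open>Since no triangle meets the square, it has no chords and consecutive outer neighbours
  differ; opposite ones may coincide.\<close>

lemma square_exists:
  assumes G: "cubic_2ec V E h" and inj: "inj_on h E" and C: "cyc4 (h ` E) a b c d"
    and nt: "\<And>x y z. cyc3 (h ` E) x y z \<Longrightarrow> {x, y, z} \<inter> {a, b, c, d} = {}"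
  obtains q1 q2 q3 q4 e12 e23 e34 e41 g1 g2 g3 g4 where
    "square V E h a b c d q1 q2 q3 q4 e12 e23 e34 e41 g1 g2 g3 g4"
    "q1 \<noteq> q2" "q2 \<noteq> q3" "q3 \<noteq> q4" "q4 \<noteq> q1"
proof -
  have mg: "mgraph V E h" using G by (simp add: cubic_2ec_def)
  have dist: "distinct [a, b, c, d]" and A: "{a, b} \<in> h ` E" "{b, c} \<in> h ` E" "{c, d} \<in> h ` E" "{d, a} \<in> h ` E"
    using C by (auto simp: cyc4_def)
  have A': "{b, a} \<in> h ` E" "{c, b} \<in> h ` E" "{d, c} \<in> h ` E" "{a, d} \<in> h ` E"
    using A by (simp_all add: insert_commute)
  obtain e12 where e12: "e12 \<in> E" "h e12 = {a, b}" using A(1) by auto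
  obtain e23 where e23: "e23 \<in> E" "h e23 = {b, c}" using A(2) by auto
  obtain e34 where e34: "e34 \<in> E" "h e34 = {c, d}" using A(3) by auto
  obtain e41 where e41: "e41 \<in> E" "h e41 = {d, a}" using A(4) by auto
  note e = e12 e23 e34 e41
  have tri: False if "{x, y} \<in> h ` E" "{y, z} \<in> h ` E" "{x, z} \<in> h ` E" "x \<in> {a, b, c, d}" for x y z
  proof -
    have "x \<noteq> y" "y \<noteq> z" "x \<noteq> z"
      using edge_image_ends(1)[OF mg that(1)] edge_image_ends(1)[OF mg that(2)] edge_image_ends(1)[OF mg that(3)] by auto
    then have "cyc3 (h ` E) x y z" using that by (auto simp: cyc3_def)
    then show False using nt that(4) by blast
  qed
  obtain g1 q1 where q1: "g1 \<in> E" "h g1 = {a, q1}" "q1 \<noteq> d" "q1 \<noteq> b" "q1 \<noteq> a" by (rule third_neighbour[OF G inj A'(4) A(1)]) (use dist in auto)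
  obtain g2 q2 where q2: "g2 \<in> E" "h g2 = {b, q2}" "q2 \<noteq> a" "q2 \<noteq> c" "q2 \<noteq> b" by (rule third_neighbour[OF G inj A'(1) A(2)]) (use dist in auto)
  obtain g3 q3 where q3: "g3 \<in> E" "h g3 = {c, q3}" "q3 \<noteq> b" "q3 \<noteq> d" "q3 \<noteq> c" by (rule third_neighbour[OF G inj A'(2) A(3)]) (use dist in auto)
  obtain g4 q4 where q4: "g4 \<in> E" "h g4 = {d, q4}" "q4 \<noteq> c" "q4 \<noteq> a" "q4 \<noteq> d" by (rule third_neighbour[OF G inj A'(3) A(4)]) (use dist in auto)
  have B: "{a, q1} \<in> h ` E" "{b, q2} \<in> h ` E" "{c, q3} \<in> h ` E" "{d, q4} \<in> h ` E"
    using q1 q2 q3 q4 by (metis imageI)+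
  have "q1 \<noteq> c" "q2 \<noteq> d" "q3 \<noteq> a" "q4 \<noteq> b"
    using tri[of a b c] tri[of b c d] tri[of c d a] tri[of d a b] A A' B by auto
  moreover have "q1 \<noteq> q2" "q2 \<noteq> q3" "q3 \<noteq> q4" "q4 \<noteq> q1"
    using tri[of a b q1] tri[of b c q2] tri[of c d q3] tri[of d a q4] A A' B by auto
  moreover have "{a, b, c, d} \<subseteq> V"
    using edge_image_ends(2,3)[OF mg A(1)] edge_image_ends(2,3)[OF mg A(3)] by auto
  ultimately show thesis using that[of q1 q2 q3 q4 e12 e23 e34 e41 g1 g2 g3 g4] e q1 q2 q3 q4 dist G
    unfolding square_def by auto
qed

text \<open>Triangles would arise from chords and from equal outer neighbours of consecutive
  corners; 4-cycles would arise from equal outer neighbours of corners at distance two.\<close>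

lemma pentagon_exists:
  assumes G: "cubic_2ec V E h" and inj: "inj_on h E" and C: "cyc5 (h ` E) a b c d f"
    and nt: "\<And>x y z. cyc3 (h ` E) x y z \<Longrightarrow> {x, y, z} \<inter> {a, b, c, d, f} = {}"
    and nq: "\<And>x y z w. cyc4 (h ` E) x y z w \<Longrightarrow> {x, y, z, w} \<inter> {a, b, c, d, f} = {}"
  obtains q1 q2 q3 q4 q5 e12 e23 e34 e45 e51 g1 g2 g3 g4 g5 where
    "pentagon V E h a b c d f q1 q2 q3 q4 q5 e12 e23 e34 e45 e51 g1 g2 g3 g4 g5"
proof -
  have mg: "mgraph V E h" using G by (simp add: cubic_2ec_def)
  have dist: "distinct [a, b, c, d, f]" and A: "{a, b} \<in> h ` E" "{b, c} \<in> h ` E" "{c, d} \<in> h ` E" "{d, f} \<in> h ` E" "{f, a} \<in> h ` E"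
    using C by (auto simp: cyc5_def)
  have A': "{b, a} \<in> h ` E" "{c, b} \<in> h ` E" "{d, c} \<in> h ` E" "{f, d} \<in> h ` E" "{a, f} \<in> h ` E"
    using A by (simp_all add: insert_commute)
  obtain e12 where e12: "e12 \<in> E" "h e12 = {a, b}" using A(1) by auto
  obtain e23 where e23: "e23 \<in> E" "h e23 = {b, c}" using A(2) by auto
  obtain e34 where e34: "e34 \<in> E" "h e34 = {c, d}" using A(3) by auto
  obtain e45 where e45: "e45 \<in> E" "h e45 = {d, f}" using A(4) by auto
  obtain e51 where e51: "e51 \<in> E" "h e51 = {f, a}" using A(5) by auto
  note e = e12 e23 e34 e45 e51
  have tri: False if "{x, y} \<in> h ` E" "{y, z} \<in> h ` E" "{x, z} \<in> h ` E" "x \<in> {a, b, c, d, f}" for x y z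
  proof -
    have "x \<noteq> y" "y \<noteq> z" "x \<noteq> z"
      using edge_image_ends(1)[OF mg that(1)] edge_image_ends(1)[OF mg that(2)] edge_image_ends(1)[OF mg that(3)] by auto
    then have "cyc3 (h ` E) x y z" using that by (auto simp: cyc3_def)
    then show False using nt that(4) by blast
  qed
  have quad: False if "{x, y} \<in> h ` E" "{y, z} \<in> h ` E" "{z, w} \<in> h ` E" "{x, w} \<in> h ` E" "x \<in> {a, b, c, d, f}" "x \<noteq> z" "y \<noteq> w" for x y z w
  proof -
    have "x \<noteq> y" "y \<noteq> z" "z \<noteq> w" "x \<noteq> w"
      using edge_image_ends(1)[OF mg that(1)] edge_image_ends(1)[OF mg that(2)] edge_image_ends(1)[OF mg that(3)]
        edge_image_ends(1)[OF mg that(4)] by auto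
    then have "cyc4 (h ` E) x y z w" using that by (auto simp: cyc4_def insert_commute)
    then show False using nq that(5) by blast
  qed
  obtain g1 q1 where q1: "g1 \<in> E" "h g1 = {a, q1}" "q1 \<noteq> f" "q1 \<noteq> b" "q1 \<noteq> a" by (rule third_neighbour[OF G inj A'(5) A(1)]) (use dist in auto)
  obtain g2 q2 where q2: "g2 \<in> E" "h g2 = {b, q2}" "q2 \<noteq> a" "q2 \<noteq> c" "q2 \<noteq> b" by (rule third_neighbour[OF G inj A'(1) A(2)]) (use dist in auto)
  obtain g3 q3 where q3: "g3 \<in> E" "h g3 = {c, q3}" "q3 \<noteq> b" "q3 \<noteq> d" "q3 \<noteq> c" by (rule third_neighbour[OF G inj A'(2) A(3)]) (use dist in auto)
  obtain g4 q4 where q4: "g4 \<in> E" "h g4 = {d, q4}" "q4 \<noteq> c" "q4 \<noteq> f" "q4 \<noteq> d" by (rule third_neighbour[OF G inj A'(3) A(4)]) (use dist in auto)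
  obtain g5 q5 where q5: "g5 \<in> E" "h g5 = {f, q5}" "q5 \<noteq> d" "q5 \<noteq> a" "q5 \<noteq> f" by (rule third_neighbour[OF G inj A'(4) A(5)]) (use dist in auto)
  have B: "{a, q1} \<in> h ` E" "{b, q2} \<in> h ` E" "{c, q3} \<in> h ` E" "{d, q4} \<in> h ` E" "{f, q5} \<in> h ` E"
    using q1 q2 q3 q4 q5 by (metis imageI)+
  have "q1 \<noteq> c" "q1 \<noteq> d" "q2 \<noteq> d" "q2 \<noteq> f" "q3 \<noteq> f" "q3 \<noteq> a" "q4 \<noteq> a" "q4 \<noteq> b" "q5 \<noteq> b" "q5 \<noteq> c"
    by (use tri[of a b c] A A' B in force, use tri[of a f d] A A' B in force, use tri[of b c d] A A' B in force,
        use tri[of b a f] A A' B in force, use tri[of c d f] A A' B in force, use tri[of c b a] A A' B in force,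
        use tri[of d f a] A A' B in force, use tri[of d c b] A A' B in force, use tri[of f a b] A A' B in force,
        use tri[of f d c] A A' B in force)
  moreover have "q1 \<noteq> q2" "q2 \<noteq> q3" "q3 \<noteq> q4" "q4 \<noteq> q5" "q5 \<noteq> q1"
    using tri[of a b q1] tri[of b c q2] tri[of c d q3] tri[of d f q4] tri[of f a q5] A A' B by auto
  moreover have "q1 \<noteq> q3" "q2 \<noteq> q4" "q3 \<noteq> q5" "q4 \<noteq> q1" "q5 \<noteq> q2"
    by (use quad[of a b c q1] q1 q2 A B dist in force, use quad[of b c d q2] q2 q3 A B dist in force,
        use quad[of c d f q3] q3 q4 A B dist in force, use quad[of d f a q4] q4 q5 A B dist in force,
        use quad[of f a b q5] q5 q1 A B dist in force)
  moreover have "{a, b, c, d, f} \<subseteq> V"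
    using edge_image_ends(2,3)[OF mg A(1)] edge_image_ends(2,3)[OF mg A(3)] edge_image_ends(2)[OF mg A(5)] by auto
  ultimately show thesis using that[of q1 q2 q3 q4 q5 e12 e23 e34 e45 e51 g1 g2 g3 g4 g5] e q1 q2 q3 q4 q5 dist G
    unfolding pentagon_def by auto
qed

text \<open>Expresses the existence of a bad set without reference to the labelling, so that rotated
  copies of a square or pentagon can be compared.\<close>

definition joined :: "'v set \<Rightarrow> 'e set \<Rightarrow> ('e \<Rightarrow> 'v set) \<Rightarrow> 'v set \<Rightarrow> 'v \<Rightarrow> 'v \<Rightarrow> bool" where
  "joined V E h C x y \<longleftrightarrow> (\<exists>X \<subseteq> V - C. x \<in> X \<and> y \<in> X \<and> card (cut h E X) \<le> 3)"

lemma two_factor_exists: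
  assumes "cubic_2ec V E h"
  obtains F where "two_factor V E h F" "6 * ncomp V h F \<le> card V + 4"
proof -
  obtain F where "two_factor V E h F" "6 * real (ncomp V h F) \<le> real (card V) + 4"
    using two_factor_few_cycles[OF assms, of "\<lambda>_. 0"] by auto
  then show thesis using that[of F] by linarith
qed

text \<open>A cost \<open>k\<close> on \<open>g\<close> is paid in full if the 2-factor avoids
  \<open>g\<close>, while the fractional matching pays only a third of it. With \<open>k = 1\<close>
  this prepays an extra cycle; a large \<open>k\<close> forces \<open>g\<close> into the
  2-factor.\<close>

lemma two_factor_exists_penalty:
  assumes G: "cubic_2ec V E h" and g: "g \<in> E"
  obtains F where "two_factor V E h F" "6 * ncomp V h F + 6 * k * of_bool (g \<notin> F) \<le> card V + 4 + 2 * k"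
proof -
  define c where "c e = (if e = g then real k else 0)" for e
  obtain F where F: "two_factor V E h F"
    "6 * real (ncomp V h F) + 6 * sum c (E - F) \<le> real (card V) + 4 + 2 * sum c E"
    using two_factor_few_cycles[OF G, of c] by auto
  have fin: "finite E" using G by (simp add: cubic_2ec_def mgraph_def)
  then have "sum c E = real k" "sum c (E - F) = real k * of_bool (g \<notin> F)"
    using g by (auto simp: c_def)
  then have "6 * real (ncomp V h F) + 6 * (real k * of_bool (g \<notin> F)) \<le> real (card V) + 4 + 2 * real k"
    using F(2) by simp
  then have "6 * ncomp V h F + 6 * k * of_bool (g \<notin> F) \<le> card V + 4 + 2 * k"
    by (cases "g \<in> F") simp_all
  then show thesis using that F(1) by blast
qed

context square
begin

lemma bad_iff: "(\<exists>X. bad x y X) \<longleftrightarrow> joined V E h {p1, p2, p3, p4} x y"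
  by (auto simp: bad_def joined_def P_def)

lemma card_outside: "card (V - P) + 4 = card V"
proof -
  have "card (V - P) = card V - card P" unfolding P_def using p fin by (intro card_Diff_subset) auto
  moreover have "card P = 4" by (simp add: P_def)
  moreover have "card P \<le> card V" unfolding P_def using p fin by (intro card_mono) auto
  ultimately show ?thesis by simp
qed

lemma h2_inj_on:
  assumes "inj_on h E" "q1 \<noteq> q2" "q3 \<noteq> q4"
  shows "inj_on h2 E2"
proof -
  have "inj_on h2 E0" using assms(1) h2_E0 by (auto simp: inj_on_def E0_def)
  moreover have "inj_on h2 {g1, g2, g3, g4, e23}" using assms(2,3) by (auto simp: inj_on_def doubleton_eq_iff)
  moreover have "h2 x \<noteq> h2 y" if "x \<in> E0" "y \<in> {g1, g2, g3, g4, e23}" for x y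
  proof -
    have "p2 \<notin> h2 x" "p3 \<notin> h2 x" using E0_avoid[OF that(1)] h2_E0[OF that(1)] by (auto simp: P_def)
    then show ?thesis using that(2) by (elim insertE) auto
  qed
  ultimately show ?thesis unfolding E2_def inj_on_def by (metis Un_iff)
qed

lemma card_V2: "card V2 + 2 = card V"
proof -
  have "card V2 = card V - card {p1, p4}" unfolding V2_def using p fin by (intro card_Diff_subset) auto
  moreover have "card {p1, p4} \<le> card V" using p fin by (intro card_mono) auto
  ultimately show ?thesis by simp
qed

end

text \<open>Two consecutive pairs are never both bad. So one of the two ways to pair the outer
  neighbours around the square has both pairs good, and a rotation brings it into standard
  position.\<close>

lemma good_square_exists:
  assumes G: "cubic_2ec V E h" and inj: "inj_on h E" and C: "cyc4 (h ` E) a b c d"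
    and nt: "\<And>x y z. cyc3 (h ` E) x y z \<Longrightarrow> {x, y, z} \<inter> {a, b, c, d} = {}"
  obtains p1 p2 p3 p4 q1 q2 q3 q4 e12 e23 e34 e41 g1 g2 g3 g4 where
    "square V E h p1 p2 p3 p4 q1 q2 q3 q4 e12 e23 e34 e41 g1 g2 g3 g4" "{p1, p2, p3, p4} = {a, b, c, d}"
    "q1 \<noteq> q2" "q3 \<noteq> q4" "\<not> joined V E h {p1, p2, p3, p4} q1 q2" "\<not> joined V E h {p1, p2, p3, p4} q3 q4"
proof -
  obtain q1 q2 q3 q4 e12 e23 e34 e41 g1 g2 g3 g4 where
    R0: "square V E h a b c d q1 q2 q3 q4 e12 e23 e34 e41 g1 g2 g3 g4"
    and ne: "q1 \<noteq> q2" "q2 \<noteq> q3" "q3 \<noteq> q4" "q4 \<noteq> q1"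
    using square_exists[OF G inj C nt] by metis
  note R1 = square.rotate[OF R0]
  note R2 = square.rotate[OF R1]
  note R3 = square.rotate[OF R2]
  define J where "J x y \<longleftrightarrow> joined V E h {a, b, c, d} x y" for x y
  have sets: "{b, c, d, a} = {a, b, c, d}" "{c, d, a, b} = {a, b, c, d}" "{d, a, b, c} = {a, b, c, d}" by auto
  have "\<not> (J q1 q2 \<and> J q2 q3)"
    using square.bad_cross[OF R0] square.bad_iff[OF R0] unfolding J_def by metis
  moreover have "\<not> (J q2 q3 \<and> J q3 q4)"
    using square.bad_cross[OF R1] square.bad_iff[OF R1] unfolding J_def sets by metis
  moreover have "\<not> (J q3 q4 \<and> J q4 q1)"
    using square.bad_cross[OF R2] square.bad_iff[OF R2] unfolding J_def sets by metis
  moreover have "\<not> (J q4 q1 \<and> J q1 q2)"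
    using square.bad_cross[OF R3] square.bad_iff[OF R3] unfolding J_def sets by metis
  ultimately consider "\<not> J q1 q2" "\<not> J q3 q4" | "\<not> J q2 q3" "\<not> J q4 q1" by blast
  then show thesis
  proof cases
    case 1
    then show thesis using that[OF R0 _ ne(1,3)] by (simp add: J_def)
  next
    case 2
    then show thesis using that[OF R1 _ ne(2,4)] by (simp add: J_def sets)
  qed
qed

lemma good_pentagon_exists:
  assumes G: "cubic_2ec V E h" and inj: "inj_on h E" and C: "cyc5 (h ` E) a b c d f"
    and nt: "\<And>x y z. cyc3 (h ` E) x y z \<Longrightarrow> {x, y, z} \<inter> {a, b, c, d, f} = {}"
    and nq: "\<And>x y z w. cyc4 (h ` E) x y z w \<Longrightarrow> {x, y, z, w} \<inter> {a, b, c, d, f} = {}"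
  obtains p1 p2 p3 p4 p5 q1 q2 q3 q4 q5 e12 e23 e34 e45 e51 g1 g2 g3 g4 g5 where
    "pentagon V E h p1 p2 p3 p4 p5 q1 q2 q3 q4 q5 e12 e23 e34 e45 e51 g1 g2 g3 g4 g5"
    "{p1, p2, p3, p4, p5} = {a, b, c, d, f}"
    "\<not> joined V E h {p1, p2, p3, p4, p5} q1 q2"
proof -
  obtain q1 q2 q3 q4 q5 e12 e23 e34 e45 e51 g1 g2 g3 g4 g5 where
    R0: "pentagon V E h a b c d f q1 q2 q3 q4 q5 e12 e23 e34 e45 e51 g1 g2 g3 g4 g5"
    using pentagon_exists[OF G inj C nt nq] by metis
  note R1 = pentagon.rotate[OF R0]
  note R2 = pentagon.rotate[OF R1]
  note R3 = pentagon.rotate[OF R2]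
  note R4 = pentagon.rotate[OF R3]
  define J where "J x y \<longleftrightarrow> joined V E h {a, b, c, d, f} x y" for x y
  have sets: "{b, c, d, f, a} = {a, b, c, d, f}" "{c, d, f, a, b} = {a, b, c, d, f}"
    "{d, f, a, b, c} = {a, b, c, d, f}" "{f, a, b, c, d} = {a, b, c, d, f}" by auto
  have bad_iff: "(\<exists>X. pentagon.bad V E h a b c d f x y X) \<longleftrightarrow> J x y" for x y
    by (auto simp: pentagon.bad_def[OF R0] pentagon.P_def[OF R0] J_def joined_def)
  have "\<not> (J q1 q2 \<and> J q2 q3 \<and> J q3 q4 \<and> J q4 q5 \<and> J q5 q1)"
    using pentagon.some_pair_not_bad[OF R0] unfolding bad_iff[symmetric] by blast
  then consider "\<not> J q1 q2" | "\<not> J q2 q3" | "\<not> J q3 q4" | "\<not> J q4 q5" | "\<not> J q5 q1" by blast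
  then show thesis
  proof cases
    case 1
    then show thesis using that[OF R0] by (simp add: J_def)
  next
    case 2
    then show thesis using that[OF R1] by (simp add: J_def sets)
  next
    case 3
    then show thesis using that[OF R2] by (simp add: J_def sets)
  next
    case 4
    then show thesis using that[OF R3] by (simp add: J_def sets)
  next
    case 5
    then show thesis using that[OF R4] by (simp add: J_def sets)
  qed
qed

text \<open>If a cut of size at most 2 splits the square into two opposite sides, no such cut splits
  it the other way. The side to be deleted is chosen accordingly.\<close>

lemma good_pinch_exists:
  assumes G: "cubic_2ec V E h" and inj: "inj_on h E" and C: "cyc4 (h ` E) a b c d"
    and nt: "\<And>x y z. \<not> cyc3 (h ` E) x y z"
  obtains p1 p2 p3 p4 q1 q2 q3 q4 e12 e23 e34 e41 g1 g2 g3 g4 where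
    "square V E h p1 p2 p3 p4 q1 q2 q3 q4 e12 e23 e34 e41 g1 g2 g3 g4" "q1 \<noteq> q2" "q3 \<noteq> q4"
    "\<And>X. X \<subseteq> V \<Longrightarrow> p1 \<in> X \<Longrightarrow> p2 \<in> X \<Longrightarrow> p3 \<notin> X \<Longrightarrow> p4 \<notin> X \<Longrightarrow> 3 \<le> card (cut h E X)"
proof -
  obtain q1 q2 q3 q4 e12 e23 e34 e41 g1 g2 g3 g4 where
    R0: "square V E h a b c d q1 q2 q3 q4 e12 e23 e34 e41 g1 g2 g3 g4"
    and ne: "q1 \<noteq> q2" "q2 \<noteq> q3" "q3 \<noteq> q4" "q4 \<noteq> q1"
    using square_exists[OF G inj C] nt by metis
  note R1 = square.rotate[OF R0]
  show thesis
  proof (cases "\<forall>X\<subseteq>V. a \<in> X \<longrightarrow> b \<in> X \<longrightarrow> c \<notin> X \<longrightarrow> d \<notin> X \<longrightarrow> 3 \<le> card (cut h E X)")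
    case True
    then show thesis using that[OF R0 ne(1,3)] by blast
  next
    case False
    then obtain X where X0: "X \<subseteq> V" "a \<in> X" "b \<in> X" "c \<notin> X" "d \<notin> X" "\<not> 3 \<le> card (cut h E X)" by blast
    then have X: "X \<subseteq> V" "a \<in> X" "b \<in> X" "c \<notin> X" "d \<notin> X" "card (cut h E X) \<le> 2" by simp_all
    have "3 \<le> card (cut h E Y)" if "Y \<subseteq> V" "b \<in> Y" "c \<in> Y" "d \<notin> Y" "a \<notin> Y" for Y
    proof (rule ccontr)
      assume "\<not> ?thesis"
      then have "card (cut h E Y) \<le> 2" by simp
      then show False using square.no_crossing_two_cuts[OF R0 X that] by simp
    qed
    then show thesis using that[OF R1 ne(2,4)] by blast
  qed
qed

context triangle
begin

text \<open>Contraction makes two edges parallel only if they run from two corners to the same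
  outside vertex, which \<open>nd\<close> excludes.\<close>

lemma h3_inj_on:
  assumes inj: "inj_on h E"
    and nd: "\<And>u v w. u \<in> T \<Longrightarrow> v \<in> T \<Longrightarrow> u \<noteq> v \<Longrightarrow> w \<notin> T \<Longrightarrow> {u, w} \<in> h ` E \<Longrightarrow> {v, w} \<notin> h ` E"
  shows "inj_on h3 E3"
proof (rule inj_onI)
  fix x y assume xy: "x \<in> E3" "y \<in> E3" "h3 x = h3 y"
  have repr: "\<exists>u w. h z = {u, w} \<and> w \<notin> T \<and> h3 z = {if u \<in> T then a else u, w}" if z: "z \<in> E3" for z
  proof -
    have "z \<in> E" using z by (simp add: E3_def)
    then obtain u w where uw: "h z = {u, w}" using mgraph_ends[OF mg] by metis
    have h3z: "h3 z = {if u \<in> T then a else u, if w \<in> T then a else w}" by (simp add: h3_def contract_def uw)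
    show ?thesis
    proof (cases "w \<in> T")
      case True
      then have "u \<notin> T" using z uw by (auto simp: E3_def)
      then show ?thesis using True h3z uw by (intro exI[of _ w] exI[of _ u]) (auto simp: insert_commute)
    qed (use h3z uw in auto)
  qed
  obtain u w where uw: "h x = {u, w}" "w \<notin> T" "h3 x = {if u \<in> T then a else u, w}" using repr[OF xy(1)] by blast
  obtain u' w' where uw': "h y = {u', w'}" "w' \<notin> T" "h3 y = {if u' \<in> T then a else u', w'}" using repr[OF xy(2)] by blast
  have E: "x \<in> E" "y \<in> E" using xy by (auto simp: E3_def)
  have eq: "{if u \<in> T then a else u, w} = {if u' \<in> T then a else u', w'}" using xy(3) uw uw' by simp
  have "h x = h y"
  proof (cases "u \<in> T")
    case True
    then have "w' = w \<and> u' \<in> T" using eq uw(2) uw'(2) TV(3) by (auto simp: doubleton_eq_iff split: if_splits)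
    then have "u = u'" using nd[OF True _ _ uw(2)] uw uw' E by (metis imageI)
    then show ?thesis using uw uw' \<open>w' = w \<and> u' \<in> T\<close> by simp
  next
    case False
    then have "u' \<notin> T" using eq uw(2) TV(3) by (auto simp: doubleton_eq_iff split: if_splits)
    then show ?thesis using eq False uw uw' by simp
  qed
  then show "x = y" using inj E by (auto simp: inj_on_def)
qed

end

lemma triangle_exists:
  assumes G: "cubic_2ec V E h" and C: "cyc3 (h ` E) a b c" and "4 \<le> card V"
  obtains t1 t2 t3 where "triangle V E h a b c t1 t2 t3"
proof -
  obtain t1 where t1: "t1 \<in> E" "h t1 = {b, c}" using C by (auto simp: cyc3_def)
  obtain t2 where t2: "t2 \<in> E" "h t2 = {a, c}" using C by (auto simp: cyc3_def)
  obtain t3 where t3: "t3 \<in> E" "h t3 = {a, b}" using C by (auto simp: cyc3_def)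
  have "card {a, b, c} \<le> 3" by (simp add: card_insert_if)
  then have "V \<noteq> {a, b, c}" using assms(3) by auto
  then have "triangle V E h a b c t1 t2 t3"
    using t1 t2 t3 C G unfolding triangle_def by (auto simp: cyc3_def)
  then show thesis by (rule that)
qed

lemma (in triangle) two_factor_lift_triangle:
  assumes "two_factor V3 E3 h3 F'"
  obtains F where "two_factor V E h F" "ncomp V h F \<le> ncomp V3 h3 F'" "F \<inter> E3 = F'"
  using even_sub_triangle_lift[OF two_factor_even_sub[OF assms]] assms by blast

subsection \<open>Two triangles sharing an edge\<close>

lemma two_factor_short_enough:
  assumes "mgraph V E h" "two_factor V E h F" "6 * ncomp V h F \<le> card V"
  shows "even_sub V E h F \<and> 3 * (card F + 2 * ncomp V h F) \<le> 4 * card V"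
  using assms two_factor_card[OF assms(1,2)] two_factor_even_sub[OF assms(2)] by simp

text \<open>This is the complete graph on \<open>a\<close>, \<open>b\<close>, \<open>c\<close>,
  \<open>d\<close> minus the edge between \<open>a\<close> and \<open>d\<close>. The four
  neighbourhoods say that its only exits lead from \<open>a\<close> to \<open>x\<close> and from
  \<open>d\<close> to \<open>y\<close>.\<close>

locale diamond =
  fixes V :: "'v set" and E :: "'e set" and h :: "'e \<Rightarrow> 'v set" and a b c d x y :: 'v and ga :: 'e
  assumes G: "cubic_2ec V E h" and inj: "inj_on h E"
    and dist: "distinct [a, b, c, d]" "x \<notin> {a, b, c, d}" "y \<notin> {a, b, c, d}" "x \<noteq> y"
    and edges: "{a, b} \<in> h ` E" "{a, c} \<in> h ` E" "{b, c} \<in> h ` E" "{b, d} \<in> h ` E" "{c, d} \<in> h ` E"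
    and ga: "ga \<in> E" "h ga = {a, x}"
    and Na: "\<And>z. {a, z} \<in> h ` E \<Longrightarrow> z = b \<or> z = c \<or> z = x"
    and Nb: "\<And>z. {b, z} \<in> h ` E \<Longrightarrow> z = a \<or> z = c \<or> z = d"
    and Nc: "\<And>z. {c, z} \<in> h ` E \<Longrightarrow> z = a \<or> z = b \<or> z = d"
    and Nd: "\<And>z. {d, z} \<in> h ` E \<Longrightarrow> z = b \<or> z = c \<or> z = y"
begin

lemma mg: "mgraph V E h"
  using G by (simp add: cubic_2ec_def)

lemma diamond_in_V: "{a, b, c, d} \<subseteq> V"
  using edge_image_ends(2,3)[OF mg edges(1)] edge_image_ends(2,3)[OF mg edges(5)] by auto

lemma neighbours:
  "u \<in> {a, b, c, d} \<Longrightarrow> {u, z} \<in> h ` E \<Longrightarrow> z \<in> {a, b, c, d} \<or> u = a \<and> z = x \<or> u = d \<and> z = y"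
  using Na Nb Nc Nd by blast

text \<open>A cycle that leaves the diamond must use both exits. It then contains \<open>x\<close>,
  \<open>a\<close>, \<open>d\<close>, \<open>y\<close> and one of \<open>b\<close>,
  \<open>c\<close>, so a cycle with fewer than five vertices stays inside.\<close>

lemma triangle_inside:
  assumes C: "cyc3 (h ` E) u v w" and u: "u \<in> {a, b, c, d}"
  shows "{u, v, w} \<subseteq> {a, b, c, d}"
proof -
  have A: "{u, v} \<in> h ` E" "{v, w} \<in> h ` E" "{u, w} \<in> h ` E" "v \<noteq> w" "u \<noteq> v" "u \<noteq> w" using C by (auto simp: cyc3_def)
  have A': "{w, v} \<in> h ` E" using A by (simp add: insert_commute)
  have "v \<in> {a, b, c, d}"
  proof (rule ccontr)
    assume v: "v \<notin> {a, b, c, d}"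
    then have uv: "u = a \<and> v = x \<or> u = d \<and> v = y" using neighbours[OF u A(1)] by auto
    have w: "w \<in> {a, b, c, d}" using neighbours[OF u A(3)] uv A(4) dist by auto
    then show False using neighbours[OF w A'] v uv A(6) dist by auto
  qed
  moreover have "w \<in> {a, b, c, d}"
  proof (rule ccontr)
    assume w: "w \<notin> {a, b, c, d}"
    then have uw: "u = a \<and> w = x \<or> u = d \<and> w = y" using neighbours[OF u A(3)] by auto
    have v: "v \<in> {a, b, c, d}" using neighbours[OF u A(1)] uw A(4) dist by auto
    then show False using neighbours[OF v A(2)] w uw A(5) dist by auto
  qed
  ultimately show ?thesis using u by blast
qed

lemma square_inside:
  assumes C: "cyc4 (h ` E) u v w z" and u: "u \<in> {a, b, c, d}"
  shows "{u, v, w, z} \<subseteq> {a, b, c, d}"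
proof -
  have A: "{u, v} \<in> h ` E" "{v, w} \<in> h ` E" "{w, z} \<in> h ` E" "{z, u} \<in> h ` E"
    and ne: "u \<noteq> v" "u \<noteq> w" "u \<noteq> z" "v \<noteq> w" "v \<noteq> z" "w \<noteq> z" using C by (auto simp: cyc4_def)
  have A': "{u, z} \<in> h ` E" "{z, w} \<in> h ` E" "{w, v} \<in> h ` E" using A by (simp_all add: insert_commute)
  have step: "v' \<in> {a, b, c, d}"
    if A: "{u, v'} \<in> h ` E" "{u, z'} \<in> h ` E" "{z', w} \<in> h ` E" "{w, v'} \<in> h ` E" and ne: "v' \<noteq> z'" "u \<noteq> w" for v' z'
  proof (rule ccontr)
    assume v: "v' \<notin> {a, b, c, d}"
    then have uv: "u = a \<and> v' = x \<or> u = d \<and> v' = y" using neighbours[OF u A(1)] by auto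
    have z: "z' \<in> {a, b, c, d}" using neighbours[OF u A(2)] uv ne dist by auto
    have "z' \<noteq> a" "z' \<noteq> d" using Na[of d] Nd[of a] uv A(2) dist edge_image_ends(1)[OF mg A(2)] by auto
    then have w: "w \<in> {a, b, c, d}" using neighbours[OF z A(3)] by auto
    then show False using neighbours[OF w A(4)] v uv ne dist by auto
  qed
  have "v \<in> {a, b, c, d}" using step[OF A(1) A'(1,2,3)] ne by auto
  moreover have z: "z \<in> {a, b, c, d}" using step[OF A'(1) A(1,2,3)] ne by auto
  moreover have "w \<in> {a, b, c, d}"
  proof (rule ccontr)
    assume w: "w \<notin> {a, b, c, d}"
    then have "v = a \<and> w = x \<or> v = d \<and> w = y" "z = a \<and> w = x \<or> z = d \<and> w = y"
      using neighbours[OF \<open>v \<in> {a, b, c, d}\<close> A(2)] neighbours[OF z A'(2)] by auto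
    then show False using ne dist by auto
  qed
  ultimately show ?thesis using u by blast
qed

lemma diamond_edges:
  obtains s1 s2 s3 where "s1 \<in> E" "h s1 = {b, c}" "s2 \<in> E" "h s2 = {a, c}" "s3 \<in> E" "h s3 = {a, b}"
proof -
  obtain s1 where 1: "s1 \<in> E" "h s1 = {b, c}" using edges(3) by auto
  obtain s2 where 2: "s2 \<in> E" "h s2 = {a, c}" using edges(2) by auto
  obtain s3 where 3: "s3 \<in> E" "h s3 = {a, b}" using edges(1) by auto
  show thesis by (rule that[OF 1 2 3])
qed

text \<open>Contracting both triangles leaves n - 4 vertices, for which the 2-factor bound is (n - 4
  + 4)/6 = n/6. Parallel edges are harmless because that bound holds for multigraphs.\<close>

lemma disjoint_triangle_case:
  assumes C: "cyc3 (h ` E) u v w" "{u, v, w} \<inter> {a, b, c, d} = {}"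
  shows "\<exists>F. two_factor V E h F \<and> 6 * ncomp V h F \<le> card V"
proof -
  obtain s1 s2 s3 where s: "s1 \<in> E" "h s1 = {b, c}" "s2 \<in> E" "h s2 = {a, c}" "s3 \<in> E" "h s3 = {a, b}"
    by (rule diamond_edges)
  have fin: "finite V" using mg by (simp add: mgraph_def)
  have "card {a, b, c, d} \<le> card V" using diamond_in_V fin by (rule card_mono[rotated])
  moreover have "card {a, b, c, d} = 4" using dist by simp
  ultimately have "4 \<le> card V" by simp
  then obtain t1 t2 t3 where T1: "triangle V E h u v w t1 t2 t3" using triangle_exists[OF G C(1)] by metis
  interpret T1: triangle V E h u v w t1 t2 t3 by (rule T1)
  have same: "T1.h3 s = h s" "s \<in> T1.E3" if "s \<in> E" "h s \<subseteq> {a, b, c}" "h s \<noteq> {}" for s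
  proof -
    have "z \<notin> T1.T" if "z \<in> h s" for z using that \<open>h s \<subseteq> {a, b, c}\<close> C(2) by (auto simp: T1.T_def)
    then show "T1.h3 s = h s" "s \<in> T1.E3" using \<open>s \<in> E\<close> \<open>h s \<noteq> {}\<close>
      by (auto simp: T1.h3_def contract_def T1.E3_def)
  qed
  have "d \<in> T1.V3" using diamond_in_V C(2) by (auto simp: T1.V3_def T1.T_def)
  moreover have "d \<notin> {a, b, c}" using dist by auto
  ultimately have "T1.V3 \<noteq> {a, b, c}" by metis
  then have T2: "triangle T1.V3 T1.E3 T1.h3 a b c s1 s2 s3"
    using T1.contracted_cubic_2ec dist s same unfolding triangle_def by auto
  interpret T2: triangle T1.V3 T1.E3 T1.h3 a b c s1 s2 s3 by (rule T2)
  obtain F2 where F2: "two_factor T2.V3 T2.E3 T2.h3 F2" "6 * ncomp T2.V3 T2.h3 F2 \<le> card T2.V3 + 4"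
    using two_factor_exists[OF T2.contracted_cubic_2ec] by blast
  obtain F1 where F1: "two_factor T1.V3 T1.E3 T1.h3 F1" "ncomp T1.V3 T1.h3 F1 \<le> ncomp T2.V3 T2.h3 F2"
    using T2.two_factor_lift_triangle[OF F2(1)] by blast
  obtain F where F: "two_factor V E h F" "ncomp V h F \<le> ncomp T1.V3 T1.h3 F1"
    using T1.two_factor_lift_triangle[OF F1(1)] by blast
  then show ?thesis using F2(2) F1(2) T1.card_V3 T2.card_V3 by (intro exI[of _ F]) simp
qed

text \<open>Replacing the square and contracting a triangle leaves n - 6 vertices. With the penalty
  of one cycle on \<open>g1\<close> the numerator is (n - 6) + 4 + 2 = n, and this already includes
  the cycle that the square may add.\<close>

lemma disjoint_square_case:
  assumes C: "cyc4 (h ` E) u v w z" "{u, v, w, z} \<inter> {a, b, c, d} = {}"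
    and nt: "\<And>u v w. cyc3 (h ` E) u v w \<Longrightarrow> {u, v, w} \<inter> {a, b, c, d} \<noteq> {}"
  shows "\<exists>F. two_factor V E h F \<and> 6 * ncomp V h F \<le> card V"
proof -
  obtain s1 s2 s3 where s: "s1 \<in> E" "h s1 = {b, c}" "s2 \<in> E" "h s2 = {a, c}" "s3 \<in> E" "h s3 = {a, b}"
    by (rule diamond_edges)
  have nt': "{i, j, k} \<inter> {u, v, w, z} = {}" if "cyc3 (h ` E) i j k" for i j k
  proof -
    have rot: "cyc3 (h ` E) j k i" "cyc3 (h ` E) k i j" using that by (auto simp: cyc3_def insert_commute)
    have "i \<in> {a, b, c, d} \<or> j \<in> {a, b, c, d} \<or> k \<in> {a, b, c, d}" using nt[OF that] by auto
    then have "{i, j, k} \<subseteq> {a, b, c, d}"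
    proof (elim disjE)
      assume "i \<in> {a, b, c, d}" then show ?thesis by (rule triangle_inside[OF that])
    next
      assume "j \<in> {a, b, c, d}" then have "{j, k, i} \<subseteq> {a, b, c, d}" by (rule triangle_inside[OF rot(1)])
      then show ?thesis by simp
    next
      assume "k \<in> {a, b, c, d}" then have "{k, i, j} \<subseteq> {a, b, c, d}" by (rule triangle_inside[OF rot(2)])
      then show ?thesis by simp
    qed
    then show ?thesis using C(2) by auto
  qed
  obtain p1 p2 p3 p4 q1 q2 q3 q4 e12 e23 e34 e41 g1 g2 g3 g4 where
    S: "square V E h p1 p2 p3 p4 q1 q2 q3 q4 e12 e23 e34 e41 g1 g2 g3 g4" and P: "{p1, p2, p3, p4} = {u, v, w, z}"
    and ne: "q1 \<noteq> q2" "q3 \<noteq> q4"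
    and good: "\<not> joined V E h {p1, p2, p3, p4} q1 q2" "\<not> joined V E h {p1, p2, p3, p4} q3 q4"
    using good_square_exists[OF G inj C(1) nt'] by metis
  interpret S: square V E h p1 p2 p3 p4 q1 q2 q3 q4 e12 e23 e34 e41 g1 g2 g3 g4 by (rule S)
  have G4: "cubic_2ec (V - S.P) S.E4 S.h4"
    using S.replaced_cubic_2ec[OF ne] good S.bad_iff by metis
  have PD: "S.P \<inter> {a, b, c, d} = {}" using P C(2) by (simp add: S.P_def)
  have same: "s \<in> S.E0" if "s \<in> E" "h s \<subseteq> {a, b, c}" for s
  proof -
    have "h t \<inter> S.P \<noteq> {}" if "t \<in> S.S" for t using that S.ends by (auto simp: S.S_def S.P_def)
    then show ?thesis using that PD by (auto simp: S.E0_def)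
  qed
  have sE0: "s1 \<in> S.E0" "s2 \<in> S.E0" "s3 \<in> S.E0" using s by (auto intro!: same)
  have "d \<in> V - S.P" using diamond_in_V PD by auto
  moreover have "d \<notin> {a, b, c}" using dist by auto
  ultimately have "V - S.P \<noteq> {a, b, c}" by metis
  then have T: "triangle (V - S.P) S.E4 S.h4 a b c s1 s2 s3"
    using G4 dist s sE0 S.h4_E0 unfolding triangle_def by (auto simp: S.E4_def)
  interpret T: triangle "V - S.P" S.E4 S.h4 a b c s1 s2 s3 by (rule T)
  \<comment> \<open>\<open>g1\<close> survives the contraction of the triangle, so the penalty can
    be imposed on it there.\<close>
  have "g1 \<in> S.E4" "g1 \<notin> {s1, s2, s3}" using S.g_notin sE0 by (auto simp: S.E4_def)
  then have g1: "g1 \<in> T.E3" using T.inside by (auto simp: T.E3_def)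
  obtain F2 where F2: "two_factor T.V3 T.E3 T.h3 F2"
    "6 * ncomp T.V3 T.h3 F2 + 6 * 1 * of_bool (g1 \<notin> F2) \<le> card T.V3 + 4 + 2 * 1"
    using two_factor_exists_penalty[OF T.contracted_cubic_2ec g1, of 1] by blast
  obtain F1 where F1: "two_factor (V - S.P) S.E4 S.h4 F1" "ncomp (V - S.P) S.h4 F1 \<le> ncomp T.V3 T.h3 F2"
    "F1 \<inter> T.E3 = F2"
    using T.two_factor_lift_triangle[OF F2(1)] by blast
  have "mgraph (V - S.P) S.E4 S.h4" using G4 by (simp add: cubic_2ec_def)
  then obtain F where F: "two_factor V E h F"
    "ncomp V h F \<le> ncomp (V - S.P) S.h4 F1 + of_bool (g1 \<notin> F1 \<and> g3 \<notin> F1)"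
    using S.two_factor_lift[OF ne _ F1(1)] by blast
  have "g1 \<in> F1 \<longleftrightarrow> g1 \<in> F2" using F1(3) g1 by auto
  then have "6 * ncomp V h F \<le> 6 * ncomp T.V3 T.h3 F2 + 6 * of_bool (g1 \<notin> F2)"
    using F(2) F1(2) by (cases "g1 \<in> F2"; cases "g3 \<in> F1") auto
  then show ?thesis using F(1) F2(2) T.card_V3 S.card_outside by (intro exI[of _ F]) simp
qed

text \<open>After both reductions n - 6 vertices remain, again 4 modulo 6, so rounding lowers the
  numerator from n - 2 to n - 4. This makes room for the 5 that the pentagon lift costs: 4 (n - 4) +
  15 <= 4 n.\<close>

lemma disjoint_pentagon_case:
  assumes C: "cyc5 (h ` E) u v w z r" "{u, v, w, z, r} \<inter> {a, b, c, d} = {}"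
    and nt: "\<And>u v w. cyc3 (h ` E) u v w \<Longrightarrow> {u, v, w} \<inter> {a, b, c, d} \<noteq> {}"
    and nq: "\<And>u v w z. cyc4 (h ` E) u v w z \<Longrightarrow> {u, v, w, z} \<inter> {a, b, c, d} \<noteq> {}"
    and n: "card V mod 6 = 4"
  shows "\<exists>F. even_sub V E h F \<and> 3 * (card F + 2 * ncomp V h F) \<le> 4 * card V"
proof -
  obtain s1 s2 s3 where s: "s1 \<in> E" "h s1 = {b, c}" "s2 \<in> E" "h s2 = {a, c}" "s3 \<in> E" "h s3 = {a, b}"
    by (rule diamond_edges)
  have nt': "{i, j, k} \<inter> {u, v, w, z, r} = {}" if "cyc3 (h ` E) i j k" for i j k
  proof -
    have rot: "cyc3 (h ` E) j k i" "cyc3 (h ` E) k i j" using that by (auto simp: cyc3_def insert_commute)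
    have "i \<in> {a, b, c, d} \<or> j \<in> {a, b, c, d} \<or> k \<in> {a, b, c, d}" using nt[OF that] by auto
    then have "{i, j, k} \<subseteq> {a, b, c, d}"
    proof (elim disjE)
      assume "i \<in> {a, b, c, d}" then show ?thesis by (rule triangle_inside[OF that])
    next
      assume "j \<in> {a, b, c, d}" then have "{j, k, i} \<subseteq> {a, b, c, d}" by (rule triangle_inside[OF rot(1)])
      then show ?thesis by simp
    next
      assume "k \<in> {a, b, c, d}" then have "{k, i, j} \<subseteq> {a, b, c, d}" by (rule triangle_inside[OF rot(2)])
      then show ?thesis by simp
    qed
    then show ?thesis using C(2) by auto
  qed
  have nq': "{i, j, k, l} \<inter> {u, v, w, z, r} = {}" if "cyc4 (h ` E) i j k l" for i j k l
  proof -
    have rot: "cyc4 (h ` E) j k l i" "cyc4 (h ` E) k l i j" "cyc4 (h ` E) l i j k" using that by (auto simp: cyc4_def)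
    have "i \<in> {a, b, c, d} \<or> j \<in> {a, b, c, d} \<or> k \<in> {a, b, c, d} \<or> l \<in> {a, b, c, d}" using nq[OF that] by auto
    then have "{i, j, k, l} \<subseteq> {a, b, c, d}"
    proof (elim disjE)
      assume "i \<in> {a, b, c, d}" then show ?thesis by (rule square_inside[OF that])
    next
      assume "j \<in> {a, b, c, d}" then have "{j, k, l, i} \<subseteq> {a, b, c, d}" by (rule square_inside[OF rot(1)])
      then show ?thesis by simp
    next
      assume "k \<in> {a, b, c, d}" then have "{k, l, i, j} \<subseteq> {a, b, c, d}" by (rule square_inside[OF rot(2)])
      then show ?thesis by simp
    next
      assume "l \<in> {a, b, c, d}" then have "{l, i, j, k} \<subseteq> {a, b, c, d}" by (rule square_inside[OF rot(3)])
      then show ?thesis by simp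
    qed
    then show ?thesis using C(2) by auto
  qed
  obtain p1 p2 p3 p4 p5 q1 q2 q3 q4 q5 e12 e23 e34 e45 e51 g1 g2 g3 g4 g5 where
    S: "pentagon V E h p1 p2 p3 p4 p5 q1 q2 q3 q4 q5 e12 e23 e34 e45 e51 g1 g2 g3 g4 g5"
    and P: "{p1, p2, p3, p4, p5} = {u, v, w, z, r}"
    and good: "\<not> joined V E h {p1, p2, p3, p4, p5} q1 q2"
    using good_pentagon_exists[OF G inj C(1) nt' nq'] by metis
  interpret S: pentagon V E h p1 p2 p3 p4 p5 q1 q2 q3 q4 q5 e12 e23 e34 e45 e51 g1 g2 g3 g4 g5 by (rule S)
  have G5: "cubic_2ec S.V5 S.E5 S.h5"
    using good by (intro S.pentagon_reduced_cubic_2ec) (auto simp: S.bad_def S.P_def joined_def)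
  have PD: "S.P \<inter> {a, b, c, d} = {}" using P C(2) by (simp add: S.P_def)
  have same: "s \<in> S.E0" if "s \<in> E" "h s \<subseteq> {a, b, c}" for s
  proof -
    have "h t \<inter> S.P \<noteq> {}" if "t \<in> S.S" for t using that S.ends by (auto simp: S.S_def S.P_def)
    then show ?thesis using that PD by (auto simp: S.E0_def)
  qed
  have sE0: "s1 \<in> S.E0" "s2 \<in> S.E0" "s3 \<in> S.E0" using s by (auto intro!: same)
  have "d \<in> S.V5" using diamond_in_V PD by (auto simp: S.V5_def S.P_def)
  moreover have "d \<notin> {a, b, c}" using dist by auto
  ultimately have "S.V5 \<noteq> {a, b, c}" by metis
  then have T: "triangle S.V5 S.E5 S.h5 a b c s1 s2 s3"
    using G5 dist s sE0 S.h5_E0 unfolding triangle_def by (auto simp: S.E5_def)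
  interpret T: triangle S.V5 S.E5 S.h5 a b c s1 s2 s3 by (rule T)
  obtain F2 where F2: "two_factor T.V3 T.E3 T.h3 F2" "6 * ncomp T.V3 T.h3 F2 \<le> card T.V3 + 4"
    using two_factor_exists[OF T.contracted_cubic_2ec] by blast
  obtain F1 where F1: "two_factor S.V5 S.E5 S.h5 F1" "ncomp S.V5 S.h5 F1 \<le> ncomp T.V3 T.h3 F2"
    using T.two_factor_lift_triangle[OF F2(1)] by blast
  have mg5: "mgraph S.V5 S.E5 S.h5" using G5 by (simp add: cubic_2ec_def)
  obtain F where F: "even_sub V E h F"
    "card F + 2 * ncomp V h F \<le> card F1 + 2 * ncomp S.V5 S.h5 F1 + 5"
    using S.even_sub_pentagon_lift[OF mg5 two_factor_even_sub[OF F1(1)]] by blast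
  have "card V = card T.V3 + 6" using T.card_V3 S.card_V5 by simp
  moreover have "6 * k \<le> m + 4 \<Longrightarrow> (m + 6) mod 6 = 4 \<Longrightarrow> 6 * k \<le> m + 2" for k m :: nat by presburger
  ultimately have "6 * ncomp T.V3 T.h3 F2 \<le> card T.V3 + 2" using F2(2) n by metis
  moreover have "card F1 = card S.V5" using two_factor_card[OF mg5 F1(1)] .
  ultimately have "3 * (card F + 2 * ncomp V h F) \<le> 4 * card V"
  proof -
    have arith: "3 * (f + 2 * k) \<le> 4 * v"
      if "6 * k2 \<le> t + 2" "f1 = v5" "f + 2 * k \<le> f1 + 2 * k1 + 5" "k1 \<le> k2" "t + 2 = v5" "v5 + 4 = v"
      for f k k1 k2 t f1 v5 v :: nat
    proof -
      have "3 * (f + 2 * k) \<le> 3 * (f1 + 2 * k2 + 5)" using that by (intro mult_le_mono2) simp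
      also have "\<dots> = 3 * v5 + 6 * k2 + 15" using that by simp
      also have "\<dots> \<le> 4 * v5 + 15" using that by simp
      also have "\<dots> \<le> 4 * v" using that by simp
      finally show ?thesis .
    qed
    show ?thesis by (rule arith[OF _ _ F(2) F1(2) T.card_V3 S.card_V5]) fact+
  qed
  then show ?thesis using F(1) by blast
qed

text \<open>Let \<open>b'\<close> be the other neighbour of \<open>a\<close> on the cycle and
  \<open>c'\<close> the remaining middle vertex. As \<open>c'\<close> is not joined to
  \<open>a\<close>, it is joined to \<open>b'\<close> and \<open>d\<close>. This uses up
  \<open>b'\<close>, so the cycle must leave \<open>d\<close> towards \<open>y\<close>.\<close>

lemma two_factor_through_diamond:
  assumes F: "two_factor V E h F" and gaF: "ga \<in> F"
  shows "{a, b, c, d, x, y} \<subseteq> component h F a"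
proof -
  define N where "N u w \<longleftrightarrow> {u, w} \<in> h ` F" for u w
  define K where "K = component h F a"
  have FE: "F \<subseteq> E" using F by (simp add: two_factor_def)
  have sym: "N u w \<Longrightarrow> N w u" for u w by (simp add: N_def insert_commute)
  have NE: "N u w \<Longrightarrow> {u, w} \<in> h ` E" for u w using FE by (auto simp: N_def)
  have NK: "w \<in> K" if "u \<in> K" "N u w" for u w
    using that component_edge[of _ F h u w a] by (auto simp: K_def N_def)
  have nxt: "\<exists>w'. w' \<noteq> w \<and> N u w' \<and> (\<forall>z. N u z \<longrightarrow> z = w \<or> z = w')" if "N u w" for u w
    using two_factor_next[OF mg inj F, of u w] that by (simp add: N_def)
  have Nax: "N a x" using gaF ga by (auto simp: N_def)
  have aK: "a \<in> K" by (simp add: K_def)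
  have ne: "a \<noteq> b" "a \<noteq> c" "a \<noteq> d" "b \<noteq> c" "b \<noteq> d" "c \<noteq> d" "x \<noteq> b" "x \<noteq> c" "y \<noteq> b" "y \<noteq> c" using dist by auto
  have main: "{b', c', d, y} \<subseteq> K"
    if ab: "N a b'" and uniq: "\<forall>z. N a z \<longrightarrow> z = x \<or> z = b'"
      and nb: "\<And>z. N b' z \<Longrightarrow> z = a \<or> z = c' \<or> z = d" and nc: "\<And>z. N c' z \<Longrightarrow> z = a \<or> z = b' \<or> z = d"
      and ne': "b' \<noteq> c'" "c' \<noteq> x" "a \<noteq> c'" "d \<noteq> b'" "d \<noteq> c'" "y \<noteq> c'"
      and nd: "\<And>z. N d z \<Longrightarrow> z = b' \<or> z = c' \<or> z = y" and Vc: "c' \<in> V" for b' c'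
  proof -
    have "\<not> N c' a" using uniq sym ne' by metis
    have "inc h F c' \<noteq> {}" using F Vc by (auto simp: two_factor_def)
    then obtain e where e: "e \<in> F" "c' \<in> h e" by (auto simp: inc_def)
    moreover have "mgraph V F h" by (rule mgraph_subset[OF mg FE])
    ultimately obtain k where "N c' k" using mgraph_other_end[of V F h e c'] by (metis N_def imageI)
    then obtain k' where k: "N c' k" "N c' k'" "k \<noteq> k'" using nxt by metis
    then have cb: "N c' b'" and cd: "N c' d" using nc \<open>\<not> N c' a\<close> by metis+
    obtain m where m: "\<forall>z. N b' z \<longrightarrow> z = a \<or> z = m" using nxt[OF sym[OF ab]] by blast
    then have "c' = m" using sym[OF cb] ne'(3) by blast
    then have "\<not> N b' d" using m ne(3) ne'(5) by blast
    then have "\<not> N d b'" using sym by blast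
    obtain l where l: "l \<noteq> c'" "N d l" using nxt[OF sym[OF cd]] by blast
    then have "l = y" using nd[OF l(2)] \<open>\<not> N d b'\<close> by blast
    then have "N d y" using l by simp
    moreover have "b' \<in> K" by (rule NK[OF aK ab])
    moreover from this have "c' \<in> K" by (rule NK[OF _ sym[OF cb]])
    moreover from this have "d \<in> K" by (rule NK[OF _ cd])
    ultimately show ?thesis using NK[of d y] by simp
  qed
  have "x \<in> K" using NK aK Nax by blast
  obtain b' where b': "b' \<noteq> x" "N a b'" "\<forall>z. N a z \<longrightarrow> z = x \<or> z = b'" using nxt[OF Nax] by blast
  have V: "b \<in> V" "c \<in> V" using diamond_in_V by auto
  have NN: "\<And>z. N b z \<Longrightarrow> z = a \<or> z = c \<or> z = d" "\<And>z. N c z \<Longrightarrow> z = a \<or> z = b \<or> z = d"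
    "\<And>z. N d z \<Longrightarrow> z = b \<or> z = c \<or> z = y" using NE Nb Nc Nd by blast+
  have "b' = b \<or> b' = c" using Na[OF NE[OF b'(2)]] b'(1) by blast
  then have "{b, c, d, y} \<subseteq> K"
  proof
    assume "b' = b"
    then have "N a b" "\<forall>z. N a z \<longrightarrow> z = x \<or> z = b" using b' by auto
    then show ?thesis by (rule main[of b c]) (use NN ne V in metis)+
  next
    assume "b' = c"
    then have "N a c" "\<forall>z. N a z \<longrightarrow> z = x \<or> z = c" using b' by auto
    then have "{c, b, d, y} \<subseteq> K" by (rule main[of c b]) (use NN ne V in metis)+
    then show ?thesis by blast
  qed
  then show ?thesis using aK \<open>x \<in> K\<close> by (simp add: K_def)
qed

lemma no_disjoint_short_cycle_case:
  assumes nt: "\<And>u v w. cyc3 (h ` E) u v w \<Longrightarrow> {u, v, w} \<inter> {a, b, c, d} \<noteq> {}"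
    and nq: "\<And>u v w z. cyc4 (h ` E) u v w z \<Longrightarrow> {u, v, w, z} \<inter> {a, b, c, d} \<noteq> {}"
    and np: "\<And>u v w z r. cyc5 (h ` E) u v w z r \<Longrightarrow> {u, v, w, z, r} \<inter> {a, b, c, d} \<noteq> {}"
  shows "\<exists>F. two_factor V E h F \<and> 6 * ncomp V h F \<le> card V"
proof -
  \<comment> \<open>The penalty forces \<open>ga\<close> into the 2-factor: avoiding it would
    require 6 (n + 5) <= 3 n + 14. The cycle through the diamond then has at least six
    vertices.\<close>
  obtain F where F: "two_factor V E h F"
    "6 * ncomp V h F + 6 * (card V + 5) * of_bool (ga \<notin> F) \<le> card V + 4 + 2 * (card V + 5)"
    using two_factor_exists_penalty[OF G ga(1), of "card V + 5"] by blast
  have "ga \<in> F"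
  proof (rule ccontr)
    assume "ga \<notin> F"
    then show False using F(2) by simp
  qed
  have FE: "F \<subseteq> E" using F by (simp add: two_factor_def)
  have mgF: "mgraph V F h" by (rule mgraph_subset[OF mg FE])
  define K where "K = component h F a"
  have DK: "{a, b, c, d, x, y} \<subseteq> K" unfolding K_def by (rule two_factor_through_diamond[OF F(1) \<open>ga \<in> F\<close>])
  have KV: "K \<subseteq> V" unfolding K_def using component_subset[OF mgF] diamond_in_V by auto
  have "6 \<le> card (component h F v)" if v: "v \<in> V" for v
  proof (cases "v \<in> K")
    case True
    then have "component h F v = K" unfolding K_def by (simp add: component_eq_iff in_component_iff conn_sym)
    moreover have "card {a, b, c, d, x, y} \<le> card K"
      using DK KV mg by (intro card_mono) (auto simp: mgraph_def intro: finite_subset)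
    moreover have "card {a, b, c, d, x, y} = 6" using dist by auto
    ultimately show ?thesis by simp
  next
    case False
    have disj: "component h F v \<inter> {a, b, c, d} = {}"
    proof -
      have "component h F v \<inter> K = {}"
        using False unfolding K_def by (metis component_eq_iff disjoint_iff in_component_iff)
      then show ?thesis using DK by blast
    qed
    show ?thesis
      using short_cycle_or_large_component[OF mg inj F(1) v]
    proof (elim disjE exE conjE)
      fix u v' w assume "cyc3 (h ` E) u v' w" "{u, v', w} \<subseteq> component h F v"
      then show ?thesis using nt[of u v' w] disj by blast
    next
      fix u v' w z assume "cyc4 (h ` E) u v' w z" "{u, v', w, z} \<subseteq> component h F v"
      then show ?thesis using nq[of u v' w z] disj by blast
    next
      fix u v' w z r assume "cyc5 (h ` E) u v' w z r" "{u, v', w, z, r} \<subseteq> component h F v"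
      then show ?thesis using np[of u v' w z r] disj by blast
    qed
  qed
  then have "6 * ncomp V h F \<le> card V" by (rule large_components_few[OF mgF])
  then show ?thesis using F(1) by blast
qed

lemma diamond_even_sub:
  assumes n: "card V mod 6 = 4"
  shows "\<exists>F. even_sub V E h F \<and> 3 * (card F + 2 * ncomp V h F) \<le> 4 * card V"
proof -
  have tf: ?thesis if "\<exists>F. two_factor V E h F \<and> 6 * ncomp V h F \<le> card V"
    using that two_factor_short_enough[OF mg] by blast
  consider "\<exists>u v w. cyc3 (h ` E) u v w \<and> {u, v, w} \<inter> {a, b, c, d} = {}"
    | "\<nexists>u v w. cyc3 (h ` E) u v w \<and> {u, v, w} \<inter> {a, b, c, d} = {}"
      "\<exists>u v w z. cyc4 (h ` E) u v w z \<and> {u, v, w, z} \<inter> {a, b, c, d} = {}"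
    | "\<nexists>u v w. cyc3 (h ` E) u v w \<and> {u, v, w} \<inter> {a, b, c, d} = {}"
      "\<nexists>u v w z. cyc4 (h ` E) u v w z \<and> {u, v, w, z} \<inter> {a, b, c, d} = {}"
      "\<exists>u v w z r. cyc5 (h ` E) u v w z r \<and> {u, v, w, z, r} \<inter> {a, b, c, d} = {}"
    | "\<nexists>u v w. cyc3 (h ` E) u v w \<and> {u, v, w} \<inter> {a, b, c, d} = {}"
      "\<nexists>u v w z. cyc4 (h ` E) u v w z \<and> {u, v, w, z} \<inter> {a, b, c, d} = {}"
      "\<nexists>u v w z r. cyc5 (h ` E) u v w z r \<and> {u, v, w, z, r} \<inter> {a, b, c, d} = {}"
    by argo
  then show ?thesis
  proof cases
    case 1
    then show ?thesis using disjoint_triangle_case tf by metis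
  next
    case 2
    then show ?thesis using disjoint_square_case tf by metis
  next
    case 3
    then show ?thesis using disjoint_pentagon_case[OF _ _ _ _ n] by metis
  next
    case 4
    show ?thesis
    proof (rule tf, rule no_disjoint_short_cycle_case)
      show "{u, v, w} \<inter> {a, b, c, d} \<noteq> {}" if "cyc3 (h ` E) u v w" for u v w using 4(1) that by metis
      show "{u, v, w, z} \<inter> {a, b, c, d} \<noteq> {}" if "cyc4 (h ` E) u v w z" for u v w z using 4(2) that by metis
      show "{u, v, w, z, r} \<inter> {a, b, c, d} \<noteq> {}" if "cyc5 (h ` E) u v w z r" for u v w z r using 4(3) that by metis
    qed
  qed
qed

end

subsection \<open>Small even edge sets\<close>

text \<open>If \<open>x\<close> or \<open>y\<close> were one of the four vertices, or if both
  coincided, at most one edge would leave a set of at most five vertices. As \<open>V\<close> has at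
  least six, this set is proper and the edge would be a bridge.\<close>

lemma diamond_exists:
  assumes G: "cubic_2ec V E h" and inj: "inj_on h E" and n: "6 \<le> card V"
    and dist: "distinct [a, b, c, d]"
    and edges: "{a, b} \<in> h ` E" "{a, c} \<in> h ` E" "{b, c} \<in> h ` E" "{b, d} \<in> h ` E" "{c, d} \<in> h ` E"
  obtains x y ga where "diamond V E h a b c d x y ga"
proof -
  have mg: "mgraph V E h" using G by (simp add: cubic_2ec_def)
  have fin: "finite V" "finite E" using mg by (auto simp: mgraph_def)
  have edges': "{b, a} \<in> h ` E" "{c, a} \<in> h ` E" "{c, b} \<in> h ` E" "{d, b} \<in> h ` E" "{d, c} \<in> h ` E"
    using edges by (simp_all add: insert_commute)
  obtain ga x where x: "ga \<in> E" "h ga = {a, x}" "x \<noteq> b" "x \<noteq> c" "x \<noteq> a" "x \<in> V"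
    "\<And>z. {a, z} \<in> h ` E \<Longrightarrow> z = b \<or> z = c \<or> z = x"
    by (rule third_neighbour[OF G inj edges(1,2)]) (use dist in auto)
  obtain gd y where y: "gd \<in> E" "h gd = {d, y}" "y \<noteq> b" "y \<noteq> c" "y \<noteq> d" "y \<in> V"
    "\<And>z. {d, z} \<in> h ` E \<Longrightarrow> z = b \<or> z = c \<or> z = y"
    by (rule third_neighbour[OF G inj edges'(4,5)]) (use dist in auto)
  have Nb: "z = a \<or> z = c \<or> z = d" if "{b, z} \<in> h ` E" for z
  proof -
    obtain w where w: "\<And>z. {b, z} \<in> h ` E \<Longrightarrow> z = a \<or> z = c \<or> z = w"
      by (rule third_neighbour[OF G inj edges'(1) edges(3)]) (use dist in auto)
    have "d = w" using w[OF edges(4)] dist by auto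
    then show ?thesis using w[OF that] by simp
  qed
  have Nc: "z = a \<or> z = b \<or> z = d" if "{c, z} \<in> h ` E" for z
  proof -
    obtain w where w: "\<And>z. {c, z} \<in> h ` E \<Longrightarrow> z = a \<or> z = b \<or> z = w"
      by (rule third_neighbour[OF G inj edges'(2,3)]) (use dist in auto)
    have "d = w" using w[OF edges(5)] dist by auto
    then show ?thesis using w[OF that] by simp
  qed
  let ?D = "{a, b, c, d}"
  have DV: "?D \<subseteq> V" using edge_image_ends(2,3)[OF mg edges(1)] edge_image_ends(2,3)[OF mg edges(5)] by auto
  have cardD: "card ?D \<le> 4" by (simp add: card_insert_if)
  have leaving: "e = ga \<and> x \<notin> ?D \<or> e = gd \<and> y \<notin> ?D" if e: "e \<in> cut h E ?D" for e
  proof -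
    have eE: "e \<in> E" using e by (simp add: cut_def)
    obtain u w where uw: "h e = {u, w}" "u \<in> ?D" "w \<notin> ?D"
    proof -
      obtain u w where "h e = {u, w}" using mgraph_ends[OF mg eE] by metis
      then show thesis using that[of u w] that[of w u] e by (auto simp: cut_def)
    qed
    then have im: "{u, w} \<in> h ` E" using eE by (metis imageI)
    have "u = a \<and> w = x \<or> u = d \<and> w = y"
      using uw(2,3) im Nb Nc x(7) y(7) by blast
    then have "h e = h ga \<and> x \<notin> ?D \<or> h e = h gd \<and> y \<notin> ?D" using uw x y by auto
    then show ?thesis using inj_onD[OF inj] eE x(1) y(1) by blast
  qed
  have two: "2 \<le> card (cut h E X)" if "X \<subseteq> V" "a \<in> X" "card X \<le> 5" for X
  proof -
    have "X \<noteq> V" using that n by auto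
    then show ?thesis using G that unfolding cubic_2ec_def by blast
  qed
  have "x \<notin> ?D"
  proof
    assume "x \<in> ?D"
    then have "cut h E ?D \<subseteq> {gd}" using leaving by blast
    then have "card (cut h E ?D) \<le> 1" using card_mono[of "{gd}" "cut h E ?D"] by simp
    then show False using two[of ?D] DV cardD by simp
  qed
  moreover have "y \<notin> ?D"
  proof
    assume "y \<in> ?D"
    then have "cut h E ?D \<subseteq> {ga}" using leaving by blast
    then have "card (cut h E ?D) \<le> 1" using card_mono[of "{ga}" "cut h E ?D"] by simp
    then show False using two[of ?D] DV cardD by simp
  qed
  moreover have "x \<noteq> y"
  proof
    assume xy: "x = y"
    let ?X = "insert x ?D"
    have "card ?X \<le> 5" using cardD by (simp add: card_insert_if)
    then have "2 \<le> card (cut h E ?X)" using DV x(6) by (intro two) auto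
    moreover have "cut h E ?X \<subseteq> inc h E x - {ga, gd}"
    proof
      fix e assume e: "e \<in> cut h E ?X"
      then have eE: "e \<in> E" by (simp add: cut_def)
      have "e \<notin> {ga, gd}" using e x(2) y(2) by (auto simp: cut_def xy)
      then have "e \<notin> cut h E ?D" using leaving by blast
      moreover have "x \<in> h e" if "e \<in> cut h E (insert x D)" "e \<notin> cut h E D" for D
        using that unfolding cut_def by blast
      ultimately have "x \<in> h e" using e by blast
      then show "e \<in> inc h E x - {ga, gd}" using eE \<open>e \<notin> {ga, gd}\<close> by (simp add: inc_def)
    qed
    moreover have "card (inc h E x - {ga, gd}) = 1"
    proof -
      have "ga \<noteq> gd"
      proof
        assume "ga = gd"
        then have "{a, x} = {d, x}" using x(2) y(2) xy by simp
        then have "a = d" using x(5) by (metis doubleton_eq_iff)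
        then show False using dist by simp
      qed
      moreover have "{ga, gd} \<subseteq> inc h E x" using x(1,2) y(1,2) xy by (simp add: inc_def)
      moreover have "card (inc h E x) = 3" using G x(6) by (simp add: cubic_2ec_def)
      ultimately show ?thesis by (simp add: card_Diff_subset)
    qed
    ultimately show False
      using card_mono[of "inc h E x - {ga, gd}" "cut h E ?X"] fin by (simp add: inc_def)
  qed
  ultimately have "diamond V E h a b c d x y ga"
    using G inj dist edges x y Nb Nc unfolding diamond_def by blast
  then show thesis by (rule that)
qed

lemma even_mod_6: "even n \<Longrightarrow> n mod 6 = 0 \<or> n mod 6 = 2 \<or> n mod 6 = 4" for n :: nat
  by presburger

lemma mod_6_eq_4_ge_10: "6 \<le> n \<Longrightarrow> n mod 6 = 4 \<Longrightarrow> 10 \<le> n" for n :: nat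
  by presburger

lemma mod_6_round_down:
  fixes k n :: nat
  shows "6 * k \<le> n + 4 \<Longrightarrow> n mod 6 = 0 \<Longrightarrow> 6 * k \<le> n"
    and "6 * k \<le> n + 2 \<Longrightarrow> n mod 6 = 2 \<Longrightarrow> 6 * k \<le> n"
proof -
  have n: "n = 6 * (n div 6) + n mod 6" by simp
  {
    assume "6 * k \<le> n + 4" "n mod 6 = 0"
    then have "k \<le> n div 6" using n by linarith
    then show "6 * k \<le> n" using n by linarith
  next
    assume "6 * k \<le> n + 2" "n mod 6 = 2"
    then have "k \<le> n div 6" using n by linarith
    then show "6 * k \<le> n" using n by linarith
  }
qed

text \<open>For n = 6 q + 4 the second hypothesis of the first part rounds down to k' <= 8 q + 2,
  and 8 q + 5 still lies below 4 n / 3. In the second part 5 <= 16/3 suffices without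
  rounding.\<close>

lemma mod_6_reduction:
  fixes k k' n n' :: nat
  shows "k \<le> k' + 3 \<Longrightarrow> 3 * k' \<le> 4 * n' \<Longrightarrow> n' + 2 = n \<Longrightarrow> n mod 6 = 4 \<Longrightarrow> 3 * k \<le> 4 * n"
    and "k \<le> k' + 5 \<Longrightarrow> 3 * k' \<le> 4 * n' \<Longrightarrow> n' + 4 = n \<Longrightarrow> 3 * k \<le> 4 * n"
proof -
  assume *: "k \<le> k' + 3" "3 * k' \<le> 4 * n'" "n' + 2 = n" "n mod 6 = 4"
  define q where "q = n div 6"
  have n: "n = 6 * q + 4" using *(4) div_mult_mod_eq[of n 6] by (simp add: q_def)
  have "k \<le> 8 * q + 5" using *(1-3) n by linarith
  then show "3 * k \<le> 4 * n" using n by linarith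
qed linarith

theorem small_even_subgraph:
  assumes "cubic_2ec V E h" "inj_on h E" "6 \<le> card V"
  shows "\<exists>F. even_sub V E h F \<and> 3 * (card F + 2 * ncomp V h F) \<le> 4 * card V"
  using assms
proof (induction "card V" arbitrary: V E h rule: less_induct)
  case less
  note G = less.prems(1) and inj = less.prems(2) and n6 = less.prems(3)
  have mg: "mgraph V E h" using G by (simp add: cubic_2ec_def)
  have fin: "finite V" using mg by (simp add: mgraph_def)
  have evenV: "even (card V)" using cubic_card_even[OF G] by simp
  have mods: "card V mod 6 = 0 \<or> card V mod 6 = 2 \<or> card V mod 6 = 4" by (rule even_mod_6[OF evenV])
  have tf: ?case if "two_factor V E h F" "6 * ncomp V h F \<le> card V" for F
    using two_factor_short_enough[OF mg that] by blast
  show ?case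
  proof (cases "\<exists>a b c. cyc3 (h ` E) a b c")
    case True
    then obtain a b c where abc: "cyc3 (h ` E) a b c" by blast
    then obtain t1 t2 t3 where T: "triangle V E h a b c t1 t2 t3" using triangle_exists[OF G abc] n6 by auto
    interpret T: triangle V E h a b c t1 t2 t3 by (rule T)
    show ?thesis
      using mods
    proof (elim disjE)
      assume 1: "card V mod 6 = 0"
      obtain F where F: "two_factor V E h F" "6 * ncomp V h F \<le> card V + 4" by (rule two_factor_exists[OF G])
      show ?thesis by (rule tf[OF F(1) mod_6_round_down(1)[OF F(2) 1]])
    next
      assume 2: "card V mod 6 = 2"
      obtain F' where F': "two_factor T.V3 T.E3 T.h3 F'" "6 * ncomp T.V3 T.h3 F' \<le> card T.V3 + 4"
        by (rule two_factor_exists[OF T.contracted_cubic_2ec])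
      obtain F where F: "two_factor V E h F" "ncomp V h F \<le> ncomp T.V3 T.h3 F'"
        by (rule T.two_factor_lift_triangle[OF F'(1)])
      have *: "6 * ncomp V h F \<le> card V + 2" using F(2) F'(2) T.card_V3 by simp
      show ?thesis by (rule tf[OF F(1) mod_6_round_down(2)[OF * 2]])
    next
      assume 3: "card V mod 6 = 4"
      show ?thesis
      proof (cases "\<exists>u v w. u \<in> T.T \<and> v \<in> T.T \<and> u \<noteq> v \<and> w \<notin> T.T \<and> {u, w} \<in> h ` E \<and> {v, w} \<in> h ` E")
        case True
        then obtain u v w where uvw: "u \<in> T.T" "v \<in> T.T" "u \<noteq> v" "w \<notin> T.T" "{u, w} \<in> h ` E" "{v, w} \<in> h ` E"
          by blast
        have tri: "{i, j} \<in> h ` E" if "i \<in> T.T" "j \<in> T.T" "i \<noteq> j" for i j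
          using that abc by (auto simp: T.T_def cyc3_def insert_commute)
        have "card (T.T - {u, v}) = 1" using uvw T.TV(4) by (simp add: card_Diff_subset)
        then obtain s where "T.T - {u, v} = {s}" by (meson card_1_singletonE)
        then have s: "s \<in> T.T" "s \<noteq> u" "s \<noteq> v" by auto
        \<comment> \<open>Together with the third corner \<open>s\<close>, the corners
          \<open>u\<close>, \<open>v\<close> and their common outside neighbour \<open>w\<close>
          form a diamond.\<close>
        have "distinct [s, u, v, w]" using uvw s by auto
        then obtain x y ga where D: "diamond V E h s u v w x y ga"
          using diamond_exists[OF G inj n6, of s u v w] tri uvw s by metis
        show ?thesis by (rule diamond.diamond_even_sub[OF D 3])
      next
        case False
        have "inj_on T.h3 T.E3" using False by (intro T.h3_inj_on[OF inj]) blast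
        \<comment> \<open>This keeps the contracted graph, with n - 2 vertices, within the range of
          the induction.\<close>
        moreover have "10 \<le> card V" by (rule mod_6_eq_4_ge_10[OF n6 3])
        ultimately obtain F' where F': "even_sub T.V3 T.E3 T.h3 F'"
          "3 * (card F' + 2 * ncomp T.V3 T.h3 F') \<le> 4 * card T.V3"
          using less.hyps[OF _ T.contracted_cubic_2ec] T.card_V3 by auto
        obtain F where F: "even_sub V E h F" "card F + 2 * ncomp V h F \<le> card F' + 2 * ncomp T.V3 T.h3 F' + 3"
          using T.even_sub_triangle_lift[OF F'(1)] by blast
        from mod_6_reduction(1)[OF F(2) F'(2) T.card_V3 3] show ?thesis using F(1) by blast
      qed
    qed
  next
    case no3: False
    show ?thesis
    proof (cases "\<exists>a b c d. cyc4 (h ` E) a b c d")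
      case True
      then obtain a b c d where abcd: "cyc4 (h ` E) a b c d" by blast
      show ?thesis
        using mods
      proof (elim disjE)
        assume 1: "card V mod 6 = 0"
        obtain F where F: "two_factor V E h F" "6 * ncomp V h F \<le> card V + 4" by (rule two_factor_exists[OF G])
        show ?thesis by (rule tf[OF F(1) mod_6_round_down(1)[OF F(2) 1]])
      next
        assume 2: "card V mod 6 = 2"
        have nt: "{x, y, z} \<inter> {a, b, c, d} = {}" if "cyc3 (h ` E) x y z" for x y z using no3 that by blast
        obtain p1 p2 p3 p4 q1 q2 q3 q4 e12 e23 e34 e41 g1 g2 g3 g4 where
          S: "square V E h p1 p2 p3 p4 q1 q2 q3 q4 e12 e23 e34 e41 g1 g2 g3 g4"
          and ne: "q1 \<noteq> q2" "q3 \<noteq> q4"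
          and good: "\<not> joined V E h {p1, p2, p3, p4} q1 q2" "\<not> joined V E h {p1, p2, p3, p4} q3 q4"
          using good_square_exists[OF G inj abcd nt] by metis
        interpret S: square V E h p1 p2 p3 p4 q1 q2 q3 q4 e12 e23 e34 e41 g1 g2 g3 g4 by (rule S)
        have G4: "cubic_2ec (V - S.P) S.E4 S.h4"
          using S.replaced_cubic_2ec[OF ne] good S.bad_iff by metis
        have g1: "g1 \<in> S.E4" by (simp add: S.E4_def)
        obtain F' where F': "two_factor (V - S.P) S.E4 S.h4 F'"
          "6 * ncomp (V - S.P) S.h4 F' + 6 * 1 * of_bool (g1 \<notin> F') \<le> card (V - S.P) + 4 + 2 * 1"
          by (rule two_factor_exists_penalty[OF G4 g1, of 1])
        have "mgraph (V - S.P) S.E4 S.h4" using G4 by (simp add: cubic_2ec_def)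
        then obtain F where F: "two_factor V E h F"
          "ncomp V h F \<le> ncomp (V - S.P) S.h4 F' + of_bool (g1 \<notin> F' \<and> g3 \<notin> F')"
          using S.two_factor_lift[OF ne _ F'(1)] by blast
        \<comment> \<open>The square is added as a cycle only if \<open>F'\<close> avoids both
          \<open>g1\<close> and \<open>g3\<close>, so a penalty on \<open>g1\<close> alone covers
          it.\<close>
        have "6 * ncomp V h F \<le> 6 * ncomp (V - S.P) S.h4 F' + 6 * of_bool (g1 \<notin> F')"
          using F(2) by (cases "g1 \<in> F'"; cases "g3 \<in> F'") auto
        then have *: "6 * ncomp V h F \<le> card V + 2" using F'(2) S.card_outside by simp
        show ?thesis by (rule tf[OF F(1) mod_6_round_down(2)[OF * 2]])
      next
        assume 3: "card V mod 6 = 4"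
        have nt: "\<not> cyc3 (h ` E) x y z" for x y z using no3 by blast
        obtain p1 p2 p3 p4 q1 q2 q3 q4 e12 e23 e34 e41 g1 g2 g3 g4 where
          S: "square V E h p1 p2 p3 p4 q1 q2 q3 q4 e12 e23 e34 e41 g1 g2 g3 g4"
          and ne: "q1 \<noteq> q2" "q3 \<noteq> q4"
          and good: "\<And>X. X \<subseteq> V \<Longrightarrow> p1 \<in> X \<Longrightarrow> p2 \<in> X \<Longrightarrow> p3 \<notin> X \<Longrightarrow> p4 \<notin> X \<Longrightarrow> 3 \<le> card (cut h E X)"
          using good_pinch_exists[OF G inj abcd nt] by blast
        interpret S: square V E h p1 p2 p3 p4 q1 q2 q3 q4 e12 e23 e34 e41 g1 g2 g3 g4 by (rule S)
        have G2: "cubic_2ec S.V2 S.E2 S.h2" using good by (rule S.pinch_cubic_2ec)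
        have "inj_on S.h2 S.E2" by (rule S.h2_inj_on[OF inj ne])
        moreover have "10 \<le> card V" by (rule mod_6_eq_4_ge_10[OF n6 3])
        ultimately obtain F' where F': "even_sub S.V2 S.E2 S.h2 F'"
          "3 * (card F' + 2 * ncomp S.V2 S.h2 F') \<le> 4 * card S.V2"
          using less.hyps[OF _ G2] S.card_V2 by auto
        have "mgraph S.V2 S.E2 S.h2" using G2 by (simp add: cubic_2ec_def)
        then obtain F where F: "even_sub V E h F" "card F + 2 * ncomp V h F \<le> card F' + 2 * ncomp S.V2 S.h2 F' + 3"
          using S.even_sub_pinch_lift[OF _ F'(1)] by blast
        from mod_6_reduction(1)[OF F(2) F'(2) S.card_V2 3] show ?thesis using F(1) by blast
      qed
    next
      case no4: False
      show ?thesis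
      proof (cases "\<exists>a b c d f. cyc5 (h ` E) a b c d f")
        case True
        then obtain a b c d f where abcdf: "cyc5 (h ` E) a b c d f" by blast
        have nt: "{x, y, z} \<inter> {a, b, c, d, f} = {}" if "cyc3 (h ` E) x y z" for x y z using no3 that by blast
        have nq: "{x, y, z, w} \<inter> {a, b, c, d, f} = {}" if "cyc4 (h ` E) x y z w" for x y z w using no4 that by blast
        obtain p1 p2 p3 p4 p5 q1 q2 q3 q4 q5 e12 e23 e34 e45 e51 g1 g2 g3 g4 g5 where
          S: "pentagon V E h p1 p2 p3 p4 p5 q1 q2 q3 q4 q5 e12 e23 e34 e45 e51 g1 g2 g3 g4 g5"
          and good: "\<not> joined V E h {p1, p2, p3, p4, p5} q1 q2"
          using good_pentagon_exists[OF G inj abcdf nt nq] by metis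
        interpret S: pentagon V E h p1 p2 p3 p4 p5 q1 q2 q3 q4 q5 e12 e23 e34 e45 e51 g1 g2 g3 g4 g5 by (rule S)
        have G5: "cubic_2ec S.V5 S.E5 S.h5"
          using good by (intro S.pentagon_reduced_cubic_2ec) (auto simp: S.bad_def S.P_def joined_def)
        \<comment> \<open>An edge between \<open>q1\<close> and \<open>q2\<close> would close a
          4-cycle with \<open>p1\<close> and \<open>p2\<close>, so the new edge is not parallel to
          an old one.\<close>
        have "h e \<noteq> {q1, q2}" if e: "e \<in> E" for e
        proof
          assume "h e = {q1, q2}"
          then have "{q1, q2} \<in> h ` E" using e by (metis imageI)
          moreover have "{p1, p2} \<in> h ` E" "{p2, q2} \<in> h ` E" "{p1, q1} \<in> h ` E"
            using S.ends S.inE by (metis imageI insert_subset)+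
          ultimately have "cyc4 (h ` E) p1 p2 q2 q1" by (simp add: cyc4_def insert_commute)
          then show False using no4 by blast
        qed
        then have inj5: "inj_on S.h5 S.E5" by (rule S.h5_inj_on[OF inj])
        \<comment> \<open>The pentagon and its outer neighbours are ten different vertices, so at
          least six remain after the reduction.\<close>
        have "card {p1, p2, p3, p4, p5, q1, q2, q3, q4, q5} \<le> card V"
          using S.p_in S.q_in fin by (intro card_mono) auto
        moreover have "card {p1, p2, p3, p4, p5, q1, q2, q3, q4, q5} = 10" by simp
        ultimately have "10 \<le> card V" by simp
        then obtain F' where F': "even_sub S.V5 S.E5 S.h5 F'"
          "3 * (card F' + 2 * ncomp S.V5 S.h5 F') \<le> 4 * card S.V5"
          using less.hyps[OF _ G5 inj5] S.card_V5 by auto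
        have "mgraph S.V5 S.E5 S.h5" using G5 by (simp add: cubic_2ec_def)
        then obtain F where F: "even_sub V E h F" "card F + 2 * ncomp V h F \<le> card F' + 2 * ncomp S.V5 S.h5 F' + 5"
          using S.even_sub_pentagon_lift[OF _ F'(1)] by blast
        from mod_6_reduction(2)[OF F(2) F'(2) S.card_V5] show ?thesis using F(1) by blast
      next
        case no5: False
        obtain F where F: "two_factor V E h F" by (rule two_factor_exists[OF G])
        have "mgraph V F h" using F mg mgraph_subset by (auto simp: two_factor_def)
        moreover have "6 \<le> card (component h F v)" if "v \<in> V" for v
          using short_cycle_or_large_component[OF mg inj F that] no3 no4 no5 by metis
        ultimately have "6 * ncomp V h F \<le> card V" by (rule large_components_few)
        then show ?thesis by (rule tf[OF F])
      qed
    qed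
  qed
qed

subsection \<open>Eulerian multigraphs and tours\<close>

text \<open>Leaving out the class of \<open>b\<close> loses a class before the insertion but none
  afterwards, since \<open>a\<close> then represents it.\<close>

lemma ncomp_insert_joining_edge:
  assumes "finite V" "h e = {a, b}" "a \<in> V" "b \<in> V" "(a, b) \<notin> (adj h F)\<^sup>*"
  shows "ncomp V h (insert e F) < ncomp V h F"
proof -
  define S where "S = {s \<in> V. (s, b) \<notin> (adj h F)\<^sup>*}"
  have fin: "finite S" using assms(1) by (simp add: S_def)
  have aS: "a \<in> S" using assms by (simp add: S_def)
  have mono: "(u, v) \<in> (adj h (insert e F))\<^sup>*" if "(u, v) \<in> (adj h F)\<^sup>*" for u v
    using that by (rule conn_mono[rotated]) blast
  have "component h (insert e F) s \<in> component h (insert e F) ` S" if "s \<in> V" for s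
  proof (cases "s \<in> S")
    case False
    then have "(s, b) \<in> (adj h (insert e F))\<^sup>*" using that by (auto simp: S_def intro: mono)
    moreover have "(b, a) \<in> (adj h (insert e F))\<^sup>*"
      using assms(2) by (intro conn_edge[of e]) auto
    ultimately have "component h (insert e F) s = component h (insert e F) a"
      by (metis component_eq_iff rtrancl_trans)
    then show ?thesis using aS by blast
  qed simp
  then have "component h (insert e F) ` V \<subseteq> component h (insert e F) ` S" by blast
  then have "ncomp V h (insert e F) \<le> card (component h (insert e F) ` S)"
    unfolding ncomp_def using fin by (intro card_mono) auto
  also have "\<dots> \<le> card (component h F ` S)"
    using fin by (rule card_image_factor) (auto simp: component_eq_iff intro: mono)
  also have "\<dots> < ncomp V h F"
    unfolding ncomp_def
  proof (rule psubset_card_mono)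
    show "finite (component h F ` V)" using assms(1) by simp
    have "component h F b \<notin> component h F ` S" by (auto simp: S_def component_eq_iff intro: conn_sym)
    then show "component h F ` S \<subset> component h F ` V" using assms(4) by (auto simp: S_def)
  qed
  finally show ?thesis .
qed

text \<open>In effect \<open>T\<close> is a spanning tree of the graph obtained by contracting the
  components of \<open>F\<close>, grown edge by edge. Being disjoint from \<open>F\<close>, its
  doubled edges stay separate from those of \<open>F\<close>.\<close>

lemma connecting_edges:
  assumes "mgraph V E h" "\<And>u v. u \<in> V \<Longrightarrow> v \<in> V \<Longrightarrow> (u, v) \<in> (adj h E)\<^sup>*" "F \<subseteq> E" "V \<noteq> {}"
  shows "\<exists>T. T \<subseteq> E \<and> T \<inter> F = {} \<and> card T < ncomp V h F \<and>
    (\<forall>u\<in>V. \<forall>v\<in>V. (u, v) \<in> (adj h (F \<union> T))\<^sup>*)"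
  using assms(3)
proof (induction "ncomp V h F" arbitrary: F rule: less_induct)
  case less
  have fin: "finite V" "finite E" using assms(1) by (auto simp: mgraph_def)
  show ?case
  proof (cases "\<forall>u\<in>V. \<forall>v\<in>V. (u, v) \<in> (adj h F)\<^sup>*")
    case True
    have "0 < ncomp V h F" using fin assms(4) by (simp add: ncomp_def card_gt_0_iff)
    then show ?thesis using True by (intro exI[of _ "{}"]) auto
  next
    case False
    then obtain u v where uv: "u \<in> V" "v \<in> V" "(u, v) \<notin> (adj h F)\<^sup>*" by blast
    have "\<exists>e\<in>E. \<exists>a b. h e = {a, b} \<and> (a, b) \<notin> (adj h F)\<^sup>*"
    proof (rule ccontr)
      assume "\<not> ?thesis"
      then have "adj h E \<subseteq> (adj h F)\<^sup>*" by (auto simp: adj_def)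
      then have "(adj h E)\<^sup>* \<subseteq> (adj h F)\<^sup>*" by (rule rtrancl_subset_rtrancl)
      then show False using assms(2)[OF uv(1,2)] uv(3) by blast
    qed
    then obtain e a b where e: "e \<in> E" "h e = {a, b}" "(a, b) \<notin> (adj h F)\<^sup>*" by blast
    have ab: "a \<in> V" "b \<in> V" using e assms(1) by (auto simp: mgraph_def)
    have "e \<notin> F" using e conn_edge by metis
    note less_comp = ncomp_insert_joining_edge[where F = F, OF fin(1) e(2) ab e(3)]
    have "insert e F \<subseteq> E" using e less.prems by simp
    then obtain T where T: "T \<subseteq> E" "T \<inter> insert e F = {}" "card T < ncomp V h (insert e F)"
      "\<forall>u\<in>V. \<forall>v\<in>V. (u, v) \<in> (adj h (insert e F \<union> T))\<^sup>*"
      using less.hyps[OF less_comp] by blast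
    have "card (insert e T) < ncomp V h F"
      using T less_comp fin finite_subset[OF T(1)] by auto
    moreover have "F \<union> insert e T = insert e F \<union> T" by blast
    ultimately show ?thesis using T e(1) \<open>e \<notin> F\<close> by (intro exI[of _ "insert e T"]) auto
  qed
qed

section \<open>Closed trails through all vertices\<close>

fun walk :: "('e \<Rightarrow> 'v set) \<Rightarrow> 'v \<Rightarrow> ('e \<times> 'v) list \<Rightarrow> bool" where
  "walk k u [] = True" |
  "walk k u ((e, w) # s) = (k e = {u, w} \<and> walk k w s)"

definition walk_end :: "'v \<Rightarrow> ('e \<times> 'v) list \<Rightarrow> 'v" where
  "walk_end u s = last (u # map snd s)"

lemma walk_end_simps [simp]: "walk_end u [] = u" "walk_end u (s @ [x]) = snd x"
  "walk_end u (x # s) = walk_end (snd x) s"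
  by (auto simp: walk_end_def)

lemma walk_end_append: "walk_end u (s @ t) = walk_end (walk_end u s) t"
  by (induction s arbitrary: u) auto

lemma walk_append: "walk k u (s @ t) \<longleftrightarrow> walk k u s \<and> walk k (walk_end u s) t"
  by (induction k u s rule: walk.induct) auto

text \<open>Each step flips the degree parity at both of its ends, so the flips cancel everywhere
  except at the two ends of the trail.\<close>

lemma walk_parity:
  assumes "walk k u s" "distinct (map fst s)" "\<And>e. e \<in> fst ` set s \<Longrightarrow> card (k e) = 2"
  shows "even (card (inc k (fst ` set s) x)) \<longleftrightarrow> (x = u \<longleftrightarrow> x = walk_end u s)"
  using assms
proof (induction k u s rule: walk.induct)
  case (1 k u)
  then show ?case by (simp add: inc_def)
next
  case (2 k u e w s)
  have IH: "even (card (inc k (fst ` set s) x)) \<longleftrightarrow> (x = w \<longleftrightarrow> x = walk_end w s)"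
    using 2 by simp
  have uw: "u \<noteq> w" "k e = {u, w}" using "2.prems"(1) "2.prems"(3)[of e] by auto
  have new: "e \<notin> fst ` set s" using "2.prems"(2) by simp
  have "inc k (fst ` set ((e, w) # s)) x =
    (if x = u \<or> x = w then insert e (inc k (fst ` set s) x) else inc k (fst ` set s) x)"
    using uw by (auto simp: inc_def)
  moreover have "finite (inc k (fst ` set s) x)" "e \<notin> inc k (fst ` set s) x"
    using new by (auto simp: inc_def)
  ultimately show ?case using IH uw(1) by auto
qed

text \<open>A longest trail works. If it were open, parity would leave a further edge at its last
  vertex. If it were closed but missed a vertex, some edge would join it to the outside, and
  rotating the trail would allow that edge to be prepended.\<close>

theorem closed_covering_walk:
  assumes mg: "mgraph V A k" and "V \<noteq> {}"
    and conn: "\<And>u v. u \<in> V \<Longrightarrow> v \<in> V \<Longrightarrow> (u, v) \<in> (adj k A)\<^sup>*"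
    and even: "\<And>v. v \<in> V \<Longrightarrow> even (card (inc k A v))"
  obtains u s where "walk k u s" "walk_end u s = u" "fst ` set s \<subseteq> A" "insert u (snd ` set s) = V"
    "length s \<le> card A"
proof -
  have fin: "finite A" using mg by (simp add: mgraph_def)
  define trail where "trail u s \<longleftrightarrow> u \<in> V \<and> walk k u s \<and> distinct (map fst s) \<and> fst ` set s \<subseteq> A" for u s
  have len: "length s \<le> card A" if "trail u s" for u s
    using that card_mono[OF fin, of "fst ` set s"] distinct_card[of "map fst s"] by (simp add: trail_def)
  obtain u0 where "u0 \<in> V" using assms(2) by blast
  then have "trail u0 []" by (simp add: trail_def)
  \<comment> \<open>Start and edge list are paired in order to maximise over both;
    \<open>Suc (card A)\<close> serves as a strict upper bound for the lengths.\<close>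
  then have "\<exists>us. trail (fst us) (snd us) \<and> (\<forall>vt. trail (fst vt) (snd vt) \<longrightarrow> length (snd vt) \<le> length (snd us))"
    using len by (intro ex_has_greatest_nat[where b = "Suc (card A)" and k = "(u0, [])"]) (auto simp: less_Suc_eq_le)
  then obtain u s where us: "trail u s" and max: "\<And>v t. trail v t \<Longrightarrow> length t \<le> length s"
    by fastforce
  have s: "u \<in> V" "walk k u s" "distinct (map fst s)" "fst ` set s \<subseteq> A"
    using us by (auto simp: trail_def)
  have two: "card (k e) = 2" "k e \<subseteq> V" if "e \<in> A" for e using mg that by (auto simp: mgraph_def)
  have inV: "snd ` set s \<subseteq> V"
    using s(2,4)
  proof (induction s arbitrary: u)
    case (Cons x s)
    then show ?case using two(2)[of "fst x"] by (cases x) force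
  qed simp
  have endV: "walk_end u s \<in> V" using s(1) inV by (cases s rule: rev_cases) auto
  have closed: "walk_end u s = u"
  proof (rule ccontr)
    assume open_end: "walk_end u s \<noteq> u"
    let ?z = "walk_end u s"
    have "odd (card (inc k (fst ` set s) ?z))"
      using walk_parity[OF s(2,3), of ?z] two s(4) open_end by blast
    then have "inc k (fst ` set s) ?z \<noteq> inc k A ?z" using even[OF endV] by metis
    then obtain e where e: "e \<in> A" "?z \<in> k e" "e \<notin> fst ` set s" using s(4) by (auto simp: inc_def)
    obtain w where w: "k e = {?z, w}" by (rule mgraph_other_end[OF mg e(1,2)])
    have "trail u (s @ [(e, w)])" using s e w by (auto simp: trail_def walk_append)
    then show False using max by fastforce
  qed
  have "insert u (snd ` set s) = V"
  proof (rule ccontr)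
    assume "insert u (snd ` set s) \<noteq> V"
    then obtain v where v: "v \<in> V" "v \<notin> insert u (snd ` set s)" using inV s(1) by blast
    let ?S = "insert u (snd ` set s)"
    have "\<exists>e\<in>A. \<exists>x y. k e = {x, y} \<and> x \<in> ?S \<and> y \<notin> ?S"
    proof (rule ccontr)
      assume "\<not> ?thesis"
      then have "component k A u \<subseteq> ?S" by (intro component_closed) blast+
      then show False using conn[OF s(1) v(1)] v(2) unfolding in_component_iff[symmetric] by blast
    qed
    then obtain e x y where e: "e \<in> A" "k e = {x, y}" "x \<in> ?S" "y \<notin> ?S" by blast
    have ends_in: "k e' \<subseteq> insert u' (snd ` set s')" if "walk k u' s'" "e' \<in> fst ` set s'" for e' u' s'
      using that by (induction k u' s' rule: walk.induct) auto
    have new: "e \<notin> fst ` set s" using ends_in[OF s(2)] e by blast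
    have yV: "y \<in> V" using two(2)[OF e(1)] e(2) by simp
    \<comment> \<open>\<open>t\<close> is the closed trail rotated so that it starts at
      \<open>x\<close>; prepending the step from \<open>y\<close> along \<open>e\<close> then gives
      a longer trail.\<close>
    obtain t where t: "walk k x t" "distinct (map fst t)" "set t = set s" "length t = length s"
    proof (cases "x = u")
      case True
      then show ?thesis using that s by blast
    next
      case False
      then obtain p where "p \<in> set s" "snd p = x" using e(3) by auto
      then obtain a b where ab: "s = a @ p # b" by (meson split_list)
      have "walk k x (b @ a @ [p])"
        using s(2) closed \<open>snd p = x\<close> unfolding ab
        by (cases p) (auto simp: walk_append walk_end_append)
      then show ?thesis using that[of "b @ a @ [p]"] s(3) unfolding ab by auto
    qed
    have "trail y ((e, x) # t)"
      using t e s(4) new yV by (auto simp: trail_def insert_commute)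
    then show False using max t(4) by fastforce
  qed
  then show thesis using that closed s len[OF us] by blast
qed

section \<open>Paths, distances and cuts in the simple graph\<close>

lemma simple_graph_mgraph: "simple_graph V E \<Longrightarrow> mgraph V E id"
  by (auto simp: simple_graph_def mgraph_def intro: finite_subset[of E "Pow V"])

text \<open>Cutting out the segment between two occurrences of a vertex shortens the walk. This
  turns concatenated walks into the repetition-free lists that \<open>path_between\<close>
  demands.\<close>

lemma successively_distinct:
  assumes "p \<noteq> []" "successively R p"
  shows "\<exists>q. q \<noteq> [] \<and> hd q = hd p \<and> last q = last p \<and> set q \<subseteq> set p \<and> distinct q \<and>
    successively R q \<and> length q \<le> length p"
  using assms
proof (induction "length p" arbitrary: p rule: less_induct)
  case less
  show ?case
  proof (cases "distinct p")
    case True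
    then show ?thesis using less.prems by blast
  next
    case False
    then obtain xs ys zs y where p: "p = xs @ [y] @ ys @ [y] @ zs"
      using not_distinct_decomp by blast
    let ?p = "xs @ [y] @ zs"
    have "successively R ?p"
      using less.prems(2) unfolding p by (auto simp: successively_append_iff successively_Cons)
    moreover have "length ?p < length p" "?p \<noteq> []" by (simp_all add: p)
    ultimately obtain q where q: "q \<noteq> []" "hd q = hd ?p" "last q = last ?p" "set q \<subseteq> set ?p" "distinct q"
      "successively R q" "length q \<le> length ?p"
      using less.hyps by blast
    moreover have "hd ?p = hd p" "last ?p = last p" by (simp_all add: p hd_append)
    moreover have "set ?p \<subseteq> set p" by (auto simp: p)
    ultimately show ?thesis using \<open>length ?p < length p\<close> by (intro exI[of _ q]) auto
  qed
qed

lemma path_between_shortcut: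
  assumes "p \<noteq> []" "successively (\<lambda>x y. {x, y} \<in> E) p" "set p \<subseteq> V"
  shows "\<exists>q. path_between V E (hd p) (last p) q \<and> length q \<le> length p"
  using successively_distinct[OF assms(1,2)] assms(3) unfolding path_between_def by blast

lemma graph_dist_le:
  assumes "p \<noteq> []" "successively (\<lambda>x y. {x, y} \<in> E) p" "set p \<subseteq> V"
  shows "graph_dist V E (hd p) (last p) \<le> length p - 1"
proof -
  obtain q where q: "path_between V E (hd p) (last p) q" "length q \<le> length p"
    using path_between_shortcut[OF assms] by blast
  have "graph_dist V E (hd p) (last p) \<le> length q - 1"
    unfolding graph_dist_def using q(1) by (intro Least_le) blast
  then show ?thesis using q(2) by simp
qed

lemma graph_dist_path:
  assumes "connected_graph V E" "u \<in> V" "v \<in> V"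
  obtains p where "path_between V E u v p" "graph_dist V E u v = length p - 1"
proof -
  have "\<exists>k p. path_between V E u v p \<and> k = length p - 1"
    using assms by (auto simp: connected_graph_def)
  from LeastI_ex[OF this] show thesis using that unfolding graph_dist_def by blast
qed

lemma graph_dist_triangle:
  assumes "connected_graph V E" "u \<in> V" "v \<in> V" "w \<in> V"
  shows "graph_dist V E u w \<le> graph_dist V E u v + graph_dist V E v w"
proof -
  obtain p where p: "path_between V E u v p" "graph_dist V E u v = length p - 1"
    using graph_dist_path[OF assms(1-3)] .
  obtain q where q: "path_between V E v w q" "graph_dist V E v w = length q - 1"
    using graph_dist_path[OF assms(1,3,4)] .
  obtain q' where q': "q = v # q'" using q(1) by (cases q) (auto simp: path_between_def)
  have "successively (\<lambda>x y. {x, y} \<in> E) (p @ q')"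
    using p(1) q(1) by (cases q') (auto simp: path_between_def q' successively_append_iff)
  moreover have "hd (p @ q') = u" "last (p @ q') = w" "p @ q' \<noteq> []" "set (p @ q') \<subseteq> V"
    using p(1) q(1) by (cases q'; auto simp: path_between_def q')+
  ultimately have "graph_dist V E u w \<le> length (p @ q') - 1" using graph_dist_le by metis
  then show ?thesis using p q by (cases p) (auto simp: path_between_def q')
qed

lemma graph_dist_edge:
  assumes "{u, v} \<in> E" "u \<in> V" "v \<in> V"
  shows "graph_dist V E u v \<le> 1"
  using graph_dist_le[of "[u, v]" E V] assms by simp

lemma connected_graph_iff:
  assumes "mgraph V E id"
  shows "connected_graph V E \<longleftrightarrow> V \<noteq> {} \<and> (\<forall>u\<in>V. \<forall>v\<in>V. (u, v) \<in> (adj id E)\<^sup>*)"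
proof -
  have walk_conn: "(hd p, last p) \<in> (adj id E)\<^sup>*" if "p \<noteq> []" "successively (\<lambda>x y. {x, y} \<in> E) p" for p
    using that
  proof (induction p rule: list_nonempty_induct)
    case (cons x xs)
    then have "(x, hd xs) \<in> adj id E" by (auto simp: adj_def successively_Cons)
    moreover have "(hd xs, last xs) \<in> (adj id E)\<^sup>*"
      using cons.prems cons.hyps by (intro cons.IH) (simp add: successively_Cons)
    ultimately show ?case using cons.hyps by (metis converse_rtrancl_into_rtrancl last_ConsR list.sel(1))
  qed simp
  have "\<exists>p. path_between V E u v p" if uv: "(u, v) \<in> (adj id E)\<^sup>*" "u \<in> V" for u v
  proof -
    have "\<exists>p. p \<noteq> [] \<and> hd p = u \<and> last p = v \<and> set p \<subseteq> V \<and> successively (\<lambda>x y. {x, y} \<in> E) p"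
      using uv(1)
    proof (induction rule: rtrancl_induct)
      case base
      then show ?case using uv(2) by (intro exI[of _ "[u]"]) simp
    next
      case (step y z)
      then obtain p where p: "p \<noteq> []" "hd p = u" "last p = y" "set p \<subseteq> V" "successively (\<lambda>x y. {x, y} \<in> E) p"
        by blast
      have yz: "{y, z} \<in> E" using step.hyps(2) by (auto simp: adj_def)
      then have "z \<in> V" using assms by (auto simp: mgraph_def)
      then show ?case using p yz by (intro exI[of _ "p @ [z]"]) (auto simp: successively_append_iff)
    qed
    then show ?thesis using path_between_shortcut by metis
  qed
  moreover have "(u, v) \<in> (adj id E)\<^sup>*" if "path_between V E u v p" for u v p
    using that walk_conn[of p] by (auto simp: path_between_def)
  ultimately show ?thesis unfolding connected_graph_def by blast
qed

text \<open>If the cut of \<open>X\<close> had at most one edge, removing that edge would separate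
  \<open>X\<close> from the rest, contradicting bridgelessness.\<close>

lemma cubic_bridgeless_cubic_2ec:
  assumes "simple_graph V E" "connected_graph V E" "bridgeless V E" "cubic V E"
  shows "cubic_2ec V E id"
proof -
  have mg: "mgraph V E id" using assms(1) by (rule simple_graph_mgraph)
  have "2 \<le> card (cut id E X)" if X: "X \<subseteq> V" "X \<noteq> {}" "X \<noteq> V" for X
  proof (rule ccontr)
    assume small: "\<not> 2 \<le> card (cut id E X)"
    have fin: "finite (cut id E X)" using mg by (auto simp: mgraph_def cut_def)
    obtain e where e: "cut id E X \<subseteq> {e}"
    proof (cases "cut id E X = {}")
      case False
      then have "card (cut id E X) \<noteq> 0" using fin by simp
      then have "card (cut id E X) = 1" using small by linarith
      then show ?thesis using that by (metis card_1_singletonE subset_refl)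
    qed (use that in blast)
    \<comment> \<open>For an empty cut \<open>e\<close> is arbitrary; if it lies outside
      \<open>E\<close>, nothing is removed and connectedness of the graph itself is used.\<close>
    have "connected_graph V (E - {e})"
      using assms(2,3) by (cases "e \<in> E") (auto simp: bridgeless_def bridge_def)
    moreover have "mgraph V (E - {e}) id" using mg by (rule mgraph_subset) blast
    ultimately have conn: "(u, v) \<in> (adj id (E - {e}))\<^sup>*" if "u \<in> V" "v \<in> V" for u v
      using that connected_graph_iff by metis
    obtain u v where uv: "u \<in> X" "v \<in> V - X" using X by blast
    have "component id (E - {e}) u \<subseteq> X"
    proof (rule component_closed[OF uv(1)])
      fix f x y assume f: "f \<in> E - {e}" "id f = {x, y}" "x \<in> X"
      then have "f \<notin> cut id E X" using e by blast
      then show "y \<in> X" using f by (auto simp: cut_def)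
    qed
    moreover have "v \<in> component id (E - {e}) u" using conn[of u v] uv X(1) by (auto simp: in_component_iff)
    ultimately show False using uv(2) by blast
  qed
  moreover have "V \<noteq> {}" using assms(2) by (simp add: connected_graph_def)
  moreover have "card (inc id E v) = 3" if "v \<in> V" for v
    using assms(4) that by (simp add: cubic_def degree_def inc_def)
  ultimately show ?thesis using mg by (simp add: cubic_2ec_def)
qed

section \<open>Shortcutting a closed walk to a tour\<close>

fun walk_length :: "('v \<Rightarrow> 'v \<Rightarrow> nat) \<Rightarrow> 'v \<Rightarrow> 'v list \<Rightarrow> nat" where
  "walk_length d x [] = 0" |
  "walk_length d x (z # zs) = d x z + walk_length d z zs"

text \<open>By the triangle inequality, skipping a vertex does not lengthen the walk. As
  \<open>remdups\<close> keeps last occurrences, the final vertex, where the walk closes,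
  survives.\<close>

lemma walk_length_remdups:
  assumes "\<And>x y z. x \<in> V \<Longrightarrow> y \<in> V \<Longrightarrow> z \<in> V \<Longrightarrow> d x z \<le> d x y + d y z" "x \<in> V" "set zs \<subseteq> V"
  shows "walk_length d x (remdups zs) \<le> walk_length d x zs"
  using assms(2,3)
proof (induction zs arbitrary: x)
  case (Cons z zs)
  have IH: "walk_length d y (remdups zs) \<le> walk_length d y zs" if "y \<in> V" for y
    using that Cons by simp
  show ?case
  proof (cases "z \<in> set zs")
    case True
    then obtain a as where zs: "zs = a # as" by (cases zs) auto
    have "walk_length d x zs \<le> d x z + walk_length d z zs"
      using assms(1)[of x z a] Cons.prems by (simp add: zs)
    then show ?thesis using IH[of x] True Cons.prems by simp
  next
    case False
    then show ?thesis using IH[of z] Cons.prems by simp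
  qed
qed simp

lemma last_remdups_eq: "last (remdups xs) = last xs"
  by (induction xs) auto

lemma walk_length_conv_sum: "walk_length d x zs = (\<Sum>i<length zs. d ((x # zs) ! i) (zs ! i))"
  by (induction zs arbitrary: x) (simp_all add: sum.lessThan_Suc_shift del: sum.lessThan_Suc)

text \<open>Starting at \<open>last c\<close> counts the closing edge of the cycle first, which
  turns the cyclic sum into that of an ordinary walk.\<close>

lemma tour_length_conv_walk_length:
  assumes "c \<noteq> []"
  shows "tour_length V E c = walk_length (graph_dist V E) (last c) c"
proof -
  obtain z zs where c: "c = z # zs" using assms by (cases c) auto
  have "tour_length V E c =
    (\<Sum>i<length zs. graph_dist V E (c ! i) (c ! Suc i)) + graph_dist V E (c ! length zs) z"
    unfolding tour_length_def by (simp add: c)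
  also have "c ! length zs = last c" by (simp add: c last_conv_nth)
  finally show ?thesis using walk_length_conv_sum[of "graph_dist V E" z zs] by (simp add: c)
qed

lemma tsp_tour_of_closed_walk:
  assumes "simple_graph V E" "connected_graph V E" "3 \<le> card V" "k ` A \<subseteq> E"
    and walk: "walk k u s" "walk_end u s = u" "fst ` set s \<subseteq> A" "insert u (snd ` set s) = V"
  shows "\<exists>c. tsp_tour V c \<and> tour_length V E c \<le> length s"
proof -
  have fin: "finite V" using assms(1) by (simp add: simple_graph_def)
  have "s \<noteq> []" using walk(4) assms(3) by auto
  \<comment> \<open>The start \<open>u\<close> is not listed separately: the walk is closed, so
    \<open>u\<close> reappears as its last vertex.\<close>
  define w where "w = map snd s"
  have w: "w \<noteq> []" "last w = u" "set w = V"
  proof -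
    show "w \<noteq> []" using \<open>s \<noteq> []\<close> by (simp add: w_def)
    then show "last w = u" using walk(2) by (simp add: walk_end_def w_def)
    then have "u \<in> set w" using \<open>w \<noteq> []\<close> last_in_set by metis
    then show "set w = V" using walk(4) by (auto simp: w_def)
  qed
  define c where "c = remdups w"
  have c: "c \<noteq> []" "last c = u" "set c = V" "distinct c"
    using w by (simp_all add: c_def last_remdups_eq)
  have len: "length c = card V" using distinct_card[OF c(4)] c(3) by simp
  have "{c ! i, c ! (Suc i mod length c)} \<in> complete_edges V" if i: "i < length c" for i
  proof -
    have "Suc i mod length c < length c" "Suc i mod length c \<noteq> i"
      using i len assms(3) by (auto simp: mod_Suc)
    then show ?thesis using i c(3,4) by (auto simp: complete_edges_def nth_eq_iff_index_eq)
  qed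
  then have "tsp_tour V c"
    using c(3,4) len assms(3) by (simp add: tsp_tour_def hamiltonian_cycle_def)
  moreover have "tour_length V E c \<le> length s"
  proof -
    have "tour_length V E c = walk_length (graph_dist V E) u c"
      using tour_length_conv_walk_length[OF c(1)] c(2) by simp
    also have "\<dots> \<le> walk_length (graph_dist V E) u w"
      unfolding c_def using walk(4) w(3)
      by (intro walk_length_remdups[where V = V] graph_dist_triangle[OF assms(2)]) auto
    also have "\<dots> \<le> length s"
    proof -
      have "walk_length (graph_dist V E) u (map snd s) \<le> length s"
        if "walk k u s" "k ` A \<subseteq> E" "fst ` set s \<subseteq> A" "u \<in> V" "snd ` set s \<subseteq> V" for k u s
        using that
      proof (induction k u s rule: walk.induct)
        case (2 k' u e v s)
        then have "k' e = {u, v}" "e \<in> A" by auto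
        then have "{u, v} \<in> E" using \<open>k' ` A \<subseteq> E\<close> by (metis image_subset_iff)
        then have "graph_dist V E u v \<le> 1" using 2 by (intro graph_dist_edge) auto
        then show ?case using 2 by auto
      qed simp
      then show ?thesis using walk assms(4) w(3) unfolding w_def by blast
    qed
    finally show ?thesis .
  qed
  ultimately show ?thesis by blast
qed

text \<open>Fewer than \<open>c\<close> connecting edges means that 2 t <= 2 c - 2. This is the
  origin of the final -2 in the bound, here multiplied by 3.\<close>

lemma doubled_edges_bound: "3 * (f + 2 * c) \<le> 4 * n \<Longrightarrow> t < c \<Longrightarrow> 3 * (f + 2 * t) + 6 \<le> 4 * n" for n :: nat
  by presburger

theorem theorem2:
  fixes V :: "'a set" and E :: "'a set set"
  assumes "simple_graph V E"
    and "connected_graph V E"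
    and "bridgeless V E"
    and "cubic V E"
    and "card V \<ge> 6"
  shows "(\<exists>c. tsp_tour V c \<and> real (tour_length V E c) \<le> 4 / 3 * real (card V) - 2) \<and>
         (\<exists>F. spanning_eulerian V E F \<and> real (size F) \<le> 4 / 3 * real (card V) - 2)"
proof -
  have mg: "mgraph V E id" using assms(1) by (rule simple_graph_mgraph)
  have G: "cubic_2ec V E id" using assms(1-4) by (rule cubic_bridgeless_cubic_2ec)
  obtain F where F: "even_sub V E id F" "3 * (card F + 2 * ncomp V id F) \<le> 4 * card V"
    using small_even_subgraph[OF G _ assms(5)] by auto
  have FE: "F \<subseteq> E" using F(1) by (simp add: even_sub_def)
  have V: "V \<noteq> {}" using assms(5) by auto
  have conn: "(u, v) \<in> (adj id E)\<^sup>*" if "u \<in> V" "v \<in> V" for u v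
    using that assms(2) connected_graph_iff[OF mg] by blast
  obtain T where T: "T \<subseteq> E" "T \<inter> F = {}" "card T < ncomp V id F"
    "\<And>u v. u \<in> V \<Longrightarrow> v \<in> V \<Longrightarrow> (u, v) \<in> (adj id (F \<union> T))\<^sup>*"
    using connecting_edges[OF mg conn FE V] by blast
  have fin: "finite F" "finite T" using mg FE T(1) by (auto simp: mgraph_def intro: finite_subset)
  have bound: "real (card F + 2 * card T) \<le> 4 / 3 * real (card V) - 2"
  proof -
    have "3 * (card F + 2 * card T) + 6 \<le> 4 * card V" by (rule doubled_edges_bound[OF F(2) T(3)])
    then have "real (3 * (card F + 2 * card T) + 6) \<le> real (4 * card V)" by (simp only: of_nat_le_iff)
    then show ?thesis by simp
  qed
  \<comment> \<open>The edges of \<open>T\<close> occur twice, so they connect the components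
    without changing any parity.\<close>
  define H where "H = mset_set F + (mset_set T + mset_set T)"
  have set_H: "set_mset H = F \<union> T" using fin by (simp add: H_def)
  have "spanning_eulerian V E H"
    unfolding spanning_eulerian_def
  proof (intro conjI ballI)
    show "set_mset H \<subseteq> E" using set_H FE T(1) by simp
    have "mgraph V (F \<union> T) id" using mg FE T(1) by (intro mgraph_subset[OF mg]) blast
    then show "connected_graph V (set_mset H)" using connected_graph_iff V T(4) set_H by metis
  next
    fix v assume v: "v \<in> V"
    have "size {#e \<in># H. v \<in> e#} = card (inc id F v) + 2 * card (inc id T v)"
      using fin by (simp add: H_def filter_mset_mset_set inc_def)
    then show "even (size {#e \<in># H. v \<in> e#})" using F(1) v by (simp add: even_sub_def)
  qed
  moreover have "size H = card F + 2 * card T" by (simp add: H_def)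
  ultimately have eulerian: "\<exists>F. spanning_eulerian V E F \<and> real (size F) \<le> 4 / 3 * real (card V) - 2"
    using bound by metis
  \<comment> \<open>A tag distinguishes the two copies of an edge of \<open>T\<close>, so that a
    trail with distinct edges may use both.\<close>
  define A where "A = (F \<union> T) \<times> {False} \<union> T \<times> {True}"
  have finA: "finite A" using fin by (simp add: A_def)
  have mgA: "mgraph V A fst"
  proof -
    have "fst e \<in> E" if "e \<in> A" for e using that FE T(1) by (auto simp: A_def)
    then show ?thesis using mg finA by (simp add: mgraph_def)
  qed
  have even: "even (card (inc fst A v))" if "v \<in> V" for v
  proof -
    have "inc fst A v = inc id F v \<times> {False} \<union> (inc id T v \<times> {False} \<union> inc id T v \<times> {True})"
      by (auto simp: inc_def A_def)
    also have "card \<dots> = card (inc id F v) + 2 * card (inc id T v)"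
      using fin T(2) by (subst card_Un_disjoint | force simp: inc_def card_cartesian_product)+
    finally show ?thesis using F(1) that unfolding even_sub_def by (metis even_add even_mult_iff even_numeral)
  qed
  have connA: "(u, v) \<in> (adj fst A)\<^sup>*" if "u \<in> V" "v \<in> V" for u v
  proof -
    have "\<exists>e'\<in>A. fst e' = e" if "e \<in> F \<union> T" for e
      using that by (intro bexI[of _ "(e, False)"]) (auto simp: A_def)
    then have "adj id (F \<union> T) \<subseteq> adj fst A" unfolding adj_def by auto
    then show ?thesis using T(4)[OF that] rtrancl_mono by blast
  qed
  obtain u s where s: "walk fst u s" "walk_end u s = u" "fst ` set s \<subseteq> A" "insert u (snd ` set s) = V"
    "length s \<le> card A"
    by (rule closed_covering_walk[OF mgA V connA even])
  have "card A = card F + 2 * card T"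
    using fin T(2) unfolding A_def
    by (subst card_Un_disjoint | force simp: card_cartesian_product card_Un_disjoint Int_commute)+
  moreover have "fst ` A \<subseteq> E" using FE T(1) by (auto simp: A_def)
  then obtain c where "tsp_tour V c" "tour_length V E c \<le> length s"
    using tsp_tour_of_closed_walk[OF assms(1,2) _ _ s(1-4)] assms(5) by auto
  ultimately have "\<exists>c. tsp_tour V c \<and> real (tour_length V E c) \<le> 4 / 3 * real (card V) - 2"
    using bound s(5) by (intro exI[of _ c]) linarith
  then show ?thesis using eulerian by blast
qed

end
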